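(* Let $\lambda\in\mathrm{Par}_n^{\le 2}$ and $\mathfrak t\in\mathrm{Std}(\lambda)$. Then for all $i=1,2,\dots,n$ we have, in $\Delta^{\mathbb Q}(\lambda)$, $$f_{\mathfrak t}\,\mathbf L_i=c_{\mathfrak t}(i)\,f_{\mathfrak t}.$$
   Context: **Temperley-Lieb algebra.** $\mathsf{TL}_n^{\mathbb Q}$ is the $\mathbb Q$-algebra with basis the non-crossing planar matchings (diagrams) of $n$ top and $n$ bottom points; $D_1D_2$ is the concatenation with $D_1$ on top of $D_2$, each closed loop being replaced by the scalar $2$. $u_i$ ($1\le i<n$) is the diagram joining the top points $i,i+1$, joining the bottom points $i,i+1$, and with vertical lines elsewhere. More generally, let $\mathrm{Hom}(a,b)$ be the $\mathbb Q$-span of non-crossing matchings with $a$ top and $b$ bottom points, composed in the same way. $\mathbf{JW}_m\in\mathsf{TL}_m^{\mathbb Q}$ is the Jones-Wenzl idempotent: the unique nonzero idempotent with $u_i\mathbf{JW}_m=\mathbf{JW}_mu_i=0$ for all $i$. **Jucys-Murphy elements.** $\Phi:\mathbb Q\mathfrak S_n\to\mathsf{TL}_n^{\mathbb Q}$ is the surjective algebra homomorphism with $\Phi((i,i+1))=u_i-1$. $L_1=0$, $L_i=(1,i)+(2,i)+\dots+(i-1,i)$ for $i\ge2$, and $\mathbf L_i:=\Phi(L_i)$. (Permutations are multiplied from left to right, acting on the right.) **Tableaux.** $\mathrm{Par}_n^{\le2}$ is the set of partitions of $n$ whose Young diagram has at most two columns; $\mathrm{Std}(\lambda)$ is the set of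 standard $\lambda$-tableaux. The content is $c_{\mathfrak t}(i)=c-r$ if $i$ is in row $r$ and column $c$ of $\mathfrak t$. **Cell module.** For $\lambda=(2^{l_2},1^{l_1-l_2})\in\mathrm{Par}_n^{\le2}$, $\Delta^{\mathbb Q}(\lambda)$ is the quotient of $\mathrm{Hom}(l_1-l_2,n)$ by the span of those diagrams in which two top points are joined; $\mathsf{TL}_n^{\mathbb Q}$ acts on the right by concatenation below. **The elements $f_{\mathfrak t}$.** A two-column standard tableau $\mathfrak t$ determines a unique sequence of consecutive blocks of consecutive integers $D_1,M_1,D_2,M_2,\dots,D_k,M_k$ (in increasing order, with union $\{1,\dots,n\}$), all non-empty except that $M_k$ may be empty, such that the $D_i$ lie in the first column and the $M_i$ in the second. Put $d_i=|D_i|$, $m_i=|M_i|$, $n_i=(d_1+\dots+d_i)-(m_1+\dots+m_{i-1})$. Define $g_0$ to be the empty diagram and, recursively for $i=1,\dots,k$: juxtapose $d_i$ vertical lines to the right of $g_{i-1}$; multiply on top by $\mathbf{JW}_{n_i}$; then bend the $m_i$ rightmost top strands around to the right and down to the bottom (without crossings), producing $m_i$ new rightmost bottom points; the result is $g_i\in\mathrm{Hom}(n_i-m_i,\sum_{j\le i}(d_j+m_j))$. Then $f_{\mathfrak t}:=g_k$, considered in $\Delta^{\mathbb Q}(\lambda)$ where $\lambda$ is the shape of $\mathfrak t$. *)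

theory Defs
  imports
    Complex_Main
    "HOL-Library.Poly_Mapping"
    "HOL-Library.Disjoint_Sets"
    "HOL-Combinatorics.Permutations"
begin

section \<open>Formal linear combinations\<close>

text \<open>
  The \<open>\<rat>\<close>-vector space with basis (a set of elements of) a type \<open>'a\<close> consists of the finitely
  supported functions \<open>'a \<Rightarrow>\<^sub>0 rat\<close>; the basis vector of \<open>a\<close> is \<open>Poly_Mapping.single a 1\<close>.
\<close>

definition scale :: "rat \<Rightarrow> ('a \<Rightarrow>\<^sub>0 rat) \<Rightarrow> ('a \<Rightarrow>\<^sub>0 rat)" where
  "scale c x = Poly_Mapping.map ((*) c) x"

definition lin_ext :: "('a \<Rightarrow> ('b \<Rightarrow>\<^sub>0 rat)) \<Rightarrow> ('a \<Rightarrow>\<^sub>0 rat) \<Rightarrow> ('b \<Rightarrow>\<^sub>0 rat)" where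
  "lin_ext \<phi> x = (\<Sum>a\<in>Poly_Mapping.keys x. scale (Poly_Mapping.lookup x a) (\<phi> a))"

definition bilin_ext ::
    "('a \<Rightarrow> 'b \<Rightarrow> ('c \<Rightarrow>\<^sub>0 rat)) \<Rightarrow> ('a \<Rightarrow>\<^sub>0 rat) \<Rightarrow> ('b \<Rightarrow>\<^sub>0 rat) \<Rightarrow> ('c \<Rightarrow>\<^sub>0 rat)" where
  "bilin_ext \<beta> x y =
     (\<Sum>a\<in>Poly_Mapping.keys x. \<Sum>b\<in>Poly_Mapping.keys y.
        scale (Poly_Mapping.lookup x a * Poly_Mapping.lookup y b) (\<beta> a b))"


section \<open>Non-crossing matchings and the spaces Hom(a,b)\<close>

text \<open>Points are numbered from 1, from left to right, on both the top and the bottom line.\<close>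

datatype point = Top nat | Bot nat

type_synonym diagram = "point set set"

definition points :: "nat \<Rightarrow> nat \<Rightarrow> point set" where
  "points a b = Top ` {1..a} \<union> Bot ` {1..b}"

text \<open>
  Clockwise order of the points on the boundary of the strip, cut open at the left side: the top
  points from left to right, followed by the bottom points from right to left.
\<close>

fun before :: "point \<Rightarrow> point \<Rightarrow> bool" where
  "before (Top i) (Top j) \<longleftrightarrow> i < j"
| "before (Top i) (Bot j) \<longleftrightarrow> True"
| "before (Bot i) (Top j) \<longleftrightarrow> False"
| "before (Bot i) (Bot j) \<longleftrightarrow> j < i"

definition noncrossing :: "diagram \<Rightarrow> bool" where
  "noncrossing D \<longleftrightarrow>
     \<not> (\<exists>p q r s. {p, q} \<in> D \<and> {r, s} \<in> D \<and> before p r \<and> before r q \<and> before q s)"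

definition diagrams :: "nat \<Rightarrow> nat \<Rightarrow> diagram set" where
  "diagrams a b =
     {D. partition_on (points a b) D \<and> (\<forall>A\<in>D. card A = 2) \<and> noncrossing D}"

definition Hom :: "nat \<Rightarrow> nat \<Rightarrow> (diagram \<Rightarrow>\<^sub>0 rat) set" where
  "Hom a b = {x. Poly_Mapping.keys x \<subseteq> diagrams a b}"


section \<open>Concatenation\<close>

text \<open>
  In the concatenation of \<open>D1\<close> (on top) with \<open>D2\<close>, the bottom points of \<open>D1\<close> are identified with the
  top points of \<open>D2\<close> (the middle points).  The connected components of the resulting graph that
  contain top or bottom points are the arcs of the composite; the others are the closed loops.
\<close>

datatype stacked_point = Upper nat | Middle nat | Lower nat

fun in_upper :: "point \<Rightarrow> stacked_point" where
  "in_upper (Top i) = Upper i"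
| "in_upper (Bot i) = Middle i"

fun in_lower :: "point \<Rightarrow> stacked_point" where
  "in_lower (Top i) = Middle i"
| "in_lower (Bot i) = Lower i"

fun outer :: "point \<Rightarrow> stacked_point" where
  "outer (Top i) = Upper i"
| "outer (Bot i) = Lower i"

definition stacked_arcs :: "diagram \<Rightarrow> diagram \<Rightarrow> stacked_point set set" where
  "stacked_arcs D1 D2 = ((`) in_upper) ` D1 \<union> ((`) in_lower) ` D2"

definition stacked_components :: "diagram \<Rightarrow> diagram \<Rightarrow> stacked_point set set" where
  "stacked_components D1 D2 =
     \<Union> (stacked_arcs D1 D2) // {(p, q). {p, q} \<in> stacked_arcs D1 D2}\<^sup>*"

definition concat_diagram :: "diagram \<Rightarrow> diagram \<Rightarrow> diagram" where
  "concat_diagram D1 D2 = (\<lambda>K. outer -` K) ` stacked_components D1 D2 - {{}}"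

definition closed_loops :: "diagram \<Rightarrow> diagram \<Rightarrow> nat" where
  "closed_loops D1 D2 = card {K \<in> stacked_components D1 D2. outer -` K = {}}"

text \<open>\<open>x \<odot> y\<close> is the composite of \<open>x \<in> Hom a m\<close> (on top) and \<open>y \<in> Hom m b\<close> in \<open>Hom a b\<close>.\<close>

definition dmult ::
    "(diagram \<Rightarrow>\<^sub>0 rat) \<Rightarrow> (diagram \<Rightarrow>\<^sub>0 rat) \<Rightarrow> (diagram \<Rightarrow>\<^sub>0 rat)" (infixl \<open>\<odot>\<close> 70) where
  "dmult = bilin_ext (\<lambda>D1 D2.
     Poly_Mapping.single (concat_diagram D1 D2) (2 ^ closed_loops D1 D2))"


section \<open>The Temperley-Lieb algebra and the Jones-Wenzl idempotents\<close>

definition TL :: "nat \<Rightarrow> (diagram \<Rightarrow>\<^sub>0 rat) set" where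
  "TL n = Hom n n"

definition vertical_lines :: "nat set \<Rightarrow> diagram" where
  "vertical_lines J = (\<lambda>j. {Top j, Bot j}) ` J"

definition TL_one :: "nat \<Rightarrow> (diagram \<Rightarrow>\<^sub>0 rat)" where
  "TL_one n = Poly_Mapping.single (vertical_lines {1..n}) 1"

definition TL_u :: "nat \<Rightarrow> nat \<Rightarrow> (diagram \<Rightarrow>\<^sub>0 rat)" where
  "TL_u n i = Poly_Mapping.single
     ({{Top i, Top (i + 1)}, {Bot i, Bot (i + 1)}} \<union> vertical_lines ({1..n} - {i, i + 1})) 1"

definition JW :: "nat \<Rightarrow> (diagram \<Rightarrow>\<^sub>0 rat)" where
  "JW m = (THE x. x \<in> TL m \<and> x \<noteq> 0 \<and> x \<odot> x = x \<and>
     (\<forall>i\<in>{1..<m}. TL_u m i \<odot> x = 0 \<and> x \<odot> TL_u m i = 0))"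


section \<open>The symmetric group and the Jucys-Murphy elements\<close>

definition QS :: "nat \<Rightarrow> ((nat \<Rightarrow> nat) \<Rightarrow>\<^sub>0 rat) set" where
  "QS n = {x. Poly_Mapping.keys x \<subseteq> {w. w permutes {1..n}}}"

text \<open>Permutations act on the right, so the product \<open>w v\<close> means: first \<open>w\<close>, then \<open>v\<close>.\<close>

definition gmult ::
    "((nat \<Rightarrow> nat) \<Rightarrow>\<^sub>0 rat) \<Rightarrow> ((nat \<Rightarrow> nat) \<Rightarrow>\<^sub>0 rat) \<Rightarrow> ((nat \<Rightarrow> nat) \<Rightarrow>\<^sub>0 rat)" where
  "gmult = bilin_ext (\<lambda>w v. Poly_Mapping.single (v \<circ> w) 1)"

definition transp :: "nat \<Rightarrow> nat \<Rightarrow> ((nat \<Rightarrow> nat) \<Rightarrow>\<^sub>0 rat)" where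
  "transp i j = Poly_Mapping.single (Transposition.transpose i j) 1"

definition is_alg_hom ::
    "nat \<Rightarrow> (((nat \<Rightarrow> nat) \<Rightarrow>\<^sub>0 rat) \<Rightarrow> (diagram \<Rightarrow>\<^sub>0 rat)) \<Rightarrow> bool" where
  "is_alg_hom n \<phi> \<longleftrightarrow>
     (\<forall>x\<in>QS n. \<phi> x \<in> TL n) \<and>
     (\<forall>x\<in>QS n. \<forall>y\<in>QS n. \<phi> (x + y) = \<phi> x + \<phi> y) \<and>
     (\<forall>c. \<forall>x\<in>QS n. \<phi> (scale c x) = scale c (\<phi> x)) \<and>
     (\<forall>x\<in>QS n. \<forall>y\<in>QS n. \<phi> (gmult x y) = \<phi> x \<odot> \<phi> y) \<and>
     \<phi> (Poly_Mapping.single id 1) = TL_one n"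

text \<open>
  Since the simple transpositions generate the symmetric group, any two choices agree on \<open>QS n\<close>;
  surjectivity onto \<open>TL n\<close> is a property of this homomorphism and is not needed to single it out.
\<close>

definition \<Phi> :: "nat \<Rightarrow> ((nat \<Rightarrow> nat) \<Rightarrow>\<^sub>0 rat) \<Rightarrow> (diagram \<Rightarrow>\<^sub>0 rat)" where
  "\<Phi> n = (SOME \<phi>. is_alg_hom n \<phi> \<and>
     (\<forall>i\<in>{1..<n}. \<phi> (transp i (i + 1)) = TL_u n i - TL_one n))"

definition JM :: "nat \<Rightarrow> ((nat \<Rightarrow> nat) \<Rightarrow>\<^sub>0 rat)" where
  "JM i = (\<Sum>j\<in>{1..<i}. transp j i)"

definition TL_JM :: "nat \<Rightarrow> nat \<Rightarrow> (diagram \<Rightarrow>\<^sub>0 rat)" where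
  "TL_JM n i = \<Phi> n (JM i)"


section \<open>Partitions and tableaux\<close>

text \<open>A partition is the list of its parts, i.e. of the row lengths of its Young diagram.\<close>

definition Par :: "nat \<Rightarrow> nat list set" where
  "Par n = {lam. sorted_wrt (\<ge>) lam \<and> 0 \<notin> set lam \<and> sum_list lam = n}"

definition young :: "nat list \<Rightarrow> (nat \<times> nat) set" where
  "young lam = {(r, c). 1 \<le> r \<and> r \<le> length lam \<and> 1 \<le> c \<and> c \<le> lam ! (r - 1)}"

definition Par2 :: "nat \<Rightarrow> nat list set" where
  "Par2 n = {lam \<in> Par n. \<forall>(r, c)\<in>young lam. c \<le> 2}"

definition column_length :: "nat list \<Rightarrow> nat \<Rightarrow> nat" where
  "column_length lam c = card {r. (r, c) \<in> young lam}"

text \<open>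
  A tableau maps the box in row \<open>r\<close> and column \<open>c\<close> to its entry; its values outside the Young
  diagram are irrelevant.
\<close>

definition Std :: "nat list \<Rightarrow> (nat \<times> nat \<Rightarrow> nat) set" where
  "Std lam = {t. bij_betw t (young lam) {1..sum_list lam} \<and>
     (\<forall>r c c'. (r, c) \<in> young lam \<and> (r, c') \<in> young lam \<and> c < c' \<longrightarrow> t (r, c) < t (r, c')) \<and>
     (\<forall>r r' c. (r, c) \<in> young lam \<and> (r', c) \<in> young lam \<and> r < r' \<longrightarrow> t (r, c) < t (r', c))}"

definition row_of :: "nat list \<Rightarrow> (nat \<times> nat \<Rightarrow> nat) \<Rightarrow> nat \<Rightarrow> nat" where
  "row_of lam t i = fst (inv_into (young lam) t i)"

definition col_of :: "nat list \<Rightarrow> (nat \<times> nat \<Rightarrow> nat) \<Rightarrow> nat \<Rightarrow> nat" where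
  "col_of lam t i = snd (inv_into (young lam) t i)"

definition content :: "nat list \<Rightarrow> (nat \<times> nat \<Rightarrow> nat) \<Rightarrow> nat \<Rightarrow> int" where
  "content lam t i = int (col_of lam t i) - int (row_of lam t i)"


section \<open>Cell modules\<close>

definition top_strands :: "nat list \<Rightarrow> nat" where
  "top_strands lam = column_length lam 1 - column_length lam 2"

definition top_cups :: "nat list \<Rightarrow> (diagram \<Rightarrow>\<^sub>0 rat) set" where
  "top_cups lam = {x \<in> Hom (top_strands lam) (sum_list lam).
     \<forall>D\<in>Poly_Mapping.keys x. \<exists>i j. {Top i, Top j} \<in> D}"

text \<open>
  The elements of the cell module are the cosets of \<open>top_cups lam\<close>, a subspace stable under the
  right action, so the unions below are again cosets.
\<close>

definition cell_class :: "nat list \<Rightarrow> (diagram \<Rightarrow>\<^sub>0 rat) \<Rightarrow> (diagram \<Rightarrow>\<^sub>0 rat) set" where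
  "cell_class lam x = (\<lambda>v. x + v) ` top_cups lam"

definition cell_module :: "nat list \<Rightarrow> (diagram \<Rightarrow>\<^sub>0 rat) set set" (\<open>\<Delta>\<close>) where
  "\<Delta> lam = cell_class lam ` Hom (top_strands lam) (sum_list lam)"

definition cell_act ::
    "nat list \<Rightarrow> (diagram \<Rightarrow>\<^sub>0 rat) set \<Rightarrow> (diagram \<Rightarrow>\<^sub>0 rat) \<Rightarrow> (diagram \<Rightarrow>\<^sub>0 rat) set" where
  "cell_act lam K y = (\<Union>x\<in>K. cell_class lam (x \<odot> y))"

definition cell_scale ::
    "nat list \<Rightarrow> rat \<Rightarrow> (diagram \<Rightarrow>\<^sub>0 rat) set \<Rightarrow> (diagram \<Rightarrow>\<^sub>0 rat) set" where
  "cell_scale lam q K = (\<Union>x\<in>K. cell_class lam (scale q x))"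


section \<open>The elements attached to standard tableaux\<close>

definition is_block_decomposition ::
    "nat list \<Rightarrow> (nat \<times> nat \<Rightarrow> nat) \<Rightarrow> (nat list \<times> nat list) list \<Rightarrow> bool" where
  "is_block_decomposition lam t bs \<longleftrightarrow>
     concat (map (\<lambda>(D, M). D @ M) bs) = [1..<Suc (sum_list lam)] \<and>
     (\<forall>(D, M)\<in>set bs. D \<noteq> []) \<and>
     (\<forall>(D, M)\<in>set (butlast bs). M \<noteq> []) \<and>
     (\<forall>(D, M)\<in>set bs. (\<forall>i\<in>set D. col_of lam t i = 1) \<and> (\<forall>i\<in>set M. col_of lam t i = 2))"

definition blocks :: "nat list \<Rightarrow> (nat \<times> nat \<Rightarrow> nat) \<Rightarrow> (nat list \<times> nat list) list" where
  "blocks lam t = (THE bs. is_block_decomposition lam t bs)"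

text \<open>\<open>juxtapose a b d\<close> maps \<open>Hom a b\<close> to \<open>Hom (a + d) (b + d)\<close>.\<close>

definition juxtapose ::
    "nat \<Rightarrow> nat \<Rightarrow> nat \<Rightarrow> (diagram \<Rightarrow>\<^sub>0 rat) \<Rightarrow> (diagram \<Rightarrow>\<^sub>0 rat)" where
  "juxtapose a b d = lin_ext (\<lambda>D.
     Poly_Mapping.single (D \<union> (\<lambda>j. {Top (a + j), Bot (b + j)}) ` {1..d}) 1)"

text \<open>
  \<open>bend a b m\<close> maps \<open>Hom a b\<close> to \<open>Hom (a - m) (b + m)\<close>: the top points \<open>a, a - 1, \<dots>, a - m + 1\<close>
  become the bottom points \<open>b + 1, b + 2, \<dots>, b + m\<close>, in this order.
\<close>

fun bend_point :: "nat \<Rightarrow> nat \<Rightarrow> nat \<Rightarrow> point \<Rightarrow> point" where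
  "bend_point a b m (Top j) = (if j \<le> a - m then Top j else Bot (b + (a + 1 - j)))"
| "bend_point a b m (Bot j) = Bot j"

definition bend ::
    "nat \<Rightarrow> nat \<Rightarrow> nat \<Rightarrow> (diagram \<Rightarrow>\<^sub>0 rat) \<Rightarrow> (diagram \<Rightarrow>\<^sub>0 rat)" where
  "bend a b m = lin_ext (\<lambda>D. Poly_Mapping.single ((`) (bend_point a b m) ` D) 1)"

text \<open>
  \<open>g_from a b g\<close> runs the recursion for the remaining block sizes \<open>(d, m)\<close>, starting from
  \<open>g \<in> Hom a b\<close>; thus \<open>a + d\<close> is the number of strands on which the Jones-Wenzl idempotent is put.
\<close>

fun g_from ::
    "nat \<Rightarrow> nat \<Rightarrow> (diagram \<Rightarrow>\<^sub>0 rat) \<Rightarrow> (nat \<times> nat) list \<Rightarrow> (diagram \<Rightarrow>\<^sub>0 rat)" where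
  "g_from a b g [] = g"
| "g_from a b g ((d, m) # bs) =
     g_from (a + d - m) (b + d + m)
       (bend (a + d) (b + d) m (JW (a + d) \<odot> juxtapose a b d g)) bs"

definition f_diag :: "nat list \<Rightarrow> (nat \<times> nat \<Rightarrow> nat) \<Rightarrow> (diagram \<Rightarrow>\<^sub>0 rat)" where
  "f_diag lam t = g_from 0 0 (Poly_Mapping.single {} 1)
     (map (\<lambda>(D, M). (length D, length M)) (blocks lam t))"

definition f_tab :: "nat list \<Rightarrow> (nat \<times> nat \<Rightarrow> nat) \<Rightarrow> (diagram \<Rightarrow>\<^sub>0 rat) set" where
  "f_tab lam t = cell_class lam (f_diag lam t)"

end

theory Submission
  imports Defs
begin

text \<open>
  A diagram from \<open>a\<close> to \<open>b\<close> points acts as a matrix indexed by spin colourings of the two boundary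
  lines: the entry is nonzero if every cup and cap joins opposite spins and every through strand
  joins equal spins, and it carries a sign which makes \<open>u\<^sub>i - 1\<close> act as minus the exchange of the
  positions \<open>i\<close> and \<open>i + 1\<close>.  This realisation is multiplicative and faithful.  It turns permutations
  into place permutations (up to sign) and \<open>JW\<^sub>m\<close> into the symmetriser.

  Every matrix in the image is \<open>GL\<^sub>2\<close>-equivariant up to a power of the determinant.  Hence the sum of
  the transpositions of a new bottom point with those to its left can be pulled through to the top
  points, where the symmetry under the Jones-Wenzl idempotent evaluates it: \<open>L\<^sub>i\<close> acts by \<open>1 - r\<close> on a
  strand added at the right and by \<open>2 - r\<close> on a strand bent down, where \<open>r\<close> is the resulting length of
  the first or second column.  The eigenvalue equation therefore holds already in the space of
  diagrams, before passing to the cell module.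
\<close>

section \<open>Non-crossing pairings\<close>

text \<open>The loop value 2 is the dimension of the spin space, and a cup or cap is the alternating
  form on it, which scales by the determinant. This is the source of the constant (b - a) / 2
  attached to Hom(a,b); in the recursion it equals the number of entries already placed in column 2.

  The sum of the exchanges of one tensor factor with the others is the split Casimir element, a sum
  of matrix units \<open>E_xy\<close> on the others paired with \<open>E_yx\<close> on the chosen
  one, and equivariance moves the first factor to the top. On an added strand the result is again a
  sum of exchanges, each of which is 1 below the idempotent. On a bent strand the diagonal and
  off-diagonal units contribute N + (b - a) / 2 and N + 1, where N counts top spins, with opposite
  signs; so N cancels.

  An obstacle is that \<open>\<Phi>\<close> and \<open>JW\<close> are choice terms about which
  nothing is known before existence (and, for \<open>JW\<close>, uniqueness) is proved. Faithfulness
  supplies both, without a presentation of the symmetric group and without a recursion for the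
  idempotents.\<close>

abbreviation swap :: "nat \<Rightarrow> nat \<Rightarrow> nat \<Rightarrow> nat" where
  "swap \<equiv> Transposition.transpose"

abbreviation coeff :: "('a \<Rightarrow>\<^sub>0 rat) \<Rightarrow> 'a \<Rightarrow> rat" where
  "coeff \<equiv> Poly_Mapping.lookup"

text \<open>The order is a parameter because the same lemmas serve \<open>before\<close> on one
  diagram and \<open>stacked_before\<close> on two stacked ones.\<close>

definition strict_linear :: "('a \<Rightarrow> 'a \<Rightarrow> bool) \<Rightarrow> bool" where
  "strict_linear lt \<longleftrightarrow> (\<forall>x. \<not> lt x x) \<and> (\<forall>x y z. lt x y \<longrightarrow> lt y z \<longrightarrow> lt x z) \<and>
     (\<forall>x y. x \<noteq> y \<longrightarrow> lt x y \<or> lt y x)"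

text \<open>A diagram is handled through its mate function instead of its set of blocks: contraction
  then is a function update and relabelling a conjugation.\<close>

definition nc :: "('a \<Rightarrow> 'a \<Rightarrow> bool) \<Rightarrow> 'a set \<Rightarrow> ('a \<Rightarrow> 'a) \<Rightarrow> bool" where
  "nc lt S \<pi> \<longleftrightarrow> (\<forall>p\<in>S. \<pi> p \<in> S \<and> \<pi> (\<pi> p) = p \<and> \<pi> p \<noteq> p) \<and>
     (\<forall>p\<in>S. \<forall>r\<in>S. \<not> (lt p r \<and> lt r (\<pi> p) \<and> lt (\<pi> p) (\<pi> r)))"

definition arcs :: "'a set \<Rightarrow> ('a \<Rightarrow> 'a) \<Rightarrow> 'a set set" where
  "arcs S \<pi> = (\<lambda>p. {p, \<pi> p}) ` S"

lemma ncD: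
  assumes "nc lt S \<pi>" "p \<in> S"
  shows "\<pi> p \<in> S" "\<pi> (\<pi> p) = p" "\<pi> p \<noteq> p"
  using assms unfolding nc_def by auto

lemma ncD_cross:
  assumes "nc lt S \<pi>" "p \<in> S" "r \<in> S" "lt p r" "lt r (\<pi> p)" "lt (\<pi> p) (\<pi> r)"
  shows False
  using assms unfolding nc_def by blast

lemma mem_arcs_iff:
  assumes "nc lt S \<pi>"
  shows "{p, q} \<in> arcs S \<pi> \<longleftrightarrow> p \<in> S \<and> q = \<pi> p"
  using ncD[OF assms] unfolding arcs_def by (auto simp: doubleton_eq_iff)

lemma partition_on_arcs:
  assumes "nc lt S \<pi>"
  shows "partition_on S (arcs S \<pi>)"
proof (rule partition_onI)
  show "\<Union> (arcs S \<pi>) = S"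
    using ncD[OF assms] by (auto simp: arcs_def)
next
  fix A B assume "A \<in> arcs S \<pi>" "B \<in> arcs S \<pi>" "A \<noteq> B"
  then obtain x y where "x \<in> S" "y \<in> S" "A = {x, \<pi> x}" "B = {y, \<pi> y}" "A \<noteq> B"
    unfolding arcs_def by blast
  then show "disjnt A B"
    using ncD[OF assms] unfolding disjnt_def by (metis Int_emptyI empty_iff insert_commute insert_iff)
qed (auto simp: arcs_def)

lemma card_arc:
  assumes "nc lt S \<pi>" "A \<in> arcs S \<pi>"
  shows "card A = 2"
proof -
  obtain p where "p \<in> S" "A = {p, \<pi> p}" using assms(2) by (auto simp: arcs_def)
  then show ?thesis using ncD(3)[OF assms(1), of p] by (auto simp: card_insert_if)
qed

lemma arcs_in_diagrams:
  assumes "nc before (points a b) \<pi>"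
  shows "arcs (points a b) \<pi> \<in> diagrams a b"
  unfolding diagrams_def noncrossing_def mem_Collect_eq
proof (intro conjI ballI)
  show "\<nexists>p q r s. {p, q} \<in> arcs (points a b) \<pi> \<and> {r, s} \<in> arcs (points a b) \<pi> \<and>
      before p r \<and> before r q \<and> before q s"
    unfolding mem_arcs_iff[OF assms] using ncD_cross[OF assms] by blast
qed (rule partition_on_arcs[OF assms] card_arc[OF assms], assumption?)+

lemma diagram_arcsE:
  assumes "D \<in> diagrams a b"
  obtains \<pi> where "nc before (points a b) \<pi>" "D = arcs (points a b) \<pi>"
proof -
  have P: "partition_on (points a b) D" and C: "\<And>A. A \<in> D \<Longrightarrow> card A = 2" and N: "noncrossing D"
    using assms by (auto simp: diagrams_def)
  have U: "\<Union>D = points a b" using P by (simp add: partition_on_def)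
  have ex: "\<exists>q. {p, q} \<in> D \<and> q \<noteq> p" if p: "p \<in> points a b" for p
  proof -
    from p U obtain A where A: "A \<in> D" "p \<in> A" by auto
    obtain x y where "A = {x, y}" "x \<noteq> y" using C[OF A(1)] by (meson card_2_iff)
    then show ?thesis using A by (auto simp: insert_commute)
  qed
  define \<pi> where "\<pi> p = (SOME q. {p, q} \<in> D \<and> q \<noteq> p)" for p
  have \<pi>: "{p, \<pi> p} \<in> D" "\<pi> p \<noteq> p" if "p \<in> points a b" for p
    using someI_ex[OF ex[OF that]] unfolding \<pi>_def by auto
  have uniq: "A = B" if "A \<in> D" "B \<in> D" "p \<in> A" "p \<in> B" for A B p
    using P that unfolding partition_on_def disjoint_def by blast
  have inU: "x \<in> points a b" if "{x, y} \<in> D" for x y using that U by auto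
  have m: "q = \<pi> p" if "{p, q} \<in> D" for p q
  proof -
    have "{p, q} = {p, \<pi> p}" using uniq[of "{p,q}" "{p, \<pi> p}" p] \<pi>(1)[OF inU[OF that]] that by auto
    moreover have "p \<noteq> q" using C[OF that] by auto
    ultimately show ?thesis by (auto simp: doubleton_eq_iff)
  qed
  have "nc before (points a b) \<pi>" unfolding nc_def
  proof (intro conjI ballI)
    fix p assume p: "p \<in> points a b"
    show "\<pi> p \<in> points a b" using \<pi>(1)[OF p] inU by (metis insert_commute)
    show "\<pi> (\<pi> p) = p" using m[of "\<pi> p" p] \<pi>(1)[OF p] by (simp add: insert_commute)
    show "\<pi> p \<noteq> p" using \<pi>[OF p] by simp
  next
    fix p r assume "p \<in> points a b" "r \<in> points a b"
    then show "\<not> (before p r \<and> before r (\<pi> p) \<and> before (\<pi> p) (\<pi> r))"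
      using N \<pi>(1) unfolding noncrossing_def by blast
  qed
  moreover have "D = arcs (points a b) \<pi>"
  proof
    show "arcs (points a b) \<pi> \<subseteq> D" using \<pi>(1) by (auto simp: arcs_def)
    show "D \<subseteq> arcs (points a b) \<pi>"
    proof
      fix A assume A: "A \<in> D"
      obtain x y where "A = {x, y}" "x \<noteq> y" using C[OF A(1)] by (meson card_2_iff)
      then show "A \<in> arcs (points a b) \<pi>" using A m inU unfolding arcs_def by blast
    qed
  qed
  ultimately show ?thesis using that by blast
qed

lemma strict_linear_before: "strict_linear before"
proof -
  have "\<not> before x x" for x by (cases x) auto
  moreover have "before x y \<longrightarrow> before y z \<longrightarrow> before x z" for x y z
    by (cases x; cases y; cases z) auto
  moreover have "x \<noteq> y \<longrightarrow> before x y \<or> before y x" for x y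
    by (cases x; cases y) auto
  ultimately show ?thesis unfolding strict_linear_def by blast
qed

lemma finite_points [simp]: "finite (points a b)"
  by (simp add: points_def)

lemma finite_diagrams [simp]: "finite (diagrams a b)"
proof (rule finite_subset)
  show "diagrams a b \<subseteq> Pow (Pow (points a b))"
    by (auto simp: diagrams_def partition_on_def)
qed simp

lemma Top_in_points [simp]: "Top i \<in> points a b \<longleftrightarrow> i \<in> {1..a}"
  by (auto simp: points_def)

lemma Bot_in_points [simp]: "Bot i \<in> points a b \<longleftrightarrow> i \<in> {1..b}"
  by (auto simp: points_def)

lemma card_points: "card (points a b) = a + b"
proof -
  have "card (points a b) = card (Top ` {1..a}) + card (Bot ` {1..b})"
    unfolding points_def by (rule card_Un_disjoint) auto
  then show ?thesis by (simp add: card_image inj_on_def)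
qed

lemma even_card_involution:
  assumes "finite S" "\<And>p. p \<in> S \<Longrightarrow> \<pi> p \<in> S \<and> \<pi> (\<pi> p) = p \<and> \<pi> p \<noteq> p"
  shows "even (card S)"
  using assms
proof (induction "card S" arbitrary: S rule: less_induct)
  case less
  show ?case
  proof (cases "S = {}")
    case False
    then obtain x where x: "x \<in> S" by auto
    let ?T = "S - {x, \<pi> x}"
    have "{x, \<pi> x} \<subseteq> S" "card {x, \<pi> x} = 2" using x less.prems(2)[OF x] by auto
    then have c: "card S = card ?T + 2"
      using card_Diff_subset[of "{x, \<pi> x}" S] card_mono[OF less.prems(1), of "{x, \<pi> x}"] by simp
    have "even (card ?T)"
    proof (rule less.hyps)
      show "card ?T < card S" using c by simp
      show "finite ?T" using less.prems by simp
      show "\<pi> p \<in> ?T \<and> \<pi> (\<pi> p) = p \<and> \<pi> p \<noteq> p" if "p \<in> ?T" for p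
        using that less.prems(2) x by (metis DiffD1 DiffD2 DiffI insert_iff singletonD)
    qed
    then show ?thesis using c by simp
  qed simp
qed

text \<open>If the mate of \<open>x\<close> lay to the right of \<open>\<pi> p\<close>, the arcs
  would cross directly; if it lay to the left of \<open>p\<close>, they would cross when read from
  \<open>\<pi> x\<close>.\<close>

lemma between_closed:
  assumes lt: "strict_linear lt" and n: "nc lt S \<pi>" and "p \<in> S" and x: "x \<in> S" "lt p x" "lt x (\<pi> p)"
  shows "lt p (\<pi> x)" "lt (\<pi> x) (\<pi> p)"
proof -
  have ne: "\<pi> x \<noteq> p" "\<pi> x \<noteq> \<pi> p"
    using x ncD(2)[OF n] assms(3) lt unfolding strict_linear_def by metis+
  have a: "\<not> lt (\<pi> p) (\<pi> x)" using ncD_cross[OF n assms(3) x(1)] x by blast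
  have b: "\<not> lt (\<pi> x) p"
    using ncD_cross[OF n ncD(1)[OF n x(1)] assms(3)] x ncD(2)[OF n x(1)] by auto
  show "lt p (\<pi> x)" "lt (\<pi> x) (\<pi> p)"
    using ne a b lt unfolding strict_linear_def by blast+
qed

text \<open>The points under an arc are paired among themselves.\<close>

lemma even_between:
  assumes lt: "strict_linear lt" and n: "nc lt S \<pi>" and "finite S" "p \<in> S"
  shows "even (card {x \<in> S. lt p x \<and> lt x (\<pi> p)})"
  by (rule even_card_involution[where \<pi> = \<pi>])
    (use assms between_closed[OF lt n assms(4)] ncD[OF n] in auto)

text \<open>The condition \<open>lt p r \<noteq> lt (\<pi> p) r\<close> says that \<open>r\<close>
  lies under the arc of \<open>p\<close>. Unlike the crossing pattern in \<open>nc\<close>, this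
  form is symmetric in the two ends of each arc, so contraction needs no case distinction on their
  order.\<close>

lemma nc_iff_separation:
  assumes lt: "strict_linear lt"
  shows "nc lt S \<pi> \<longleftrightarrow> (\<forall>p\<in>S. \<pi> p \<in> S \<and> \<pi> (\<pi> p) = p \<and> \<pi> p \<noteq> p) \<and>
    (\<forall>p\<in>S. \<forall>r\<in>S. r \<noteq> p \<longrightarrow> r \<noteq> \<pi> p \<longrightarrow>
      (lt p r \<noteq> lt (\<pi> p) r) = (lt p (\<pi> r) \<noteq> lt (\<pi> p) (\<pi> r)))"
    (is "_ \<longleftrightarrow> ?I \<and> ?S")
proof
  have irr: "\<not> lt z z" and tr: "lt z z' \<Longrightarrow> lt z' z'' \<Longrightarrow> lt z z''"
    and tot: "z \<noteq> z' \<Longrightarrow> lt z z' \<or> lt z' z" for z z' z''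
    using lt unfolding strict_linear_def by blast+
  show "?I \<and> ?S" if n: "nc lt S \<pi>"
  proof -
    have imp: "lt p (\<pi> r) \<noteq> lt (\<pi> p) (\<pi> r)"
      if "p \<in> S" "r \<in> S" "r \<noteq> p" "r \<noteq> \<pi> p" "lt p r \<noteq> lt (\<pi> p) r" for p r
    proof (cases "lt p r")
      case True
      then have "lt r (\<pi> p)" using that tot by blast
      then show ?thesis using between_closed[OF lt n that(1,2) True] irr tr by blast
    next
      case False
      then have 1: "lt (\<pi> p) r" "lt r p" using that tot by blast+
      then show ?thesis
        using between_closed[OF lt n ncD(1)[OF n that(1)] that(2)] ncD(2)[OF n that(1)] irr tr by metis
    qed
    have "\<pi> r \<noteq> p" "\<pi> r \<noteq> \<pi> p" if "p \<in> S" "r \<in> S" "r \<noteq> p" "r \<noteq> \<pi> p" for p r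
      using that ncD(2)[OF n] by metis+
    then show ?thesis using imp ncD[OF n] by metis
  qed
  show "nc lt S \<pi>" if "?I \<and> ?S"
    unfolding nc_def
  proof (intro conjI ballI)
    fix p r assume pr: "p \<in> S" "r \<in> S"
    show "\<not> (lt p r \<and> lt r (\<pi> p) \<and> lt (\<pi> p) (\<pi> r))"
      using that pr irr tr by metis
  qed (use that in auto)
qed

section \<open>Parity of the positions joined by an arc\<close>

lemma even_hom:
  assumes "D \<in> diagrams a b" shows "even (a + b)"
proof -
  obtain \<pi> where p: "nc before (points a b) \<pi>" by (rule diagram_arcsE[OF assms])
  have "even (card (points a b))"
    by (rule even_card_involution[where \<pi> = \<pi>]) (use ncD[OF p] in auto)
  then show ?thesis by (simp add: card_points)
qed

text \<open>This is the parity of the position in the clockwise order: \<open>Bot j\<close> stands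
  at place a + b + 1 - j, and a + b is even as soon as a diagram exists.\<close>

fun pol :: "point \<Rightarrow> bool" where
  "pol (Top i) = even i"
| "pol (Bot j) = odd j"

text \<open>An even number of points lies under an arc, so the positions of its ends differ by an
  odd number. The cases only compute that number for the three kinds of arcs.\<close>

lemma pol_mate:
  assumes n: "nc before (points a b) \<pi>" and p: "p \<in> points a b"
  shows "pol (\<pi> p) = (\<not> pol p)"
proof -
  have e: "even (a + b)" using even_hom arcs_in_diagrams[OF n] by blast
  have *: "pol (\<pi> q) = (\<not> pol q)" if q: "q \<in> points a b" "before q (\<pi> q)" for q
  proof -
    have ev: "even (card {x \<in> points a b. before q x \<and> before x (\<pi> q)})" (is "even (card ?B)")
      by (rule even_between[OF strict_linear_before n]) (use q in auto)
    have mq: "\<pi> q \<in> points a b" using ncD[OF n q(1)] by simp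
    show ?thesis
    proof (cases q)
      case (Top i)
      show ?thesis
      proof (cases "\<pi> q")
        case (Top i')
        have "?B = Top ` {i<..<i'}" using q mq Top \<open>q = Top i\<close>
          by (auto simp: points_def image_iff elim!: before.elims)
        then have "card ?B = i' - Suc i" by (simp add: card_image inj_on_def)
        then show ?thesis using ev q Top \<open>q = Top i\<close> by auto
      next
        case (Bot j)
        have "?B = Top ` {i<..a} \<union> Bot ` {j<..b}" using q mq Bot \<open>q = Top i\<close>
          by (auto simp: points_def image_iff elim!: before.elims)
        moreover have "card (Top ` {i<..a} \<union> Bot ` {j<..b}) = (a - i) + (b - j)"
          by (subst card_Un_disjoint) (auto simp: card_image inj_on_def)
        ultimately have "even ((a - i) + (b - j))" using ev by simp
        moreover have "i \<le> a" "j \<le> b" using q mq Bot \<open>q = Top i\<close> by auto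
        ultimately show ?thesis using e Bot \<open>q = Top i\<close> by auto
      qed
    next
      case (Bot j)
      then obtain j' where j': "\<pi> q = Bot j'" using q by (cases "\<pi> q") auto
      have "?B = Bot ` {j'<..<j}" using q mq Bot j'
        by (auto simp: points_def image_iff elim!: before.elims)
      then have "card ?B = j - Suc j'" by (simp add: card_image inj_on_def)
      then show ?thesis using ev q Bot j' by auto
    qed
  qed
  have "before p (\<pi> p) \<or> before (\<pi> p) p"
    using strict_linear_before ncD[OF n p] unfolding strict_linear_def by metis
  then show ?thesis using *[OF p] *[of "\<pi> p"] ncD[OF n p] by auto
qed

text \<open>Every remaining point sees the neighbours \<open>u\<close> and \<open>v\<close> on the
  same side. Hence separation by the new arc from \<open>\<pi> u\<close> to \<open>\<pi> v\<close>
  is the exclusive or of separation by the two old arcs, and the criterion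
  \<open>nc_iff_separation\<close> is inherited. If \<open>u\<close> and \<open>v\<close> are mates,
  the arc is simply dropped.\<close>

lemma nc_contract:
  assumes lt: "strict_linear lt" and n: "nc lt S \<pi>" and u: "u \<in> S" "v \<in> S" "lt u v"
    and adj: "\<And>x. x \<in> S \<Longrightarrow> \<not> (lt u x \<and> lt x v)"
  shows "nc lt (S - {u, v}) (if \<pi> u = v then \<pi> else \<pi>(\<pi> u := \<pi> v, \<pi> v := \<pi> u))"
proof (cases "\<pi> u = v")
  case True
  then have "\<pi> p \<in> S - {u, v}" if "p \<in> S - {u, v}" for p
    using ncD[OF n that[THEN DiffD1]] ncD(2)[OF n u(1)] that True by auto
  then show ?thesis using True n unfolding nc_def by auto
next
  case False
  define x y where "x = \<pi> u" and "y = \<pi> v"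
  have xy: "x \<in> S" "y \<in> S" "\<pi> x = u" "\<pi> y = v" "x \<noteq> y" "x \<noteq> u" "x \<noteq> v" "y \<noteq> u" "y \<noteq> v" "u \<noteq> v"
    using ncD[OF n] u False lt unfolding x_def y_def strict_linear_def by metis+
  have other: "\<pi> p \<in> S - {u, v, x, y}" if "p \<in> S - {u, v, x, y}" for p
  proof -
    have "\<pi> p \<noteq> u" "\<pi> p \<noteq> v" "\<pi> p \<noteq> x" "\<pi> p \<noteq> y"
      using that ncD(2)[OF n, of p] xy x_def y_def by auto
    then show ?thesis using ncD(1)[OF n, of p] that by auto
  qed
  have irr: "\<not> lt z z" and tr: "lt z z' \<Longrightarrow> lt z' z'' \<Longrightarrow> lt z z''" and tot: "z \<noteq> z' \<Longrightarrow> lt z z' \<or> lt z' z" for z z' z''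
    using lt unfolding strict_linear_def by blast+
  have side: "lt u z \<longleftrightarrow> lt v z" "lt z u \<longleftrightarrow> lt z v" if "z \<in> S - {u, v}" for z
    using that adj[of z] tot[of u z] tot[of v z] tr irr u(3) by blast+
  let ?p = "\<pi>(x := y, y := x)"
  have inv: "?p p \<in> S - {u, v} \<and> ?p (?p p) = p \<and> ?p p \<noteq> p" if "p \<in> S - {u, v}" for p
    using that other[of p] xy ncD[OF n, of p] by auto
  have X: "(lt p r \<noteq> lt (\<pi> p) r) = (lt p (\<pi> r) \<noteq> lt (\<pi> p) (\<pi> r))"
    if "p \<in> S" "r \<in> S" "r \<noteq> p" "r \<noteq> \<pi> p" for p r
    using n that unfolding nc_iff_separation[OF lt] by blast
  have cr: "(lt p r \<noteq> lt (?p p) r) = (lt p (?p r) \<noteq> lt (?p p) (?p r))"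
    if p: "p \<in> S - {u, v}" and r: "r \<in> S - {u, v}" and ne: "r \<noteq> p" "r \<noteq> ?p p" for p r
  proof -
    have a: "(lt x z \<noteq> lt y z) = (lt x (\<pi> z) \<noteq> lt y (\<pi> z))" if z: "z \<in> S - {u, v, x, y}" for z
      using X[of u z] X[of v z] z u xy side[of z] side[of "\<pi> z"] other[OF z]
      unfolding x_def[symmetric] y_def[symmetric] by blast
    have b: "(lt z x \<noteq> lt (\<pi> z) x) = (lt z y \<noteq> lt (\<pi> z) y)" if z: "z \<in> S - {u, v, x, y}" for z
      using X[of z u] X[of z v] z u xy side[of z] side[of "\<pi> z"] other[OF z]
      unfolding x_def[symmetric] y_def[symmetric] by blast
    consider "p \<in> {x, y}" "r \<in> {x, y}" | "p \<in> {x, y}" "r \<notin> {x, y}"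
      | "p \<notin> {x, y}" "r \<in> {x, y}" | "p \<notin> {x, y}" "r \<notin> {x, y}" by blast
    then show ?thesis
    proof cases
      case 1 then show ?thesis using ne xy by auto
    next
      case 2
      then show ?thesis using a[of r] r xy by auto
    next
      case 3
      then show ?thesis using b[of p] p xy by auto
    next
      case 4
      then show ?thesis using X[of p r] p r ne by auto
    qed
  qed
  have "nc lt (S - {u, v}) ?p" unfolding nc_iff_separation[OF lt] using inv cr by blast
  then show ?thesis using False by (simp add: x_def y_def)
qed

section \<open>Concatenation of diagrams\<close>

text \<open>Applied to the two relabellings that keep the clockwise order: forgetting the copy tags
  after glueing, and bending, which only moves the place where the boundary is divided into top and
  bottom.\<close>

lemma nc_image:
  assumes n: "nc lt S \<pi>" and inj: "inj_on f S"
    and ord: "\<And>p q. p \<in> S \<Longrightarrow> q \<in> S \<Longrightarrow> lt' (f p) (f q) \<longleftrightarrow> lt p q"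
  shows "nc lt' (f ` S) (f \<circ> \<pi> \<circ> inv_into S f)"
    and "arcs (f ` S) (f \<circ> \<pi> \<circ> inv_into S f) = (`) f ` arcs S \<pi>"
proof -
  have [simp]: "inv_into S f (f p) = p" if "p \<in> S" for p using inj that by simp
  have "f (\<pi> p) \<noteq> f p" if "p \<in> S" for p
    using that ncD[OF n that] inj by (auto dest: inj_onD)
  then show "nc lt' (f ` S) (f \<circ> \<pi> \<circ> inv_into S f)"
    using ncD[OF n] ord ncD_cross[OF n] unfolding nc_def by auto
  show "arcs (f ` S) (f \<circ> \<pi> \<circ> inv_into S f) = (`) f ` arcs S \<pi>"
    unfolding arcs_def image_image by (rule image_cong) auto
qed

text \<open>
  The middle points are kept in two copies, so that two stacked diagrams form one non-crossing
  pairing of a line.  Glueing the copies of \<open>1, 2, \<dots>, m\<close> in this order contracts a pair of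
  neighbouring points at each step.
\<close>

fun stacked_before :: "point + point \<Rightarrow> point + point \<Rightarrow> bool" where
  "stacked_before (Inl p) (Inl q) = before p q"
| "stacked_before (Inl p) (Inr q) = True"
| "stacked_before (Inr p) (Inl q) = False"
| "stacked_before (Inr p) (Inr q) = before p q"

lemma strict_linear_stacked_before: "strict_linear stacked_before"
proof -
  note b = strict_linear_before[unfolded strict_linear_def]
  have "\<not> stacked_before x x" for x using b by (cases x) auto
  moreover have "stacked_before x y \<longrightarrow> stacked_before y z \<longrightarrow> stacked_before x z" for x y z
    using b by (cases x; cases y; cases z) auto
  moreover have "x \<noteq> y \<longrightarrow> stacked_before x y \<or> stacked_before y x" for x y
    using b by (cases x; cases y) auto
  ultimately show ?thesis unfolding strict_linear_def by blast
qed

lemma rtrancl_map_into: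
  assumes "\<And>x y. (x, y) \<in> E \<Longrightarrow> (f x, f y) \<in> R\<^sup>*" "(p, q) \<in> E\<^sup>*"
  shows "(f p, f q) \<in> R\<^sup>*"
  using assms(2)
proof (induction rule: rtrancl_induct)
  case (step y z)
  then show ?case using rtrancl_trans[OF step.IH assms(1)] by simp
qed simp

text \<open>Here \<open>G\<close> holds the identifications still to be made. A new arc stands for
  the old path from \<open>\<pi> u\<close> through \<open>u\<close> and \<open>v\<close> to
  \<open>\<pi> v\<close>; conversely an old path is pushed off \<open>u\<close> and
  \<open>v\<close>.\<close>

lemma contract_reach:
  assumes n: "nc lt S \<pi>" and uv: "u \<in> S" "v \<in> S" "u \<noteq> v"
    and G: "G \<subseteq> (S - {u, v}) \<times> (S - {u, v})"
    and E: "E = (\<lambda>p. (p, \<pi> p)) ` S \<union> {(u, v), (v, u)} \<union> G"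
    and \<pi>': "\<pi>' = (if \<pi> u = v then \<pi> else \<pi>(\<pi> u := \<pi> v, \<pi> v := \<pi> u))"
    and E': "E' = (\<lambda>p. (p, \<pi>' p)) ` (S - {u, v}) \<union> G"
    and pq: "p \<in> S - {u, v}" "q \<in> S - {u, v}"
  shows "(p, q) \<in> E\<^sup>* \<longleftrightarrow> (p, q) \<in> E'\<^sup>*"
proof
  note inv = ncD[OF n]
  have Euv: "(u, v) \<in> E" "(v, u) \<in> E" unfolding E by auto
  have EI: "(x, \<pi> x) \<in> E" if "x \<in> S" for x using that unfolding E by auto
  have ne: "\<pi> u \<noteq> \<pi> v" using inv(2) uv by metis
  have "E' \<subseteq> E\<^sup>*"
  proof
    fix e assume "e \<in> E'"
    then consider "e \<in> G" | x where "x \<in> S - {u, v}" "e = (x, \<pi>' x)" unfolding E' by auto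
    then show "e \<in> E\<^sup>*"
    proof cases
      case 1 then show ?thesis unfolding E by auto
    next
      case (2 x)
      consider "\<pi>' x = \<pi> x" | "x = \<pi> u" "\<pi>' x = \<pi> v" | "x = \<pi> v" "\<pi>' x = \<pi> u"
        using \<pi>' ne by (metis fun_upd_apply)
      then show ?thesis
      proof cases
        case 1 then show ?thesis using 2 EI[of x] by auto
      next
        case a: 2
        have "(x, u) \<in> E" using EI[of x] 2 a inv(2)[OF uv(1)] by auto
        then have "(x, \<pi> v) \<in> E\<^sup>*" using Euv(1) EI[OF uv(2)]
          by (meson converse_rtrancl_into_rtrancl r_into_rtrancl)
        then show ?thesis using 2 a by simp
      next
        case a: 3
        have "(x, v) \<in> E" using EI[of x] 2 a inv(2)[OF uv(2)] by auto
        then have "(x, \<pi> u) \<in> E\<^sup>*" using Euv(2) EI[OF uv(1)]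
          by (meson converse_rtrancl_into_rtrancl r_into_rtrancl)
        then show ?thesis using 2 a by simp
      qed
    qed
  qed
  then show "(p, q) \<in> E\<^sup>*" if "(p, q) \<in> E'\<^sup>*"
    using that rtrancl_subset_rtrancl by blast
next
  note inv = ncD[OF n]
  \<comment> \<open>Retraction of \<open>u\<close> and \<open>v\<close> onto their mates: the arcs
    at \<open>u\<close> and \<open>v\<close> become constant and the edge between them becomes the
    new arc. If they are mates, both collapse to \<open>u\<close>.\<close>
  define h where "h z = (if \<pi> u = v then (if z = v then u else z)
     else if z = u then \<pi> u else if z = v then \<pi> v else z)" for z
  have edge: "(h x, h y) \<in> E'\<^sup>*" if xy: "(x, y) \<in> E" for x y
  proof -
    consider (G) "(x, y) \<in> G" | (uv) "(x, y) \<in> {(u, v), (v, u)}" | (p) "x \<in> S" "y = \<pi> x"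
      using xy unfolding E by blast
    then show ?thesis
    proof cases
      case G
      then have "h x = x" "h y = y" using \<open>G \<subseteq> _\<close> by (auto simp: h_def)
      then show ?thesis using G E' by auto
    next
      case uv': uv
      show ?thesis
      proof (cases "\<pi> u = v")
        case True then show ?thesis using uv' by (auto simp: h_def)
      next
        case False
        have "\<pi> u \<in> S - {u, v}" "\<pi> v \<in> S - {u, v}" "\<pi> u \<noteq> \<pi> v"
          using inv[OF uv(1)] inv[OF uv(2)] False uv(3) by auto
        moreover have "\<pi>' (\<pi> u) = \<pi> v" "\<pi>' (\<pi> v) = \<pi> u"
          unfolding \<pi>' using False calculation by auto
        ultimately have "(\<pi> u, \<pi> v) \<in> E'" "(\<pi> v, \<pi> u) \<in> E'"
          unfolding E' by (metis (no_types, lifting) UnI1 image_eqI)+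
        then show ?thesis using uv' uv(3) False by (auto simp: h_def)
      qed
    next
      case p
      show ?thesis
      proof (cases "x \<in> {u, v} \<or> y \<in> {u, v}")
        case True
        then have "x = u \<or> x = v \<or> x = \<pi> u \<or> x = \<pi> v" "y = \<pi> x"
          using p inv(2)[of x] by auto
        then have "h x = h y" using inv[OF uv(1)] inv[OF uv(2)] uv(3)
          by (auto simp: h_def)
        then show ?thesis by simp
      next
        case False
        then have "h x = x" "h y = y" by (auto simp: h_def)
        moreover have "\<pi>' x = y" using False p inv(2)[OF uv(1)] inv(2)[OF uv(2)] \<pi>' by auto
        moreover have "(x, \<pi>' x) \<in> E'" using False p(1) unfolding E' by blast
        ultimately show ?thesis by auto
      qed
    qed
  qed
  have "(h p, h z) \<in> E'\<^sup>*" if "(p, z) \<in> E\<^sup>*" for z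
    using rtrancl_map_into[where f = h, OF edge that] .
  moreover have "h p = p" "h q = q" using pq by (auto simp: h_def)
  ultimately show "(p, q) \<in> E'\<^sup>*" if "(p, q) \<in> E\<^sup>*" using that by metis
qed

text \<open>Stage \<open>j\<close> of the glueing: both copies of the middle points up to
  \<open>j\<close> have disappeared.\<close>

definition glued_points :: "nat \<Rightarrow> nat \<Rightarrow> nat \<Rightarrow> nat \<Rightarrow> (point + point) set" where
  "glued_points a m b j = Inl ` (Top ` {1..a} \<union> Bot ` {j<..m}) \<union> Inr ` (Top ` {j<..m} \<union> Bot ` {1..b})"

definition glue_graph ::
    "nat \<Rightarrow> nat \<Rightarrow> nat \<Rightarrow> nat \<Rightarrow> (point + point \<Rightarrow> point + point) \<Rightarrow> ((point + point) \<times> (point + point)) set" where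
  "glue_graph a m b j \<pi> = (\<lambda>p. (p, \<pi> p)) ` glued_points a m b j \<union>
     (\<Union>i\<in>{j<..m}. {(Inl (Bot i), Inr (Top i)), (Inr (Top i), Inl (Bot i))})"

lemma nc_stack:
  assumes "nc before (points a m) \<pi>1" "nc before (points m b) \<pi>2"
  shows "nc stacked_before (glued_points a m b 0) (map_sum \<pi>1 \<pi>2)"
proof -
  have S: "glued_points a m b 0 = Inl ` points a m \<union> Inr ` points m b"
    unfolding glued_points_def points_def by auto
  show ?thesis unfolding S nc_def
    using ncD[OF assms(1)] ncD[OF assms(2)] ncD_cross[OF assms(1)] ncD_cross[OF assms(2)]
    by (auto simp: ball_Un)
qed

text \<open>The set \<open>glued_points a m b m\<close> contains only outer points, which survive
  every stage; reachability among them is the invariant. Closed loops never meet these points and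
  vanish silently.\<close>

lemma glue_strands:
  assumes n0: "nc stacked_before (glued_points a m b 0) \<pi>0" and "j \<le> m"
  shows "\<exists>\<pi>. nc stacked_before (glued_points a m b j) \<pi> \<and>
     (\<forall>p\<in>glued_points a m b m. \<forall>q\<in>glued_points a m b m.
        (p, q) \<in> (glue_graph a m b 0 \<pi>0)\<^sup>* \<longleftrightarrow> (p, q) \<in> (glue_graph a m b j \<pi>)\<^sup>*)"
  using \<open>j \<le> m\<close>
proof (induction j)
  case 0
  then show ?case using n0 by blast
next
  case (Suc j)
  then obtain \<pi> where n: "nc stacked_before (glued_points a m b j) \<pi>"
    and eq: "\<And>p q. p \<in> glued_points a m b m \<Longrightarrow> q \<in> glued_points a m b m \<Longrightarrow>
        (p, q) \<in> (glue_graph a m b 0 \<pi>0)\<^sup>* \<longleftrightarrow> (p, q) \<in> (glue_graph a m b j \<pi>)\<^sup>*" by auto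
  let ?S = "glued_points a m b j" and ?u = "Inl (Bot (Suc j)) :: point + point" and ?v = "Inr (Top (Suc j)) :: point + point"
  let ?G = "\<Union>i\<in>{Suc j<..m}. {(Inl (Bot i), Inr (Top i)), (Inr (Top i), Inl (Bot i))} :: ((point + point) \<times> (point + point)) set"
  define \<pi>' where "\<pi>' = (if \<pi> ?u = ?v then \<pi> else \<pi>(\<pi> ?u := \<pi> ?v, \<pi> ?v := \<pi> ?u))"
  have I: "{j<..m} = insert (Suc j) {Suc j<..m}" using Suc.prems by auto
  have S': "glued_points a m b (Suc j) = ?S - {?u, ?v}"
    unfolding glued_points_def I by auto
  have uv: "?u \<in> ?S" "?v \<in> ?S" "?u \<noteq> ?v" using Suc.prems by (auto simp: glued_points_def)
  have "nc stacked_before (glued_points a m b (Suc j)) \<pi>'"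
    unfolding S' \<pi>'_def
    by (rule nc_contract[OF strict_linear_stacked_before n uv(1,2)])
      (auto simp: glued_points_def)
  moreover have "(p, q) \<in> (glue_graph a m b j \<pi>)\<^sup>* \<longleftrightarrow> (p, q) \<in> (glue_graph a m b (Suc j) \<pi>')\<^sup>*"
    if "p \<in> glued_points a m b m" "q \<in> glued_points a m b m" for p q
  proof (rule contract_reach[OF n uv _ _ \<pi>'_def])
    show "?G \<subseteq> (?S - {?u, ?v}) \<times> (?S - {?u, ?v})" by (auto simp: glued_points_def)
    show "glue_graph a m b j \<pi> = (\<lambda>p. (p, \<pi> p)) ` ?S \<union> {(?u, ?v), (?v, ?u)} \<union> ?G"
      unfolding glue_graph_def I by (simp only: UN_insert Un_assoc)
    show "glue_graph a m b (Suc j) \<pi>' = (\<lambda>p. (p, \<pi>' p)) ` (?S - {?u, ?v}) \<union> ?G"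
      unfolding glue_graph_def S' ..
    show "p \<in> ?S - {?u, ?v}" "q \<in> ?S - {?u, ?v}" using that Suc.prems by (auto simp: glued_points_def)
  qed
  ultimately show ?case using eq by blast
qed

lemma rtrancl_involution:
  assumes "\<And>p. p \<in> S \<Longrightarrow> \<pi> p \<in> S \<and> \<pi> (\<pi> p) = p" "p \<in> S"
  shows "(p, q) \<in> ((\<lambda>p. (p, \<pi> p)) ` S)\<^sup>* \<longleftrightarrow> q = p \<or> q = \<pi> p"
proof
  show "q = p \<or> q = \<pi> p" if "(p, q) \<in> ((\<lambda>p. (p, \<pi> p)) ` S)\<^sup>*"
    using that by (induction rule: rtrancl_induct) (use assms in auto)
qed (use assms(2) in auto)

abbreviation stacked_graph :: "diagram \<Rightarrow> diagram \<Rightarrow> (stacked_point \<times> stacked_point) set" where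
  "stacked_graph D1 D2 \<equiv> {(p, q). {p, q} \<in> stacked_arcs D1 D2}"

lemma doubleton_image_iff:
  assumes n: "nc lt S \<pi>"
  shows "(\<exists>p\<in>S. {x, y} = {g p, g (\<pi> p)}) \<longleftrightarrow> (\<exists>p\<in>S. x = g p \<and> y = g (\<pi> p))"
proof
  assume "\<exists>p\<in>S. {x, y} = {g p, g (\<pi> p)}"
  then obtain p where p: "p \<in> S" "x = g p \<and> y = g (\<pi> p) \<or> x = g (\<pi> p) \<and> y = g p"
    by (auto simp: doubleton_eq_iff)
  then show "\<exists>p\<in>S. x = g p \<and> y = g (\<pi> p)"
    using ncD(1,2)[OF n p(1)] by (metis (no_types))
qed auto

lemma stacked_graph_arcs:
  assumes n1: "nc before (points a m) \<pi>1" and n2: "nc before (points m b) \<pi>2"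
  shows "(x, y) \<in> stacked_graph (arcs (points a m) \<pi>1) (arcs (points m b) \<pi>2) \<longleftrightarrow>
    (\<exists>z\<in>glued_points a m b 0. x = case_sum in_upper in_lower z \<and> y = case_sum in_upper in_lower (map_sum \<pi>1 \<pi>2 z))"
proof -
  have S: "glued_points a m b 0 = Inl ` points a m \<union> Inr ` points m b"
    unfolding glued_points_def points_def by auto
  have "(x, y) \<in> stacked_graph (arcs (points a m) \<pi>1) (arcs (points m b) \<pi>2) \<longleftrightarrow>
    (\<exists>p\<in>points a m. {x, y} = {in_upper p, in_upper (\<pi>1 p)}) \<or> (\<exists>p\<in>points m b. {x, y} = {in_lower p, in_lower (\<pi>2 p)})"
    by (auto simp: stacked_arcs_def arcs_def image_image image_iff)
  also have "\<dots> \<longleftrightarrow> (\<exists>p\<in>points a m. x = in_upper p \<and> y = in_upper (\<pi>1 p)) \<or>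
      (\<exists>p\<in>points m b. x = in_lower p \<and> y = in_lower (\<pi>2 p))"
    by (simp only: doubleton_image_iff[OF n1] doubleton_image_iff[OF n2])
  finally show ?thesis unfolding S by (simp add: bex_Un)
qed

text \<open>Collapsing the two copies of a middle point turns the glueing edges into equalities.
  Conversely the points in one fibre of the collapse are joined by a glueing edge, so paths
  lift.\<close>

lemma stacked_reach:
  assumes n1: "nc before (points a m) \<pi>1" and n2: "nc before (points m b) \<pi>2"
    and p: "p \<in> glued_points a m b 0" and q: "q \<in> glued_points a m b 0"
  defines "f \<equiv> case_sum in_upper in_lower"
  shows "(p, q) \<in> (glue_graph a m b 0 (map_sum \<pi>1 \<pi>2))\<^sup>* \<longleftrightarrow>
     (f p, f q) \<in> (stacked_graph (arcs (points a m) \<pi>1) (arcs (points m b) \<pi>2))\<^sup>*"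
    (is "_ \<in> ?E\<^sup>* \<longleftrightarrow> _ \<in> ?R\<^sup>*")
proof
  note R = stacked_graph_arcs[OF n1 n2, folded f_def]
  have "(f x, f y) \<in> ?R\<^sup>*" if "(x, y) \<in> ?E" for x y
  proof -
    have "(x \<in> glued_points a m b 0 \<and> y = map_sum \<pi>1 \<pi>2 x) \<or> f x = f y"
      using that unfolding glue_graph_def f_def by auto
    then show ?thesis using R by auto
  qed
  then show "(f p, f q) \<in> ?R\<^sup>*" if "(p, q) \<in> ?E\<^sup>*"
    using rtrancl_map_into[where f = f, OF _ that] by blast
next
  note R = stacked_graph_arcs[OF n1 n2, folded f_def]
  have fib: "(x, y) \<in> ?E\<^sup>*" if "x \<in> glued_points a m b 0" "y \<in> glued_points a m b 0" "f x = f y" for x y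
  proof -
    have "x = y \<or> (\<exists>i\<in>{1..m}. (x = Inl (Bot i) \<and> y = Inr (Top i)) \<or> (x = Inr (Top i) \<and> y = Inl (Bot i)))"
      using that unfolding glued_points_def f_def by (elim UnE imageE) simp_all
    then have "x = y \<or> (x, y) \<in> ?E" unfolding glue_graph_def by auto
    then show ?thesis by auto
  qed
  \<comment> \<open>The claim covers the whole fibre over \<open>y\<close>, since the next step may
    leave from either copy.\<close>
  have "\<forall>q\<in>glued_points a m b 0. f q = y \<longrightarrow> (p, q) \<in> ?E\<^sup>*" if "(f p, y) \<in> ?R\<^sup>*" for y
    using that
  proof (induction rule: rtrancl_induct)
    case base
    then show ?case using fib p by auto
  next
    case (step x y)
    then obtain z where z: "z \<in> glued_points a m b 0" "x = f z" "y = f (map_sum \<pi>1 \<pi>2 z)"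
      using R by blast
    have "(p, z) \<in> ?E\<^sup>*" using step z by blast
    moreover have "(z, map_sum \<pi>1 \<pi>2 z) \<in> ?E" using z by (auto simp: glue_graph_def)
    moreover have "map_sum \<pi>1 \<pi>2 z \<in> glued_points a m b 0"
      using ncD(1)[OF nc_stack[OF n1 n2] z(1)] .
    ultimately have pz: "(p, map_sum \<pi>1 \<pi>2 z) \<in> ?E\<^sup>*"
      and m: "map_sum \<pi>1 \<pi>2 z \<in> glued_points a m b 0"
      by (simp_all add: rtrancl.rtrancl_into_rtrancl)
    show ?case
    proof (intro ballI impI)
      fix q assume "q \<in> glued_points a m b 0" "f q = y"
      then have "(map_sum \<pi>1 \<pi>2 z, q) \<in> ?E\<^sup>*" using fib[OF m] z(3) by simp
      then show "(p, q) \<in> ?E\<^sup>*" by (rule rtrancl_trans[OF pz])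
    qed
  qed
  then show "(p, q) \<in> ?E\<^sup>*" if "(f p, f q) \<in> ?R\<^sup>*" using that q by blast
qed


lemma Union_stacked_arcs:
  assumes n1: "nc before (points a m) \<pi>1" and n2: "nc before (points m b) \<pi>2"
  shows "\<Union> (stacked_arcs (arcs (points a m) \<pi>1) (arcs (points m b) \<pi>2)) =
    Upper ` {1..a} \<union> Middle ` {1..m} \<union> Lower ` {1..b}"
proof -
  have U: "\<Union> (arcs S \<pi>) = S" if "nc before S \<pi>" for S \<pi>
    using partition_on_arcs[OF that] by (simp add: partition_on_def)
  have "\<Union> (stacked_arcs (arcs (points a m) \<pi>1) (arcs (points m b) \<pi>2)) =
     in_upper ` (\<Union> (arcs (points a m) \<pi>1)) \<union> in_lower ` (\<Union> (arcs (points m b) \<pi>2))"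
    unfolding stacked_arcs_def by auto
  also have "\<dots> = in_upper ` points a m \<union> in_lower ` points m b" by (simp only: U[OF n1] U[OF n2])
  also have "\<dots> = Upper ` {1..a} \<union> Middle ` {1..m} \<union> Lower ` {1..b}"
    by (simp add: points_def image_Un image_image) blast
  finally show ?thesis .
qed

text \<open>At stage \<open>m\<close> no glueing edges are left and the graph is that of an
  involution. Therefore every component meets the outer points in one pair or not at all, and the
  pairs do not cross.\<close>

lemma concat_diagram_arcs:
  assumes n1: "nc before (points a m) \<pi>1" and n2: "nc before (points m b) \<pi>2"
  shows "\<exists>\<pi>. nc before (points a b) \<pi> \<and>
    concat_diagram (arcs (points a m) \<pi>1) (arcs (points m b) \<pi>2) = arcs (points a b) \<pi>"
proof -
  let ?D1 = "arcs (points a m) \<pi>1" and ?D2 = "arcs (points m b) \<pi>2"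
  let ?r = "(stacked_graph ?D1 ?D2)\<^sup>*"
  let ?f = "case_sum in_upper in_lower"
  define T where "T = glued_points a m b m"
  have T: "T = Inl ` Top ` {1..a} \<union> Inr ` Bot ` {1..b}" unfolding T_def glued_points_def by auto
  obtain \<rho> where n: "nc stacked_before T \<rho>"
    and eq: "\<And>p q. p \<in> T \<Longrightarrow> q \<in> T \<Longrightarrow> (p, q) \<in> (glue_graph a m b 0 (map_sum \<pi>1 \<pi>2))\<^sup>* \<longleftrightarrow> (p, q) \<in> (glue_graph a m b m \<rho>)\<^sup>*"
    unfolding T_def using glue_strands[OF nc_stack[OF n1 n2], of m] by auto
  have gm: "glue_graph a m b m \<rho> = (\<lambda>p. (p, \<rho> p)) ` T" unfolding glue_graph_def T_def by simp
  have sub: "T \<subseteq> glued_points a m b 0" unfolding T glued_points_def by auto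
  have reach: "(?f p, ?f q) \<in> ?r \<longleftrightarrow> q = p \<or> q = \<rho> p" if "p \<in> T" "q \<in> T" for p q
  proof -
    have "(?f p, ?f q) \<in> ?r \<longleftrightarrow> (p, q) \<in> ((\<lambda>p. (p, \<rho> p)) ` T)\<^sup>*"
      using stacked_reach[OF n1 n2, of p q] eq[OF that] sub that gm by auto
    also have "\<dots> \<longleftrightarrow> q = p \<or> q = \<rho> p"
      by (rule rtrancl_involution) (use ncD[OF n] that in auto)
    finally show ?thesis .
  qed
  \<comment> \<open>Forgetting the tag loses nothing here: only tops of the first and bottoms of the
    second diagram remain.\<close>
  define g where "g = (\<lambda>x :: point + point. case x of Inl p \<Rightarrow> p | Inr p \<Rightarrow> p)"
  have gT: "g ` T = points a b" unfolding T points_def g_def image_Un image_image by simp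
  have ginj: "inj_on g T" unfolding T g_def inj_on_def by auto
  have fg: "?f x = outer (g x)" if "x \<in> T" for x using that unfolding T g_def by auto
  define \<pi> where "\<pi> = g \<circ> \<rho> \<circ> inv_into T g"
  have "nc before (g ` T) \<pi>" unfolding \<pi>_def
    by (rule nc_image[OF n ginj]) (auto simp: T g_def)
  then have np: "nc before (points a b) \<pi>" by (simp add: gT)
  have reach': "(outer p, outer q) \<in> ?r \<longleftrightarrow> q = p \<or> q = \<pi> p" if pq: "p \<in> points a b" "q \<in> points a b" for p q
  proof -
    obtain x y where xy: "x \<in> T" "y \<in> T" "p = g x" "q = g y" using pq unfolding gT[symmetric] by auto
    have "(outer p, outer q) \<in> ?r \<longleftrightarrow> y = x \<or> y = \<rho> x" using reach[OF xy(1,2)] fg xy by simp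
    also have "\<dots> \<longleftrightarrow> q = p \<or> q = g (\<rho> x)"
      using xy ginj ncD(1)[OF n xy(1)] by (auto dest: inj_onD)
    also have "g (\<rho> x) = \<pi> p" unfolding \<pi>_def using xy ginj by simp
    finally show ?thesis .
  qed
  let ?X = "\<Union> (stacked_arcs ?D1 ?D2)"
  have X: "?X = Upper ` {1..a} \<union> Middle ` {1..m} \<union> Lower ` {1..b}" by (rule Union_stacked_arcs[OF n1 n2])
  have outerX: "outer p \<in> ?X \<longleftrightarrow> p \<in> points a b" for p unfolding X by (cases p) auto
  have sym: "sym ?r" by (rule sym_rtrancl) (auto simp: sym_def insert_commute)
  have clos: "y \<in> ?X" if "(x, y) \<in> ?r" "x \<in> ?X" for x y
    using that by (induction rule: rtrancl_induct) auto
  have cl: "outer -` (?r `` {outer p}) = {p, \<pi> p}" if p: "p \<in> points a b" for p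
  proof -
    have "(outer p, outer q) \<in> ?r \<Longrightarrow> q \<in> points a b" for q
      using clos outerX p by metis
    then show ?thesis using reach'[OF p] ncD(1)[OF np p] p by auto
  qed
  have "concat_diagram ?D1 ?D2 = arcs (points a b) \<pi>"
  proof
    show "concat_diagram ?D1 ?D2 \<subseteq> arcs (points a b) \<pi>"
    proof
      fix A assume "A \<in> concat_diagram ?D1 ?D2"
      then obtain x where x: "x \<in> ?X" "A = outer -` (?r `` {x})" "A \<noteq> {}"
        unfolding concat_diagram_def stacked_components_def quotient_def by auto
      then obtain p where p: "(x, outer p) \<in> ?r" by auto
      then have "?r `` {x} = ?r `` {outer p}"
        using sym by (auto dest: symD intro: rtrancl_trans)
      moreover have "p \<in> points a b" using clos[OF p x(1)] outerX by simp
      ultimately show "A \<in> arcs (points a b) \<pi>" using cl x by (auto simp: arcs_def)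
    qed
    show "arcs (points a b) \<pi> \<subseteq> concat_diagram ?D1 ?D2"
    proof
      fix A assume "A \<in> arcs (points a b) \<pi>"
      then obtain p where p: "p \<in> points a b" "A = {p, \<pi> p}" by (auto simp: arcs_def)
      have "A = outer -` (?r `` {outer p})" "A \<noteq> {}" using cl p by auto
      moreover have "?r `` {outer p} \<in> stacked_components ?D1 ?D2"
        unfolding stacked_components_def using p outerX by (auto intro: quotientI)
      ultimately show "A \<in> concat_diagram ?D1 ?D2"
        unfolding concat_diagram_def by auto
    qed
  qed
  then show ?thesis using np by blast
qed

lemma concat_in_diagrams:
  assumes "D1 \<in> diagrams a m" "D2 \<in> diagrams m b"
  shows "concat_diagram D1 D2 \<in> diagrams a b"
proof -
  obtain \<pi>1 where 1: "nc before (points a m) \<pi>1" "D1 = arcs (points a m) \<pi>1"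
    by (rule diagram_arcsE[OF assms(1)])
  obtain \<pi>2 where 2: "nc before (points m b) \<pi>2" "D2 = arcs (points m b) \<pi>2"
    by (rule diagram_arcsE[OF assms(2)])
  show ?thesis using concat_diagram_arcs[OF 1(1) 2(1)] arcs_in_diagrams 1(2) 2(2) by metis
qed

text \<open>The component of such a cup never reaches the middle line. This makes
  \<open>top_cups\<close> stable under the right action.\<close>

lemma top_cup_concat:
  assumes D1: "D1 \<in> diagrams a m" and D2: "D2 \<in> diagrams m b" and cup: "{Top i, Top j} \<in> D1"
  shows "{Top i, Top j} \<in> concat_diagram D1 D2"
proof -
  obtain \<pi>1 where 1: "nc before (points a m) \<pi>1" "D1 = arcs (points a m) \<pi>1"
    by (rule diagram_arcsE[OF assms(1)])
  obtain \<pi>2 where 2: "nc before (points m b) \<pi>2" "D2 = arcs (points m b) \<pi>2"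
    by (rule diagram_arcsE[OF assms(2)])
  have p: "Top i \<in> points a m" "\<pi>1 (Top i) = Top j"
    using cup[unfolded 1(2) mem_arcs_iff[OF 1(1)]] by simp_all
  then have p': "Top j \<in> points a m" "\<pi>1 (Top j) = Top i" using ncD[OF 1(1) p(1)] by auto
  have iff: "(Upper i, Upper j) \<in> stacked_graph D1 D2"
  proof -
    have "in_upper ` {Top i, Top j} \<in> stacked_arcs D1 D2" unfolding stacked_arcs_def using cup by blast
    then show ?thesis by simp
  qed
  have step': "y \<in> {Upper i, Upper j}" if "(x, y) \<in> stacked_graph D1 D2" "x \<in> {Upper i, Upper j}" for x y
  proof -
    have "(x, y) \<in> stacked_graph (arcs (points a m) \<pi>1) (arcs (points m b) \<pi>2)"
      using that(1) by (simp only: 1(2) 2(2))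
    from iffD1[OF stacked_graph_arcs[OF 1(1) 2(1)] this]
    obtain z where z: "z \<in> glued_points a m b 0" "x = case_sum in_upper in_lower z" "y = case_sum in_upper in_lower (map_sum \<pi>1 \<pi>2 z)"
      by blast
    have "z = Inl (Top i) \<or> z = Inl (Top j)" using that(2) z(1,2) by (auto simp: glued_points_def)
    then show ?thesis using z(3) p p' by auto
  qed
  have "y \<in> {Upper i, Upper j}" if "(Upper i, y) \<in> (stacked_graph D1 D2)\<^sup>*" for y
    using that
  proof (induction rule: rtrancl_induct)
    case (step y z)
    show ?case by (rule step'[OF step(2,3)])
  qed simp
  then have "(stacked_graph D1 D2)\<^sup>* `` {Upper i} = {Upper i, Upper j}"
    using r_into_rtrancl[OF iff] by blast
  moreover have "Upper i \<in> \<Union> (stacked_arcs D1 D2)" using iff by blast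
  ultimately have "{Upper i, Upper j} \<in> stacked_components D1 D2"
    unfolding stacked_components_def by (metis (no_types, lifting) quotientI)
  moreover have "outer -` {Upper i, Upper j} = {Top i, Top j}"
    by (auto elim: outer.elims)
  ultimately show ?thesis unfolding concat_diagram_def by (metis DiffI image_eqI insert_not_empty singletonD)
qed

section \<open>Spin weights of diagrams\<close>

text \<open>Vanishing outside \<open>{1..m}\<close> picks one representative of each spin colouring,
  so the set is finite and can index a sum; \<open>weight\<close> and \<open>realise\<close> still
  accept arbitrary functions.\<close>

definition colours :: "nat \<Rightarrow> (nat \<Rightarrow> bool) set" where
  "colours m = {z. \<forall>i. z i \<longrightarrow> i \<in> {1..m}}"

text \<open>
  In a non-crossing diagram a cup or cap joins points of different parity and a through strand joins
  points of the same parity.  After flipping the spins at the even positions, the condition on each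
  arc therefore becomes that of being monochromatic, which passes to connected components.
\<close>

fun twist :: "(nat \<Rightarrow> bool) \<Rightarrow> (nat \<Rightarrow> bool) \<Rightarrow> point \<Rightarrow> bool" where
  "twist s t (Top i) = (s i \<noteq> even i)"
| "twist s t (Bot j) = (t j \<noteq> even j)"

definition compat :: "diagram \<Rightarrow> (point \<Rightarrow> bool) \<Rightarrow> bool" where
  "compat D \<kappa> \<longleftrightarrow> (\<forall>A\<in>D. \<forall>p\<in>A. \<forall>q\<in>A. \<kappa> p = \<kappa> q)"

text \<open>A cup or cap joins opposite spins at positions of opposite parity, so its factors make
  it an alternating form; the ends of a through strand agree in spin and parity, so their factors
  cancel. As a product over a line rather than over arcs, the sign squares to 1 on the middle line
  of a composite.\<close>

definition sg :: "nat \<Rightarrow> (nat \<Rightarrow> bool) \<Rightarrow> rat" where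
  "sg m z = (\<Prod>i\<in>{1..m}. if z i \<and> odd i then - 1 else 1)"

definition weight :: "nat \<Rightarrow> nat \<Rightarrow> diagram \<Rightarrow> (nat \<Rightarrow> bool) \<Rightarrow> (nat \<Rightarrow> bool) \<Rightarrow> rat" where
  "weight a b D s t = of_bool (compat D (twist s t)) * sg a s * sg b t"

lemma sg_square [simp]: "sg m z * sg m z = 1"
  unfolding sg_def prod.distrib[symmetric] by (rule prod.neutral) auto

lemma sg_cong: "(\<And>i. i \<in> {1..m} \<Longrightarrow> s i = s' i) \<Longrightarrow> sg m s = sg m s'"
  unfolding sg_def by (rule prod.cong) auto

lemma finite_colours [simp]: "finite (colours m)"
proof -
  have "colours m \<subseteq> (\<lambda>X i. i \<in> X) ` Pow {1..m}"
  proof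
    fix z assume "z \<in> colours m"
    then have "{i. z i} \<in> Pow {1..m}" "z = (\<lambda>i. i \<in> {i. z i})" by (auto simp: colours_def)
    then show "z \<in> (\<lambda>X i. i \<in> X) ` Pow {1..m}" by blast
  qed
  then show ?thesis using finite_subset by blast
qed

fun stacked_twist :: "(nat \<Rightarrow> bool) \<Rightarrow> (nat \<Rightarrow> bool) \<Rightarrow> (nat \<Rightarrow> bool) \<Rightarrow> stacked_point \<Rightarrow> bool" where
  "stacked_twist s z t (Upper i) = (s i \<noteq> even i)"
| "stacked_twist s z t (Middle i) = (z i \<noteq> even i)"
| "stacked_twist s z t (Lower i) = (t i \<noteq> even i)"

lemma stacked_twist_simps:
  "stacked_twist s z t (in_upper p) = twist s z p"
  "stacked_twist s z t (in_lower p) = twist z t p"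
  "stacked_twist s z t (outer p) = twist s t p"
  by (cases p; simp)+

lemma compat_stacked:
  assumes D1: "D1 \<in> diagrams a m" and D2: "D2 \<in> diagrams m b"
  shows "compat D1 (twist s z) \<and> compat D2 (twist z t) \<longleftrightarrow>
    (\<forall>x y. (x, y) \<in> (stacked_graph D1 D2)\<^sup>* \<longrightarrow> stacked_twist s z t x = stacked_twist s z t y)"
    (is "?L \<longleftrightarrow> ?R")
proof -
  let ?g = "stacked_twist s z t"
  have pair: "\<exists>x y. A = {x, y}" if "A \<in> D1 \<union> D2" for A
  proof -
    have "card A = 2" using that D1 D2 by (auto simp: diagrams_def)
    then show ?thesis by (auto simp: card_2_iff)
  qed
  have "?L \<longleftrightarrow> (\<forall>A\<in>stacked_arcs D1 D2. \<forall>x\<in>A. \<forall>y\<in>A. ?g x = ?g y)"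
    unfolding compat_def stacked_arcs_def ball_Un ball_simps stacked_twist_simps by (rule refl)
  also have "\<dots> \<longleftrightarrow> (\<forall>x y. {x, y} \<in> stacked_arcs D1 D2 \<longrightarrow> ?g x = ?g y)"
  proof
    assume R: "\<forall>x y. {x, y} \<in> stacked_arcs D1 D2 \<longrightarrow> ?g x = ?g y"
    show "\<forall>A\<in>stacked_arcs D1 D2. \<forall>x\<in>A. \<forall>y\<in>A. ?g x = ?g y"
    proof
      fix A assume A: "A \<in> stacked_arcs D1 D2"
      then obtain B f where "B \<in> D1 \<union> D2" "A = f ` B" unfolding stacked_arcs_def by blast
      then obtain x y where "A = {x, y}" using pair[of B] by force
      then show "\<forall>x\<in>A. \<forall>y\<in>A. ?g x = ?g y" using R A by auto
    qed
  next
    assume L: "\<forall>A\<in>stacked_arcs D1 D2. \<forall>x\<in>A. \<forall>y\<in>A. ?g x = ?g y"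
    show "\<forall>x y. {x, y} \<in> stacked_arcs D1 D2 \<longrightarrow> ?g x = ?g y"
    proof (intro allI impI)
      fix x y assume "{x, y} \<in> stacked_arcs D1 D2"
      from L[rule_format, OF this, of x y] show "?g x = ?g y" by simp
    qed
  qed
  also have "\<dots> \<longleftrightarrow> ?R"
  proof
    assume R: "\<forall>x y. {x, y} \<in> stacked_arcs D1 D2 \<longrightarrow> ?g x = ?g y"
    have "?g x = ?g y" if "(x, y) \<in> (stacked_graph D1 D2)\<^sup>*" for x y
      using that
    proof (induction rule: rtrancl_induct)
      case (step y w)
      then show ?case using R[rule_format, of y w] by simp
    qed simp
    then show ?R by simp
  next
    assume R: ?R
    show "\<forall>x y. {x, y} \<in> stacked_arcs D1 D2 \<longrightarrow> ?g x = ?g y"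
    proof (intro allI impI)
      fix x y assume "{x, y} \<in> stacked_arcs D1 D2"
      then have "(x, y) \<in> stacked_graph D1 D2" by simp
      from r_into_rtrancl[OF this] show "?g x = ?g y" using R by blast
    qed
  qed
  finally show ?thesis .
qed

text \<open>On a component with an outer point the colour is forced by \<open>s\<close> and
  \<open>t\<close>, while each closed loop has two free colours. So the colourings counted
  correspond to the subsets of the set \<open>L\<close> of loops.\<close>

lemma card_middle_colours:
  assumes D1: "D1 \<in> diagrams a m" and D2: "D2 \<in> diagrams m b"
  shows "card {z \<in> colours m. compat D1 (twist s z) \<and> compat D2 (twist z t)} =
    (if compat (concat_diagram D1 D2) (twist s t) then 2 ^ closed_loops D1 D2 else 0)"
proof -
  define r where "r = (stacked_graph D1 D2)\<^sup>*"
  define X where "X = \<Union> (stacked_arcs D1 D2)"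
  define L where "L = {K \<in> X // r. outer -` K = {}}"
  define V where "V = {z \<in> colours m. compat D1 (twist s z) \<and> compat D2 (twist z t)}"
  let ?g = "\<lambda>z. stacked_twist s z t"
  obtain \<pi>1 where 1: "nc before (points a m) \<pi>1" "D1 = arcs (points a m) \<pi>1"
    by (rule diagram_arcsE[OF D1])
  obtain \<pi>2 where 2: "nc before (points m b) \<pi>2" "D2 = arcs (points m b) \<pi>2"
    by (rule diagram_arcsE[OF D2])
  have X: "X = Upper ` {1..a} \<union> Middle ` {1..m} \<union> Lower ` {1..b}"
    unfolding X_def 1(2) 2(2) by (rule Union_stacked_arcs[OF 1(1) 2(1)])
  have fX: "finite X" unfolding X by auto
  have sym: "(x, y) \<in> r \<Longrightarrow> (y, x) \<in> r" for x y
  proof -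
    have "sym r" unfolding r_def by (rule sym_rtrancl) (auto simp: sym_def insert_commute)
    then show "(x, y) \<in> r \<Longrightarrow> (y, x) \<in> r" by (rule symD)
  qed
  have tr: "(x, y) \<in> r \<Longrightarrow> (y, w) \<in> r \<Longrightarrow> (x, w) \<in> r" for x y w
    unfolding r_def by (rule rtrancl_trans)
  have rf: "(x, x) \<in> r" for x unfolding r_def by simp
  have cls: "(x, y) \<in> r \<Longrightarrow> r `` {x} = r `` {y}" for x y using sym tr by blast
  have clos: "y \<in> X" if "(x, y) \<in> r" "x \<in> X" for x y
    using that unfolding r_def X_def by (induction rule: rtrancl_induct) auto
  have VD: "?g z x = ?g z y" if "z \<in> V" "(x, y) \<in> r" for z x y
    using that compat_stacked[OF D1 D2, of s z t] unfolding V_def r_def by blast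
  have VI: "z \<in> V" if "z \<in> colours m" "\<And>x y. (x, y) \<in> r \<Longrightarrow> ?g z x = ?g z y" for z
    using that compat_stacked[OF D1 D2, of s z t] unfolding V_def r_def by blast
  have cc: "compat (concat_diagram D1 D2) (twist s t) \<longleftrightarrow>
    (\<forall>p q. outer p \<in> X \<longrightarrow> (outer p, outer q) \<in> r \<longrightarrow> twist s t p = twist s t q)"
  proof
    assume c: "compat (concat_diagram D1 D2) (twist s t)"
    show "\<forall>p q. outer p \<in> X \<longrightarrow> (outer p, outer q) \<in> r \<longrightarrow> twist s t p = twist s t q"
    proof (intro allI impI)
      fix p q assume p: "outer p \<in> X" "(outer p, outer q) \<in> r"
      have "r `` {outer p} \<in> stacked_components D1 D2"
        unfolding stacked_components_def r_def[symmetric] X_def[symmetric] using p by (auto intro: quotientI)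
      moreover have pq: "p \<in> outer -` (r `` {outer p})" "q \<in> outer -` (r `` {outer p})" using p rf by auto
      ultimately have "outer -` (r `` {outer p}) \<in> concat_diagram D1 D2" unfolding concat_diagram_def by blast
      from c[unfolded compat_def, rule_format, OF this pq] show "twist s t p = twist s t q" .
    qed
  next
    assume R: "\<forall>p q. outer p \<in> X \<longrightarrow> (outer p, outer q) \<in> r \<longrightarrow> twist s t p = twist s t q"
    show "compat (concat_diagram D1 D2) (twist s t)" unfolding compat_def
    proof (intro ballI)
      fix A p q assume A: "A \<in> concat_diagram D1 D2" and pq: "p \<in> A" "q \<in> A"
      then obtain x where x: "x \<in> X" "A = outer -` (r `` {x})"
        unfolding concat_diagram_def stacked_components_def quotient_def r_def X_def by auto
      then have "(x, outer p) \<in> r" "(x, outer q) \<in> r" using pq by auto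
      then show "twist s t p = twist s t q" using R clos[OF _ x(1)] sym tr by blast
    qed
  qed
  show ?thesis
  proof (cases "compat (concat_diagram D1 D2) (twist s t)")
    case False
    have "V = {}"
    proof (rule ccontr)
      assume "V \<noteq> {}"
      then obtain z where z: "z \<in> V" by blast
      have "compat (concat_diagram D1 D2) (twist s t)" unfolding cc
        using VD[OF z] stacked_twist_simps(3) by metis
      then show False using False by simp
    qed
    then show ?thesis using False unfolding V_def by simp
  next
    case True
    note cT = True[unfolded cc, rule_format]
    \<comment> \<open>The loops coloured \<open>True\<close> in the twisted picture.\<close>
    define F where "F z = {K \<in> L. \<exists>v\<in>K. ?g z v}" for z
    \<comment> \<open>The inverse construction: colour \<open>True\<close> exactly the loops in
      \<open>Y\<close>, and let every other component inherit the colour of its outer points, on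
      which \<open>cT\<close> says they agree.\<close>
    define G where "G Y v \<longleftrightarrow> (if r `` {v} \<in> L then r `` {v} \<in> Y else (\<exists>p. (v, outer p) \<in> r \<and> twist s t p))"
      for Y :: "stacked_point set set" and v
    have inj: "z i = z' i" if z: "z \<in> V" "z' \<in> V" "F z = F z'" for z z' i
    proof (cases "i \<in> {1..m}")
      case False
      have "\<not> z i" "\<not> z' i" using z False by (auto simp: V_def colours_def)
      then show ?thesis by simp
    next
      case i: True
      let ?K = "r `` {Middle i}"
      have MX: "Middle i \<in> X" using i unfolding X by auto
      have "?g z (Middle i) = ?g z' (Middle i)"
      proof (cases "?K \<in> L")
        case True
        have "?g z (Middle i) \<longleftrightarrow> ?K \<in> F z" if "z \<in> V" for z
          using VD[OF that] True rf unfolding F_def by blast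
        then show ?thesis using z by simp
      next
        case False
        have "?K \<in> X // r" using MX by (rule quotientI)
        then obtain p where "(Middle i, outer p) \<in> r" using False unfolding L_def by auto
        then show ?thesis using VD z stacked_twist_simps(3) by metis
      qed
      then show ?thesis by auto
    qed
    then have injF: "inj_on F V" unfolding inj_on_def by blast
    have sur: "\<exists>z\<in>V. F z = Y" if Y: "Y \<subseteq> L" for Y
    proof -
      \<comment> \<open>The comparison with \<open>even i\<close> undoes the twist.\<close>
      define z where "z i \<longleftrightarrow> i \<in> {1..m} \<and> (G Y (Middle i) \<noteq> even i)" for i
      have Gr: "G Y x = G Y y" if "(x, y) \<in> r" for x y
        using cls[OF that] sym[OF that] that tr unfolding G_def by metis
      have gG: "?g z v = G Y v" if "v \<in> X" for v
      proof -
        from that consider i where "v = Middle i" "i \<in> {1..m}" | p where "v = outer p"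
          unfolding X by (metis (no_types, lifting) UnE imageE outer.simps)
        then show ?thesis
        proof cases
          case 1 then show ?thesis by (auto simp: z_def)
        next
          case 2
          have "r `` {v} \<notin> L" using 2 rf unfolding L_def by blast
          moreover have "(\<exists>q. (v, outer q) \<in> r \<and> twist s t q) \<longleftrightarrow> twist s t p"
            using cT[of p] that 2 rf by blast
          ultimately show ?thesis unfolding G_def 2 stacked_twist_simps by simp
        qed
      qed
      have zV: "z \<in> V"
      proof (rule VI)
        show "z \<in> colours m" by (simp add: colours_def z_def)
        show "?g z x = ?g z y" if xy: "(x, y) \<in> r" for x y
        proof (cases "x \<in> X")
          case True
          then show ?thesis using gG clos[OF xy] Gr[OF xy] by simp
        next
          case False
          \<comment> \<open>The closure is reflexive on the whole type, so points outside the
            picture form singleton classes.\<close>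
          from xy[unfolded r_def] have "y = x"
          proof (cases rule: converse_rtranclE)
            case (step w)
            then have "x \<in> \<Union> (stacked_arcs D1 D2)" by (intro UnionI[of "{x, w}"]) simp_all
            then show ?thesis using False unfolding X_def by simp
          qed simp
          then show ?thesis by simp
        qed
      qed
      have "K \<in> F z \<longleftrightarrow> K \<in> Y" if K: "K \<in> L" for K
      proof -
        obtain x where x: "x \<in> X" "K = r `` {x}" using K unfolding L_def quotient_def by auto
        have gK: "?g z v \<longleftrightarrow> K \<in> Y" if "v \<in> K" for v
        proof -
          have xv: "(x, v) \<in> r" using that x(2) by simp
          have "r `` {v} = K" using cls[OF xv] x(2) by simp
          then show ?thesis using gG[OF clos[OF xv x(1)]] K unfolding G_def by simp
        qed
        have "x \<in> K" using x rf by simp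
        then have "(\<exists>v\<in>K. ?g z v) \<longleftrightarrow> K \<in> Y" using gK by blast
        then show ?thesis unfolding F_def using K by simp
      qed
      then have "F z = Y" using Y unfolding F_def by blast
      then show ?thesis using zV by blast
    qed
    have "F ` V = Pow L"
    proof (intro equalityI subsetI)
      fix Y assume "Y \<in> F ` V"
      then obtain z where "Y = F z" by (rule imageE)
      then show "Y \<in> Pow L" unfolding F_def by simp
    next
      fix Y assume "Y \<in> Pow L"
      then obtain z where "z \<in> V" "F z = Y" using sur[of Y] by (auto simp only: Pow_iff)
      then show "Y \<in> F ` V" by (intro image_eqI[of _ F z]) simp_all
    qed
    then have "bij_betw F V (Pow L)" using injF by (simp add: bij_betw_def)
    then have "card V = card (Pow L)" by (rule bij_betw_same_card)
    moreover have "finite L" unfolding L_def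
    proof (rule finite_subset)
      show "{K \<in> X // r. outer -` K = {}} \<subseteq> X // r" by simp
      show "finite (X // r)" unfolding quotient_def using fX by simp
    qed
    moreover have "closed_loops D1 D2 = card L"
      unfolding closed_loops_def stacked_components_def L_def r_def X_def ..
    ultimately show ?thesis using True unfolding V_def by (simp add: card_Pow)
  qed
qed

text \<open>The signs of the middle line cancel in pairs, and the two free spins of a loop give the
  loop value 2.\<close>

lemma weight_concat:
  assumes "D1 \<in> diagrams a m" "D2 \<in> diagrams m b"
  shows "(\<Sum>z\<in>colours m. weight a m D1 s z * weight m b D2 z t) =
    2 ^ closed_loops D1 D2 * weight a b (concat_diagram D1 D2) s t"
proof -
  have "(\<Sum>z\<in>colours m. weight a m D1 s z * weight m b D2 z t) =
    (\<Sum>z\<in>colours m. of_bool (compat D1 (twist s z) \<and> compat D2 (twist z t)) * (sg a s * sg b t * (sg m z * sg m z)))"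
    unfolding weight_def by (rule sum.cong) (simp_all add: of_bool_conj algebra_simps del: sg_square)
  also have "\<dots> = of_nat (card {z \<in> colours m. compat D1 (twist s z) \<and> compat D2 (twist z t)}) * (sg a s * sg b t)"
    by (simp add: sum_distrib_right[symmetric] of_bool_def sum.If_cases Int_def)
  finally show ?thesis unfolding card_middle_colours[OF assms] by (simp add: weight_def)
qed

section \<open>Faithfulness of the spin realisation\<close>

lemma compat_arcs:
  assumes "nc lt S \<pi>"
  shows "compat (arcs S \<pi>) \<kappa> \<longleftrightarrow> (\<forall>p\<in>S. \<kappa> p = \<kappa> (\<pi> p))"
  unfolding compat_def arcs_def by auto

text \<open>
  Colour the openers of \<open>\<pi>'\<close> by \<open>True\<close>.  If \<open>\<pi>\<close> is compatible with this colouring, moving each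
  opener of \<open>\<pi>'\<close> to the left end of its arc in \<open>\<pi>\<close> yields the openers of \<open>\<pi>\<close>.  Hence the weights
  are unitriangular with respect to the sum of the positions of the openers.
\<close>

definition openers :: "('a \<Rightarrow> 'a \<Rightarrow> bool) \<Rightarrow> 'a set \<Rightarrow> ('a \<Rightarrow> 'a) \<Rightarrow> 'a set" where
  "openers lt S \<pi> = {p \<in> S. lt p (\<pi> p)}"

definition rank_in :: "('a \<Rightarrow> 'a \<Rightarrow> bool) \<Rightarrow> 'a set \<Rightarrow> 'a \<Rightarrow> nat" where
  "rank_in lt S x = card {y \<in> S. lt y x}"

lemma rank_in_less:
  assumes "strict_linear lt" "finite S" "x \<in> S" "lt x y"
  shows "rank_in lt S x < rank_in lt S y"
  unfolding rank_in_def
proof (rule psubset_card_mono)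
  show "{z \<in> S. lt z x} \<subset> {z \<in> S. lt z y}"
    using assms unfolding strict_linear_def by blast
qed (use assms in simp)

text \<open>Otherwise the opener \<open>\<pi>' q\<close> lies under the arc of \<open>\<pi>\<close>
  ending at \<open>q\<close>, so \<open>\<pi>\<close> closes it before \<open>q\<close>. There the
  two pairings agree by \<open>IH\<close>, although \<open>\<pi>'\<close> closes it at
  \<open>q\<close>.\<close>

lemma mate_of_closer:
  assumes lt: "strict_linear lt" and S: "finite S" and n: "nc lt S \<pi>" and n': "nc lt S \<pi>'"
    and O: "openers lt S \<pi> = openers lt S \<pi>'"
    and IH: "\<And>r. r \<in> S \<Longrightarrow> r \<notin> openers lt S \<pi> \<Longrightarrow> lt r q \<Longrightarrow> \<pi> r = \<pi>' r"
    and q: "q \<in> S" "q \<notin> openers lt S \<pi>"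
  shows "\<not> lt (\<pi> q) (\<pi>' q)"
proof
  assume l: "lt (\<pi> q) (\<pi>' q)"
  have irr: "\<not> lt z z" and tr: "lt z z' \<Longrightarrow> lt z' z'' \<Longrightarrow> lt z z''"
    and tot: "z \<noteq> z' \<Longrightarrow> lt z z' \<or> lt z' z" for z z' z''
    using lt unfolding strict_linear_def by blast+
  let ?p' = "\<pi>' q"
  have p': "?p' \<in> S" "\<pi>' ?p' = q" "lt ?p' q"
    using ncD[OF n' q(1)] q O tot unfolding openers_def by auto
  have "?p' \<in> openers lt S \<pi>'" using p' unfolding openers_def by simp
  then have o: "lt ?p' (\<pi> ?p')" using O unfolding openers_def by blast
  have ne: "\<pi> ?p' \<noteq> q" using ncD(2)[OF n p'(1)] l irr by metis
  have "\<not> lt q (\<pi> ?p')"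
    using ncD_cross[OF n ncD(1)[OF n q(1)] p'(1) l] ncD(2)[OF n q(1)] p'(3) by (auto simp only:)
  then have l2: "lt (\<pi> ?p') q" using ne tot by blast
  have "\<pi> ?p' \<notin> openers lt S \<pi>"
    using o ncD(2)[OF n p'(1)] irr tr unfolding openers_def by auto
  then have "\<pi> (\<pi> ?p') = \<pi>' (\<pi> ?p')" using IH[OF ncD(1)[OF n p'(1)]] l2 by blast
  then have "\<pi>' (\<pi>' (\<pi> ?p')) = q" using ncD(2)[OF n p'(1)] p' by simp
  then show False using ncD(2)[OF n' ncD(1)[OF n p'(1)]] ne by simp
qed

text \<open>This is unique bracket matching: closers are treated from left to right, and
  \<open>mate_of_closer\<close> is applied with both roles of the pairings.\<close>

lemma nc_determined_by_openers:
  assumes lt: "strict_linear lt" and S: "finite S" and n: "nc lt S \<pi>" and n': "nc lt S \<pi>'"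
    and O: "openers lt S \<pi> = openers lt S \<pi>'" and p: "p \<in> S"
  shows "\<pi> p = \<pi>' p"
proof -
  have irr: "\<not> lt z z" and tot: "z \<noteq> z' \<Longrightarrow> lt z z' \<or> lt z' z" for z z'
    using lt unfolding strict_linear_def by blast+
  have closer: "\<pi> q = \<pi>' q" if "q \<in> S" "q \<notin> openers lt S \<pi>" for q
    using that
  proof (induction "rank_in lt S q" arbitrary: q rule: less_induct)
    case less
    have IH: "\<pi> r = \<pi>' r" if "r \<in> S" "r \<notin> openers lt S \<pi>" "lt r q" for r
      using less.hyps[OF rank_in_less[OF lt S]] that by blast
    have "\<not> lt (\<pi> q) (\<pi>' q)"
      by (rule mate_of_closer[OF lt S n n' O IH less.prems])
    moreover have "\<not> lt (\<pi>' q) (\<pi> q)"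
      by (rule mate_of_closer[OF lt S n' n O[symmetric] IH[symmetric]]) (use less.prems O in auto)
    ultimately show ?case using tot by blast
  qed
  show ?thesis
  proof (cases "p \<in> openers lt S \<pi>")
    case True
    have "\<pi> p \<in> S" "\<pi> (\<pi> p) = p" using ncD[OF n p] by auto
    moreover have "\<pi> p \<notin> openers lt S \<pi>"
    proof
      assume "\<pi> p \<in> openers lt S \<pi>"
      then have "lt (\<pi> p) p" using \<open>\<pi> (\<pi> p) = p\<close> by (simp add: openers_def)
      moreover have "lt p (\<pi> p)" using True by (simp add: openers_def)
      ultimately show False using lt unfolding strict_linear_def by blast
    qed
    ultimately have "\<pi>' (\<pi> p) = \<pi> (\<pi> p)" by (intro closer[symmetric])
    from this \<open>\<pi> (\<pi> p) = p\<close> have "\<pi>' (\<pi> p) = p" by (rule trans)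
    then show ?thesis using ncD(2)[OF n' \<open>\<pi> p \<in> S\<close>] by simp
  qed (use closer p in blast)
qed

lemma sum_rank_openers_less:
  assumes lt: "strict_linear lt" and S: "finite S" and n: "nc lt S \<pi>" and n': "nc lt S \<pi>'"
    and c: "\<And>p. p \<in> S \<Longrightarrow> p \<in> openers lt S \<pi>' \<longleftrightarrow> \<pi> p \<notin> openers lt S \<pi>'"
    and ne: "openers lt S \<pi> \<noteq> openers lt S \<pi>'"
  shows "sum (rank_in lt S) (openers lt S \<pi>) < sum (rank_in lt S) (openers lt S \<pi>')"
proof -
  have irr: "\<not> lt z z" and tr: "lt z z' \<Longrightarrow> lt z' z'' \<Longrightarrow> lt z z''" and tot: "z \<noteq> z' \<Longrightarrow> lt z z' \<or> lt z' z" for z z' z''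
    using lt unfolding strict_linear_def by blast+
  let ?O = "openers lt S \<pi>" and ?O' = "openers lt S \<pi>'"
  \<comment> \<open>By \<open>c\<close> each arc of \<open>\<pi>\<close> contains exactly one opener
    of \<open>\<pi>'\<close>; hence moving to the left end of the arc is a bijection between the two
    sets of openers, and it never raises a rank.\<close>
  define \<mu> where "\<mu> x = (if lt x (\<pi> x) then x else \<pi> x)" for x
  have f: "finite ?O'" "?O' \<subseteq> S" "?O \<subseteq> S" using S unfolding openers_def by auto
  have \<mu>O: "\<mu> x \<in> ?O" if "x \<in> S" for x
    using ncD[OF n that] that tot unfolding \<mu>_def openers_def by auto
  have "inj_on \<mu> ?O'"
  proof (rule inj_onI)
    fix x y assume xy: "x \<in> ?O'" "y \<in> ?O'" "\<mu> x = \<mu> y"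
    then have "y = x \<or> y = \<pi> x" using ncD(2)[OF n] f unfolding \<mu>_def by (metis subsetD)
    then show "x = y" using c[of x] xy f by auto
  qed
  moreover have "\<mu> ` ?O' = ?O"
  proof
    show "\<mu> ` ?O' \<subseteq> ?O" using \<mu>O f by auto
    show "?O \<subseteq> \<mu> ` ?O'"
    proof
      fix x assume x: "x \<in> ?O"
      then have xS: "x \<in> S" "lt x (\<pi> x)" unfolding openers_def by auto
      have "\<mu> x = x" "\<mu> (\<pi> x) = x" using xS ncD(2)[OF n xS(1)] irr tr unfolding \<mu>_def by auto
      then show "x \<in> \<mu> ` ?O'" using c[OF xS(1)] by (metis image_eqI)
    qed
  qed
  ultimately have eq: "sum (rank_in lt S) ?O = (\<Sum>x\<in>?O'. rank_in lt S (\<mu> x))"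
    by (metis (no_types, lifting) sum.reindex_cong)
  have le: "rank_in lt S (\<mu> x) < rank_in lt S x" if "x \<in> S" "\<mu> x \<noteq> x" for x
    using that ncD[OF n that(1)] tot unfolding \<mu>_def
    by (metis rank_in_less[OF lt S])
  have "\<exists>x\<in>?O'. \<mu> x \<noteq> x"
  proof (rule ccontr)
    assume "\<not> (\<exists>x\<in>?O'. \<mu> x \<noteq> x)"
    then have "\<mu> ` ?O' = ?O'" by auto
    then show False using \<open>\<mu> ` ?O' = ?O\<close> ne by simp
  qed
  then obtain x where x: "x \<in> ?O'" "\<mu> x \<noteq> x" by blast
  show ?thesis unfolding eq
  proof (rule sum_strict_mono_ex1[OF f(1)])
    show "\<forall>x\<in>?O'. rank_in lt S (\<mu> x) \<le> rank_in lt S x"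
      using le f by (metis less_imp_le_nat order_refl subsetD)
    show "\<exists>x\<in>?O'. rank_in lt S (\<mu> x) < rank_in lt S x" using le x f by blast
  qed
qed

definition realise :: "nat \<Rightarrow> nat \<Rightarrow> (diagram \<Rightarrow>\<^sub>0 rat) \<Rightarrow> (nat \<Rightarrow> bool) \<Rightarrow> (nat \<Rightarrow> bool) \<Rightarrow> rat" where
  "realise a b x s t = (\<Sum>D\<in>diagrams a b. coeff x D * weight a b D s t)"

text \<open>The negation in \<open>word_bot\<close> compensates for through strands joining equal
  spins: after twisting, an arc of either kind is compatible exactly when one of its ends lies in
  \<open>P\<close>.\<close>

definition word_top :: "point set \<Rightarrow> nat \<Rightarrow> bool" where "word_top P i \<longleftrightarrow> Top i \<in> P"
definition word_bot :: "point set \<Rightarrow> nat \<Rightarrow> bool" where "word_bot P j \<longleftrightarrow> Bot j \<notin> P"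

lemma compat_word:
  assumes n: "nc before (points a b) \<pi>"
  shows "compat (arcs (points a b) \<pi>) (twist (word_top P) (word_bot P)) \<longleftrightarrow>
    (\<forall>p\<in>points a b. p \<in> P \<longleftrightarrow> \<pi> p \<notin> P)"
proof -
  have "twist (word_top P) (word_bot P) p = ((p \<in> P) \<noteq> pol p)" for p
    by (cases p) (auto simp: word_top_def word_bot_def)
  then show ?thesis using compat_arcs[OF n] pol_mate[OF n] by auto
qed

lemma sg_nonzero [simp]: "sg m z \<noteq> 0"
  using sg_square[of m z] by force

text \<open>Choose a diagram in the support with the least sum of opener positions and evaluate at
  the colouring of its openers. Any other compatible diagram in the support would have a smaller
  sum, so a single nonzero term remains.\<close>

lemma realise_eq_0:
  assumes x: "x \<in> Hom a b" and R: "\<And>s t. realise a b x s t = 0"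
  shows "x = 0"
proof (rule ccontr)
  assume "x \<noteq> 0"
  let ?S = "points a b" and ?rk = "rank_in before (points a b)"
  let ?K = "Poly_Mapping.keys x"
  have K: "?K \<subseteq> diagrams a b" using x by (simp add: Hom_def)
  define mate where "mate D = (SOME \<pi>. nc before ?S \<pi> \<and> D = arcs ?S \<pi>)" for D
  have mate: "nc before ?S (mate D) \<and> D = arcs ?S (mate D)" if D: "D \<in> diagrams a b" for D
  proof -
    have "\<exists>\<pi>. nc before ?S \<pi> \<and> D = arcs ?S \<pi>" by (rule diagram_arcsE[OF D]) blast
    then show ?thesis unfolding mate_def by (rule someI_ex)
  qed
  define \<psi> where "\<psi> D = sum ?rk (openers before ?S (mate D))" for D
  have "?K \<noteq> {}" using \<open>x \<noteq> 0\<close> by simp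
  then obtain D where D: "D \<in> ?K" and min: "\<And>E. E \<in> ?K \<Longrightarrow> \<psi> D \<le> \<psi> E"
    using arg_min_if_finite[of ?K \<psi>] by (metis finite_keys not_le)
  define P where "P = openers before ?S (mate D)"
  have D': "D \<in> diagrams a b" using D K by blast
  note mD = mate[OF D']
  have other: "coeff x E * weight a b E (word_top P) (word_bot P) = 0" if E: "E \<in> diagrams a b" "E \<noteq> D" for E
  proof (rule ccontr)
    assume "\<not> ?thesis"
    then have EK: "E \<in> ?K" and "compat E (twist (word_top P) (word_bot P))"
      by (auto simp: weight_def in_keys_iff)
    moreover note mE = mate[OF E(1)]
    ultimately have c: "\<And>p. p \<in> ?S \<Longrightarrow> p \<in> P \<longleftrightarrow> mate E p \<notin> P"
      using compat_word mE by metis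
    show False
    proof (cases "openers before ?S (mate E) = P")
      case True
      have "mate E p = mate D p" if "p \<in> ?S" for p
        using nc_determined_by_openers[OF strict_linear_before finite_points] mE mD True that
        unfolding P_def by blast
      then have "arcs ?S (mate E) = arcs ?S (mate D)" unfolding arcs_def by auto
      then show False using E mE mD by simp
    next
      case False
      have "\<psi> E < \<psi> D" unfolding \<psi>_def
        by (rule sum_rank_openers_less[OF strict_linear_before finite_points])
          (use mE mD c False in \<open>simp_all add: P_def\<close>)
      then show False using min[OF EK] by simp
    qed
  qed
  have "p \<in> P \<longleftrightarrow> mate D p \<notin> P" if p: "p \<in> ?S" for p
    using strict_linear_before ncD[OF mD[THEN conjunct1] p] p
    unfolding P_def openers_def strict_linear_def by (metis (no_types, lifting) mem_Collect_eq)
  then have "compat (arcs ?S (mate D)) (twist (word_top P) (word_bot P))"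
    using compat_word[OF mD[THEN conjunct1]] by blast
  then have w: "weight a b D (word_top P) (word_bot P) \<noteq> 0"
    using mD by (simp add: weight_def)
  have "realise a b x (word_top P) (word_bot P) = coeff x D * weight a b D (word_top P) (word_bot P)"
    unfolding realise_def by (subst sum.remove[OF finite_diagrams D'], subst sum.neutral)
      (use other in blast, simp)
  then show False using R w D by (simp add: in_keys_iff)
qed

section \<open>Linear extension and multiplicativity of the realisation\<close>

lemma lookup_scale [simp]: "coeff (scale c x) k = c * coeff x k"
  unfolding scale_def by (simp add: Poly_Mapping.map.rep_eq when_def)

lemma scale_single [simp]: "scale c (Poly_Mapping.single k v) = Poly_Mapping.single k (c * v)"
  by (rule poly_mapping_eqI) (simp add: lookup_single when_def)

lemma lin_ext_superset:
  assumes "finite S" "Poly_Mapping.keys x \<subseteq> S"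
  shows "lin_ext \<phi> x = (\<Sum>k\<in>S. scale (coeff x k) (\<phi> k))"
  unfolding lin_ext_def
proof (rule sum.mono_neutral_left[OF assms])
  show "\<forall>k\<in>S - Poly_Mapping.keys x. scale (coeff x k) (\<phi> k) = 0"
    by (auto simp: in_keys_iff intro!: poly_mapping_eqI)
qed

lemma bilin_ext_superset:
  assumes "finite S" "Poly_Mapping.keys x \<subseteq> S" "finite T" "Poly_Mapping.keys y \<subseteq> T"
  shows "bilin_ext \<beta> x y = (\<Sum>k\<in>S. \<Sum>l\<in>T.
    scale (coeff x k * coeff y l) (\<beta> k l))"
proof -
  have "bilin_ext \<beta> x y = (\<Sum>k\<in>Poly_Mapping.keys x. \<Sum>l\<in>T.
    scale (coeff x k * coeff y l) (\<beta> k l))"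
    unfolding bilin_ext_def
  proof (rule sum.cong[OF refl], rule sum.mono_neutral_left[OF assms(3,4)])
    fix k show "\<forall>l\<in>T - Poly_Mapping.keys y.
        scale (coeff x k * coeff y l) (\<beta> k l) = 0"
      by (auto simp: in_keys_iff intro!: poly_mapping_eqI)
  qed
  also have "\<dots> = (\<Sum>k\<in>S. \<Sum>l\<in>T.
    scale (coeff x k * coeff y l) (\<beta> k l))"
  proof (rule sum.mono_neutral_left[OF assms(1,2)])
    show "\<forall>k\<in>S - Poly_Mapping.keys x. (\<Sum>l\<in>T.
        scale (coeff x k * coeff y l) (\<beta> k l)) = 0"
      by (auto simp: in_keys_iff intro!: poly_mapping_eqI sum.neutral)
  qed
  finally show ?thesis .
qed

lemma Hom_iff: "x \<in> Hom a b \<longleftrightarrow> (\<forall>D. coeff x D \<noteq> 0 \<longrightarrow> D \<in> diagrams a b)"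
  unfolding Hom_def by (auto simp: in_keys_iff subset_iff)

lemma Hom_add: "x \<in> Hom a b \<Longrightarrow> y \<in> Hom a b \<Longrightarrow> x + y \<in> Hom a b"
  unfolding Hom_iff lookup_add by (metis add_0)

lemma Hom_diff: "x \<in> Hom a b \<Longrightarrow> y \<in> Hom a b \<Longrightarrow> x - y \<in> Hom a b"
  unfolding Hom_iff lookup_minus by (metis diff_zero)

lemma Hom_zero [simp]: "0 \<in> Hom a b"
  and Hom_scale: "x \<in> Hom a b \<Longrightarrow> scale c x \<in> Hom a b"
  and Hom_single: "D \<in> diagrams a b \<Longrightarrow> Poly_Mapping.single D c \<in> Hom a b"
  unfolding Hom_iff by (auto simp: lookup_add lookup_minus lookup_single when_def)

lemma Hom_sum: "(\<And>i. i \<in> I \<Longrightarrow> f i \<in> Hom a b) \<Longrightarrow> sum f I \<in> Hom a b"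
  by (induction I rule: infinite_finite_induct) (simp_all add: Hom_add)

lemma realise_zero [simp]: "realise a b 0 s t = 0"
  by (simp add: realise_def)

lemma realise_add: "realise a b (x + y) s t = realise a b x s t + realise a b y s t"
  by (simp add: realise_def lookup_add algebra_simps sum.distrib)

lemma realise_diff: "realise a b (x - y) s t = realise a b x s t - realise a b y s t"
  by (simp add: realise_def lookup_minus algebra_simps sum_subtractf)

lemma realise_scale: "realise a b (scale c x) s t = c * realise a b x s t"
  by (simp add: realise_def sum_distrib_left mult.assoc)

lemma realise_sum: "realise a b (sum f I) s t = (\<Sum>i\<in>I. realise a b (f i) s t)"
  by (induction I rule: infinite_finite_induct) (simp_all add: realise_add)

lemma realise_single:
  assumes "D \<in> diagrams a b"
  shows "realise a b (Poly_Mapping.single D c) s t = c * weight a b D s t"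
proof -
  have "realise a b (Poly_Mapping.single D c) s t =
      (\<Sum>E\<in>diagrams a b. if E = D then c * weight a b D s t else 0)"
    unfolding realise_def by (rule sum.cong) (auto simp: lookup_single when_def)
  then show ?thesis using assms by simp
qed

lemma realise_inject:
  assumes "x \<in> Hom a b" "y \<in> Hom a b" "\<And>s t. realise a b x s t = realise a b y s t"
  shows "x = y"
proof -
  have "x - y = 0"
    by (rule realise_eq_0[OF Hom_diff[OF assms(1,2)]]) (simp add: realise_diff assms(3))
  then show ?thesis by simp
qed

lemma dmult_eq_sum:
  assumes "x \<in> Hom a m" "y \<in> Hom m b"
  shows "x \<odot> y = (\<Sum>D\<in>diagrams a m. \<Sum>E\<in>diagrams m b.
    Poly_Mapping.single (concat_diagram D E) (coeff x D * coeff y E * 2 ^ closed_loops D E))"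
  unfolding dmult_def
  by (subst bilin_ext_superset[where S = "diagrams a m" and T = "diagrams m b"])
    (use assms in \<open>simp_all add: Hom_def\<close>)

lemma dmult_Hom:
  assumes "x \<in> Hom a m" "y \<in> Hom m b"
  shows "x \<odot> y \<in> Hom a b"
  unfolding dmult_eq_sum[OF assms]
  by (intro Hom_sum Hom_single concat_in_diagrams)

lemma realise_dmult:
  assumes "x \<in> Hom a m" "y \<in> Hom m b"
  shows "realise a b (x \<odot> y) s t = (\<Sum>z\<in>colours m. realise a m x s z * realise m b y z t)"
proof -
  have "realise a b (x \<odot> y) s t = (\<Sum>D\<in>diagrams a m. \<Sum>E\<in>diagrams m b.
     coeff x D * coeff y E * (2 ^ closed_loops D E * weight a b (concat_diagram D E) s t))"
    unfolding dmult_eq_sum[OF assms] realise_sum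
    by (intro sum.cong refl) (simp add: realise_single concat_in_diagrams)
  also have "\<dots> = (\<Sum>D\<in>diagrams a m. \<Sum>E\<in>diagrams m b.
     coeff x D * coeff y E * (\<Sum>z\<in>colours m. weight a m D s z * weight m b E z t))"
    by (intro sum.cong refl) (simp add: weight_concat)
  also have "\<dots> = (\<Sum>D\<in>diagrams a m. \<Sum>E\<in>diagrams m b. \<Sum>z\<in>colours m.
     (coeff x D * weight a m D s z) * (coeff y E * weight m b E z t))"
    unfolding sum_distrib_left by (intro sum.cong refl) (simp add: mult_ac)
  also have "\<dots> = (\<Sum>D\<in>diagrams a m. \<Sum>z\<in>colours m. \<Sum>E\<in>diagrams m b.
     (coeff x D * weight a m D s z) * (coeff y E * weight m b E z t))"
    by (intro sum.cong refl sum.swap)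
  also have "\<dots> = (\<Sum>z\<in>colours m. \<Sum>D\<in>diagrams a m. \<Sum>E\<in>diagrams m b.
     (coeff x D * weight a m D s z) * (coeff y E * weight m b E z t))"
    by (rule sum.swap)
  also have "\<dots> = (\<Sum>z\<in>colours m. realise a m x s z * realise m b y z t)"
    unfolding realise_def sum_product ..
  finally show ?thesis .
qed

lemma weight_cong:
  assumes "D \<in> diagrams a b" "\<And>i. i \<in> {1..a} \<Longrightarrow> s i = s' i" "\<And>j. j \<in> {1..b} \<Longrightarrow> t j = t' j"
  shows "weight a b D s t = weight a b D s' t'"
proof -
  have "twist s t p = twist s' t' p" if "p \<in> points a b" for p
    using that assms(2,3) by (cases p) auto
  moreover have "p \<in> points a b" if "A \<in> D" "p \<in> A" for A p
  proof -
    have "points a b = \<Union>D" by (rule partition_onD1) (use assms(1) in \<open>simp add: diagrams_def\<close>)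
    then show ?thesis using UnionI[OF that] by simp
  qed
  ultimately have "A \<in> D \<Longrightarrow> p \<in> A \<Longrightarrow> twist s t p = twist s' t' p" for A p
    by simp
  then have "compat D (twist s t) = compat D (twist s' t')"
    unfolding compat_def by (simp cong: ball_cong)
  then show ?thesis using sg_cong[of a s s'] sg_cong[of b t t'] assms by (simp add: weight_def)
qed

lemma realise_cong:
  assumes "\<And>i. i \<in> {1..a} \<Longrightarrow> s i = s' i" "\<And>j. j \<in> {1..b} \<Longrightarrow> t j = t' j"
  shows "realise a b x s t = realise a b x s' t'"
  unfolding realise_def by (intro sum.cong refl arg_cong2[where f = "(*)"] weight_cong assms)

text \<open>The matrix of the identity. Equality is tested only on \<open>{1..n}\<close>, because
  colourings may be arbitrary beyond it.\<close>

definition agree :: "nat \<Rightarrow> (nat \<Rightarrow> bool) \<Rightarrow> (nat \<Rightarrow> bool) \<Rightarrow> rat" where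
  "agree n s t = of_bool (\<forall>i\<in>{1..n}. s i = t i)"

lemma agree_commute: "agree n s t = agree n t s"
  unfolding agree_def by (metis (full_types))

lemma sum_agree:
  assumes "\<And>z z'. (\<And>i. i \<in> {1..n} \<Longrightarrow> z i = z' i) \<Longrightarrow> g z = g z'"
  shows "(\<Sum>z\<in>colours n. g z * agree n z t) = g t"
proof -
  \<comment> \<open>The representative of \<open>t\<close> in \<open>colours n\<close>; the
    hypothesis on \<open>g\<close> allows the return to \<open>t\<close> itself.\<close>
  let ?t = "\<lambda>i. t i \<and> i \<in> {1..n}"
  have iff: "(\<forall>i\<in>{1..n}. z i = t i) \<longleftrightarrow> z = ?t" if "z \<in> colours n" for z
  proof -
    have z: "z i \<Longrightarrow> i \<in> {1..n}" for i using that by (simp add: colours_def)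
    show ?thesis
    proof
      assume "\<forall>i\<in>{1..n}. z i = t i"
      then show "z = ?t" using z by (intro ext) blast
    qed simp
  qed
  have "(\<Sum>z\<in>colours n. g z * agree n z t) = (\<Sum>z\<in>colours n. if z = ?t then g z else 0)"
    by (rule sum.cong[OF refl]) (simp only: agree_def iff, simp)
  also have "\<dots> = (if ?t \<in> colours n then g ?t else 0)" by (rule sum.delta) simp
  also have "\<dots> = g ?t" by (simp add: colours_def)
  also have "\<dots> = g t" by (rule assms) simp
  finally show ?thesis .
qed

lemma sum_colours_permute:
  assumes w: "w permutes {1..n}"
  shows "(\<Sum>z\<in>colours n. g (z \<circ> w)) = (\<Sum>z\<in>colours n. g z)"
proof (rule sum.reindex_bij_witness[where i = "\<lambda>z. z \<circ> inv w" and j = "\<lambda>z. z \<circ> w"])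
  fix z assume z: "z \<in> colours n"
  show "z \<circ> w \<in> colours n" "z \<circ> inv w \<in> colours n"
    using z permutes_in_image[OF w] permutes_in_image[OF permutes_inv[OF w]] unfolding colours_def by auto
qed (simp_all add: o_assoc[symmetric] permutes_inv_o[OF w])

section \<open>The action of the symmetric group\<close>

text \<open>The standard induction multiplies by arbitrary transpositions. The one exchanging
  \<open>i\<close> and \<open>j + 1\<close> is the conjugate of the one exchanging \<open>i\<close>
  and \<open>j\<close> by the adjacent transposition of \<open>j\<close> and \<open>j + 1\<close>,
  so \<open>far\<close> follows by induction on \<open>j\<close>.\<close>

lemma adjacent_permutes_induct [consumes 1, case_names id step]:
  fixes n :: nat
  assumes w: "w permutes {1..n}" and id: "P id"
    and step: "\<And>i p. i \<in> {1..<n} \<Longrightarrow> p permutes {1..n} \<Longrightarrow> P p \<Longrightarrow> P (swap i (i + 1) \<circ> p)"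
  shows "P w"
proof -
  have far: "P (swap i j \<circ> p)"
    if "1 \<le> i" "i < j" "j \<le> n" "p permutes {1..n}" "P p" for i j p
    using that
  proof (induction j arbitrary: p)
    case (Suc j)
    show ?case
    proof (cases "i = j")
      case True
      have "i \<in> {1..<n}" using Suc.prems by simp
      from step[OF this Suc.prems(4,5)] show ?thesis using True by (simp only: Suc_eq_plus1)
    next
      case False
      let ?r = "swap (Suc j) j"
      have r: "?r permutes {1..n}" "swap i j permutes {1..n}" using Suc.prems False by (auto intro: permutes_swap_id)
      have s: "P (?r \<circ> q)" if "q permutes {1..n}" "P q" for q
        using step[of j q] Suc.prems that False by (simp add: transpose_commute)
      have "P (swap i j \<circ> (?r \<circ> p))"
        by (rule Suc.IH[OF _ _ _ permutes_compose[OF Suc.prems(4) r(1)] s[OF Suc.prems(4,5)]])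
          (use Suc.prems False in simp_all)
      then have "P (?r \<circ> (swap i j \<circ> (?r \<circ> p)))"
        using s r Suc.prems permutes_compose by blast
      moreover have "?r \<circ> swap j i \<circ> ?r = swap (Suc j) i"
        using Suc.prems False by (intro transpose_comp_triple) auto
      then have "swap i (Suc j) = ?r \<circ> swap i j \<circ> ?r"
        by (simp only: transpose_commute[of i])
      ultimately show ?thesis by (simp only: o_assoc)
    qed
  qed simp
  show ?thesis
    using w finite_atLeastAtMost
  proof (induction rule: permutes_induct)
    case (swap i j p)
    show ?case
    proof (cases "i < j")
      case True
      show ?thesis by (rule far) (use swap True in simp_all)
    next
      case False
      show ?thesis unfolding transpose_commute[of i j] by (rule far) (use swap False in simp_all)
    qed
  qed (rule id)
qed

lemma vertical_lines_arcs:
  fixes n :: nat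
  defines "\<pi> \<equiv> \<lambda>p. case p of Top i \<Rightarrow> Bot i | Bot i \<Rightarrow> Top i"
  shows "nc before (points n n) \<pi>" "vertical_lines {1..n} = arcs (points n n) \<pi>"
proof -
  show "nc before (points n n) \<pi>"
    unfolding nc_def points_def \<pi>_def by auto
  show "vertical_lines {1..n} = arcs (points n n) \<pi>"
    unfolding vertical_lines_def arcs_def points_def \<pi>_def image_Un image_image
    by (simp add: insert_commute)
qed

lemma vertical_lines_diagram: "vertical_lines {1..n} \<in> diagrams n n"
  using arcs_in_diagrams vertical_lines_arcs by metis

lemma TL_one_in: "TL_one n \<in> TL n"
  unfolding TL_def TL_one_def by (intro Hom_single vertical_lines_diagram)

lemma weight_vertical_lines: "weight n n (vertical_lines {1..n}) s t = agree n s t"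
proof -
  have "compat (vertical_lines {1..n}) (twist s t) \<longleftrightarrow> (\<forall>i\<in>{1..n}. s i = t i)"
    unfolding compat_def vertical_lines_def by auto
  then show ?thesis using sg_cong[of n s t] unfolding weight_def agree_def by auto
qed

lemma realise_TL_one: "realise n n (TL_one n) s t = agree n s t"
  unfolding TL_one_def realise_single[OF vertical_lines_diagram] weight_vertical_lines by simp

text \<open>The two signs are multiplied instead of compared: in the product all factors away from
  \<open>i\<close> and \<open>j\<close> are 1, and \<open>sg n s\<close> is its own inverse.\<close>

lemma sg_swap:
  assumes "i \<in> {1..n}" "j \<in> {1..n}" "i \<noteq> j"
  shows "sg n (s \<circ> swap i j) = (if s i \<noteq> s j \<and> odd (i + j) then - sg n s else sg n s)"
proof -
  let ?s' = "s \<circ> swap i j"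
  have "sg n s * sg n ?s' = (\<Prod>k\<in>{1..n}. (if s k \<and> odd k then - 1 else 1) * (if ?s' k \<and> odd k then - 1 else 1))"
    unfolding sg_def prod.distrib ..
  also have "\<dots> = (\<Prod>k\<in>{i, j}. (if s k \<and> odd k then - 1 else 1) * (if ?s' k \<and> odd k then - 1 else 1))"
    by (rule prod.mono_neutral_right) (use assms in \<open>auto simp: transpose_def\<close>)
  also have "\<dots> = (if s i \<noteq> s j \<and> odd (i + j) then - 1 else 1)"
    using assms by auto
  finally have "sg n s * (sg n s * sg n ?s') = sg n s * (if s i \<noteq> s j \<and> odd (i + j) then - 1 else 1)"
    by simp
  then show ?thesis by (simp add: mult.assoc[symmetric])
qed

lemma TL_u_arcs:
  fixes n i :: nat
  assumes i: "i \<in> {1..<n}"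
  defines "\<pi> \<equiv> \<lambda>p. case p of Top j \<Rightarrow> if j = i then Top (i + 1) else if j = i + 1 then Top i else Bot j
     | Bot j \<Rightarrow> if j = i then Bot (i + 1) else if j = i + 1 then Bot i else Top j"
    and "U \<equiv> {{Top i, Top (i + 1)}, {Bot i, Bot (i + 1)}} \<union> vertical_lines ({1..n} - {i, i + 1})"
  shows "nc before (points n n) \<pi>" "U = arcs (points n n) \<pi>"
proof -
  show "nc before (points n n) \<pi>"
    unfolding nc_def
  proof (intro conjI ballI)
    fix p assume p: "p \<in> points n n"
    show "\<pi> p \<in> points n n" "\<pi> (\<pi> p) = p" "\<pi> p \<noteq> p"
      using i p unfolding \<pi>_def by (cases p; auto)+
  next
    fix p r assume "p \<in> points n n" "r \<in> points n n"
    show "\<not> (before p r \<and> before r (\<pi> p) \<and> before (\<pi> p) (\<pi> r))"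
      unfolding \<pi>_def by (cases p; cases r) auto
  qed
  have S: "points n n = {Top i, Top (i + 1), Bot i, Bot (i + 1)} \<union>
      (Top ` ({1..n} - {i, i + 1}) \<union> Bot ` ({1..n} - {i, i + 1}))"
    using i unfolding points_def by auto
  have "(\<lambda>p. {p, \<pi> p}) ` Top ` ({1..n} - {i, i + 1}) = vertical_lines ({1..n} - {i, i + 1})"
    "(\<lambda>p. {p, \<pi> p}) ` Bot ` ({1..n} - {i, i + 1}) = vertical_lines ({1..n} - {i, i + 1})"
    unfolding vertical_lines_def image_image \<pi>_def
    by (rule image_cong[OF refl]; auto simp: insert_commute)+
  then show "U = arcs (points n n) \<pi>"
    unfolding arcs_def S U_def image_Un by (simp add: \<pi>_def insert_commute)
qed

lemma TL_u_diagram: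
  assumes "i \<in> {1..<n}"
  shows "{{Top i, Top (i + 1)}, {Bot i, Bot (i + 1)}} \<union> vertical_lines ({1..n} - {i, i + 1}) \<in> diagrams n n"
  unfolding TL_u_arcs(2)[OF assms] by (rule arcs_in_diagrams[OF TL_u_arcs(1)[OF assms]])

lemma TL_u_in: "i \<in> {1..<n} \<Longrightarrow> TL_u n i \<in> TL n"
  unfolding TL_def TL_u_def by (intro Hom_single TL_u_diagram)

text \<open>If the spins at \<open>i\<close> and \<open>i + 1\<close> are equal, the cup vanishes
  and so does the difference of the deltas. If they differ, \<open>t\<close> must equal
  \<open>s\<close> or its exchange, and \<open>sg\<close> changes sign precisely in the second
  case.\<close>

lemma realise_TL_u:
  assumes i: "i \<in> {1..<n}"
  shows "realise n n (TL_u n i) s t = agree n s t - agree n (s \<circ> swap i (i + 1)) t"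
proof -
  let ?U = "{{Top i, Top (i + 1)}, {Bot i, Bot (i + 1)}} \<union> vertical_lines ({1..n} - {i, i + 1})"
  let ?\<tau> = "swap i (i + 1)"
  note U = TL_u_diagram[OF i]
  have c: "compat ?U (twist s t) \<longleftrightarrow> s i \<noteq> s (i + 1) \<and> t i \<noteq> t (i + 1) \<and> (\<forall>j\<in>{1..n} - {i, i + 1}. s j = t j)"
  proof -
    have "compat (X \<union> Y) \<kappa> \<longleftrightarrow> compat X \<kappa> \<and> compat Y \<kappa>" for X Y \<kappa>
      by (simp add: compat_def ball_Un)
    moreover have "compat {{p, q}, {r, u}} \<kappa> \<longleftrightarrow> \<kappa> p = \<kappa> q \<and> \<kappa> r = \<kappa> u" for p q r u \<kappa>
      by (auto simp: compat_def)
    moreover have "compat (vertical_lines J) (twist s t) \<longleftrightarrow> (\<forall>j\<in>J. s j = t j)" for J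
      unfolding compat_def vertical_lines_def by auto
    ultimately show ?thesis by (simp only:) auto
  qed
  have I: "{1..n} = insert i (insert (i + 1) ({1..n} - {i, i + 1}))" using i by auto
  define Q where "Q \<longleftrightarrow> (\<forall>j\<in>{1..n} - {i, i + 1}. s j = t j)"
  have A: "(\<forall>j\<in>{1..n}. P j) \<longleftrightarrow> P i \<and> P (i + 1) \<and> (\<forall>j\<in>{1..n} - {i, i + 1}. P j)" for P
    by (subst I) simp
  have st: "(\<forall>j\<in>{1..n} - {i, i + 1}. (s \<circ> ?\<tau>) j = t j) \<longleftrightarrow> Q"
    unfolding Q_def by (rule ball_cong) (auto simp: transpose_def)
  have "(\<forall>j\<in>{1..n}. s j = t j) \<longleftrightarrow> s i = t i \<and> s (i + 1) = t (i + 1) \<and> Q"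
    unfolding A Q_def ..
  moreover from this have "sg n t = sg n s" if "s i = t i" "s (i + 1) = t (i + 1)" "Q"
    using that sg_cong[of n s t] by simp
  moreover have B: "(\<forall>j\<in>{1..n}. (s \<circ> ?\<tau>) j = t j) \<longleftrightarrow> s (i + 1) = t i \<and> s i = t (i + 1) \<and> Q"
    unfolding A st by simp
  moreover from B have "sg n t = (if s i \<noteq> s (i + 1) then - sg n s else sg n s)"
    if "s (i + 1) = t i" "s i = t (i + 1)" "Q"
    using that sg_cong[of n "s \<circ> ?\<tau>" t] sg_swap[of i n "i + 1" s] i by simp
  ultimately have "weight n n ?U s t = agree n s t - agree n (s \<circ> ?\<tau>) t"
    unfolding weight_def c[folded Q_def] agree_def
    by (cases Q; cases "s i"; cases "s (i + 1)"; cases "t i"; cases "t (i + 1)") (simp_all only: simp_thms of_bool_eq if_True if_False, simp_all)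
  then show ?thesis unfolding TL_u_def realise_single[OF U] by simp
qed

lemma agree_transpose: 
  assumes w: "w permutes {1..n}"
  shows "agree n (s \<circ> w) t = agree n s (t \<circ> inv w)"
proof -
  have "(\<forall>i\<in>{1..n}. s (w i) = t i) \<longleftrightarrow> (\<forall>i\<in>w ` {1..n}. s i = t (inv w i))"
    using permutes_inverses[OF w] by simp
  then show ?thesis unfolding agree_def permutes_image[OF w] by simp
qed

lemma realise_simple_reflection:
  assumes i: "i \<in> {1..<n}"
  shows "realise n n (TL_u n i - TL_one n) s t = - agree n s (t \<circ> swap i (i + 1))"
proof -
  have "swap i (i + 1) permutes {1..n}" using i by (intro permutes_swap_id) auto
  from agree_transpose[OF this] show ?thesis
    by (simp add: realise_diff realise_TL_u[OF i] realise_TL_one)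
qed

text \<open>Faithfulness leaves at most one such \<open>y\<close> for each \<open>w\<close>, so
  identities between these elements can be read off from the permutations.\<close>

definition realises_perm :: "nat \<Rightarrow> (nat \<Rightarrow> nat) \<Rightarrow> (diagram \<Rightarrow>\<^sub>0 rat) \<Rightarrow> bool" where
  "realises_perm n w y \<longleftrightarrow> y \<in> TL n \<and>
     (\<forall>s t. realise n n y s t = of_int (sign w) * agree n s (t \<circ> w))"

lemma realise_right_perm:
  assumes x: "x \<in> Hom a n" and w: "w permutes {1..n}" and y: "realises_perm n w y"
  shows "realise a n (x \<odot> y) s t = of_int (sign w) * realise a n x s (t \<circ> w)"
proof -
  have "realise a n (x \<odot> y) s t = (\<Sum>z\<in>colours n. realise a n x s z * (of_int (sign w) * agree n z (t \<circ> w)))"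
    using y unfolding realises_perm_def TL_def by (simp add: realise_dmult[OF x])
  also have "\<dots> = of_int (sign w) * (\<Sum>z\<in>colours n. realise a n x s z * agree n z (t \<circ> w))"
    by (simp add: sum_distrib_left mult_ac)
  also have "(\<Sum>z\<in>colours n. realise a n x s z * agree n z (t \<circ> w)) = realise a n x s (t \<circ> w)"
    by (rule sum_agree) (auto intro: realise_cong)
  finally show ?thesis .
qed

lemma realises_perm_id: "realises_perm n id (TL_one n)"
  unfolding realises_perm_def by (simp add: TL_one_in realise_TL_one)

lemma realises_perm_simple:
  "i \<in> {1..<n} \<Longrightarrow> realises_perm n (swap i (i + 1)) (TL_u n i - TL_one n)"
  unfolding realises_perm_def using TL_u_in TL_one_in
  by (auto simp: realise_simple_reflection sign_swap_id TL_def intro: Hom_diff)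

lemma realises_perm_mult:
  assumes w: "w permutes {1..n}" and v: "v permutes {1..n}"
    and x: "realises_perm n w x" and y: "realises_perm n v y"
  shows "realises_perm n (v \<circ> w) (x \<odot> y)"
proof -
  have xT: "x \<in> Hom n n" "y \<in> Hom n n" using x y unfolding realises_perm_def TL_def by auto
  have "sign (v \<circ> w) = sign v * sign w"
    using w v by (intro sign_compose) (auto intro: permutes_imp_permutation)
  then show ?thesis
    using dmult_Hom[OF xT] realise_right_perm[OF xT(1) v y] x unfolding realises_perm_def TL_def
    by (simp add: o_assoc[symmetric])
qed

lemma realises_perm_unique:
  "realises_perm n w x \<Longrightarrow> realises_perm n w y \<Longrightarrow> x = y"
  unfolding realises_perm_def TL_def by (auto intro: realise_inject)

lemma ex_realises_perm:
  assumes "w permutes {1..n}"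
  shows "\<exists>y. realises_perm n w y"
  using assms
proof (induction rule: adjacent_permutes_induct)
  case (step i p)
  have "swap i (i + 1) permutes {1..n}" using step by (intro permutes_swap_id) auto
  then show ?case
    using realises_perm_mult[OF step(2) _ _ realises_perm_simple[OF step(1)]] step(3) by blast
qed (use realises_perm_id in blast)

section \<open>The homomorphism from the group algebra\<close>

lemma scale_zero_left [simp]: "scale 0 x = 0"
  and scale_zero_right [simp]: "scale c 0 = 0"
  and scale_one [simp]: "scale 1 x = x"
  by (rule poly_mapping_eqI; simp)+

lemma QS_superset: "x \<in> QS n \<Longrightarrow> Poly_Mapping.keys x \<subseteq> {w. w permutes {1..n}}"
  by (simp add: QS_def)

lemma finite_perms: "finite {w. w permutes {1..n::nat}}"
  by (rule finite_permutations) simp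

lemma QS_iff: "x \<in> QS n \<longleftrightarrow> (\<forall>w. coeff x w \<noteq> 0 \<longrightarrow> w permutes {1..n})"
  unfolding QS_def by (auto simp: in_keys_iff subset_iff)

lemma QS_add: "x \<in> QS n \<Longrightarrow> y \<in> QS n \<Longrightarrow> x + y \<in> QS n"
  unfolding QS_iff lookup_add by (metis add_0)

lemma QS_zero [simp]: "0 \<in> QS n"
  and QS_single: "w permutes {1..n} \<Longrightarrow> Poly_Mapping.single w c \<in> QS n"
  unfolding QS_iff by (auto simp: lookup_single when_def)

lemma QS_sum: "(\<And>i. i \<in> I \<Longrightarrow> f i \<in> QS n) \<Longrightarrow> sum f I \<in> QS n"
  by (induction I rule: infinite_finite_induct) (simp_all add: QS_add)

lemma gmult_eq_sum:
  assumes "x \<in> QS n" "y \<in> QS n"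
  shows "gmult x y = (\<Sum>w\<in>{w. w permutes {1..n}}. \<Sum>v\<in>{w. w permutes {1..n}}.
    Poly_Mapping.single (v \<circ> w) (coeff x w * coeff y v))"
  unfolding gmult_def
  by (subst bilin_ext_superset[OF finite_perms QS_superset[OF assms(1)] finite_perms QS_superset[OF assms(2)]]) simp

lemma gmult_single:
  assumes "w permutes {1..n}" "v permutes {1..n}"
  shows "gmult (Poly_Mapping.single w 1) (Poly_Mapping.single v 1) = Poly_Mapping.single (v \<circ> w) 1"
  unfolding gmult_def
  by (subst bilin_ext_superset[of "{w}" _ "{v}"]) simp_all

text \<open>Without it the choice in \<open>\<Phi>\<close> is opaque. No braid relation is checked:
  \<open>\<rho> w \<odot> \<rho> v\<close> and \<open>\<rho> (v \<circ> w)\<close> realise the same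
  permutation and hence coincide.\<close>

lemma ex_alg_hom:
  "\<exists>\<phi>. is_alg_hom n \<phi> \<and> (\<forall>i\<in>{1..<n}. \<phi> (transp i (i + 1)) = TL_u n i - TL_one n)"
proof -
  let ?P = "{w. w permutes {1..n}}"
  define \<rho> where "\<rho> w = (SOME y. realises_perm n w y)" for w
  have \<rho>: "realises_perm n w (\<rho> w)" if "w permutes {1..n}" for w
    unfolding \<rho>_def by (rule someI_ex[OF ex_realises_perm[OF that]])
  have \<rho>T: "\<rho> w \<in> Hom n n" if "w permutes {1..n}" for w
    using \<rho>[OF that] by (simp add: realises_perm_def TL_def)
  define \<phi> where "\<phi> x = (\<Sum>w\<in>?P. scale (coeff x w) (\<rho> w))" for x
  have T: "\<phi> x \<in> Hom n n" for x unfolding \<phi>_def by (intro Hom_sum Hom_scale \<rho>T) simp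
  have add: "\<phi> (x + y) = \<phi> x + \<phi> y" for x y
    unfolding \<phi>_def sum.distrib[symmetric]
    by (intro sum.cong refl poly_mapping_eqI) (simp add: lookup_add algebra_simps)
  have sc: "\<phi> (scale c x) = scale c (\<phi> x)" for c x
    unfolding \<phi>_def by (rule poly_mapping_eqI) (simp add: lookup_sum sum_distrib_left mult.assoc)
  have single: "\<phi> (Poly_Mapping.single w c) = scale c (\<rho> w)" if w: "w permutes {1..n}" for w c
  proof -
    have "\<phi> (Poly_Mapping.single w c) = (\<Sum>v\<in>?P. if v = w then scale c (\<rho> w) else 0)"
      unfolding \<phi>_def by (rule sum.cong) (auto simp: lookup_single when_def intro!: poly_mapping_eqI)
    then show ?thesis using w finite_perms[of n] by simp
  qed
  have zero: "\<phi> 0 = 0" using sc[of 0 0] by simp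
  have sum: "\<phi> (sum f I) = (\<Sum>i\<in>I. \<phi> (f i))" for f :: "(nat \<Rightarrow> nat) \<Rightarrow> _" and I
    by (induction I rule: infinite_finite_induct) (simp_all add: zero add)
  have R: "realise n n (\<phi> x) s t = (\<Sum>w\<in>?P. coeff x w * realise n n (\<rho> w) s t)" for x s t
    unfolding \<phi>_def by (simp add: realise_sum realise_scale)
  have mult: "\<phi> (gmult x y) = \<phi> x \<odot> \<phi> y" if xy: "x \<in> QS n" "y \<in> QS n" for x y
  proof (rule realise_inject[OF T dmult_Hom[OF T T]])
    fix s t
    have hom: "\<rho> (v \<circ> w) = \<rho> w \<odot> \<rho> v" if "w permutes {1..n}" "v permutes {1..n}" for v w
      using realises_perm_unique[OF \<rho>[OF permutes_compose[OF that]] realises_perm_mult[OF that \<rho> \<rho>]] that by simp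
    have "realise n n (\<phi> (gmult x y)) s t = (\<Sum>w\<in>?P. \<Sum>v\<in>?P.
       coeff x w * coeff y v * realise n n (\<rho> w \<odot> \<rho> v) s t)"
      unfolding gmult_eq_sum[OF xy] sum realise_sum
      by (intro sum.cong refl) (simp add: single permutes_compose realise_scale hom)
    also have "\<dots> = (\<Sum>w\<in>?P. \<Sum>v\<in>?P. \<Sum>z\<in>colours n.
       (coeff x w * realise n n (\<rho> w) s z) * (coeff y v * realise n n (\<rho> v) z t))"
      by (intro sum.cong refl) (simp add: realise_dmult[OF \<rho>T \<rho>T] sum_distrib_left mult_ac)
    also have "\<dots> = (\<Sum>w\<in>?P. \<Sum>z\<in>colours n. \<Sum>v\<in>?P.
       (coeff x w * realise n n (\<rho> w) s z) * (coeff y v * realise n n (\<rho> v) z t))"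
      by (intro sum.cong refl sum.swap)
    also have "\<dots> = (\<Sum>z\<in>colours n. \<Sum>w\<in>?P. \<Sum>v\<in>?P.
       (coeff x w * realise n n (\<rho> w) s z) * (coeff y v * realise n n (\<rho> v) z t))"
      by (rule sum.swap)
    also have "\<dots> = realise n n (\<phi> x \<odot> \<phi> y) s t"
      unfolding realise_dmult[OF T T] R sum_product ..
    finally show "realise n n (\<phi> (gmult x y)) s t = realise n n (\<phi> x \<odot> \<phi> y) s t" .
  qed
  have one: "\<phi> (Poly_Mapping.single id 1) = TL_one n"
    using realises_perm_unique[OF \<rho> realises_perm_id] by (simp add: single permutes_id)
  have "\<phi> (transp i (i + 1)) = TL_u n i - TL_one n" if i: "i \<in> {1..<n}" for i
  proof -
    have w: "swap i (i + 1) permutes {1..n}" using i by (intro permutes_swap_id) auto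
    show ?thesis unfolding transp_def single[OF w] scale_one
      using realises_perm_unique[OF \<rho>[OF w] realises_perm_simple[OF i]] .
  qed
  then show ?thesis
    using T add sc mult one unfolding is_alg_hom_def TL_def by blast
qed

lemma Phi_hom: "is_alg_hom n (\<Phi> n)"
  and Phi_simple: "i \<in> {1..<n} \<Longrightarrow> \<Phi> n (transp i (i + 1)) = TL_u n i - TL_one n"
  using someI_ex[OF ex_alg_hom[of n]] unfolding \<Phi>_def[symmetric] by auto

text \<open>The argument uses only the defining properties of \<open>\<Phi>\<close>, so it holds for
  whichever homomorphism the choice returns.\<close>

lemma Phi_realises_perm:
  assumes "w permutes {1..n}"
  shows "realises_perm n w (\<Phi> n (Poly_Mapping.single w 1))"
  using assms
proof (induction rule: adjacent_permutes_induct)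
  case id
  have "\<Phi> n (Poly_Mapping.single id 1) = TL_one n" using Phi_hom[of n] unfolding is_alg_hom_def by blast
  then show ?case using realises_perm_id by (simp only:)
next
  case (step i p)
  let ?\<tau> = "swap i (i + 1)"
  have \<tau>: "?\<tau> permutes {1..n}" using step by (intro permutes_swap_id) auto
  have "\<Phi> n (Poly_Mapping.single (?\<tau> \<circ> p) 1) = \<Phi> n (Poly_Mapping.single p 1) \<odot> \<Phi> n (transp i (i + 1))"
    unfolding gmult_single[OF step(2) \<tau>, symmetric] transp_def
    using Phi_hom[of n] QS_single step(2) \<tau> unfolding is_alg_hom_def by blast
  then show ?case
    using realises_perm_mult[OF step(2) \<tau> step(3) realises_perm_simple[OF step(1)]] Phi_simple[OF step(1)] by (simp only:)
qed

lemma Phi_zero: "\<Phi> n 0 = 0"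
proof -
  have "\<Phi> n (scale 0 0) = scale 0 (\<Phi> n 0)" using Phi_hom[of n] QS_zero unfolding is_alg_hom_def by blast
  then show ?thesis by simp
qed

lemma Phi_sum:
  assumes "\<And>i. i \<in> I \<Longrightarrow> f i \<in> QS n"
  shows "\<Phi> n (sum f I) = (\<Sum>i\<in>I. \<Phi> n (f i))"
  using assms
proof (induction I rule: infinite_finite_induct)
  case (insert i I)
  have "f i \<in> QS n" "sum f I \<in> QS n" using insert.prems by (auto intro: QS_sum)
  then show ?case using insert Phi_hom[of n] unfolding is_alg_hom_def by simp
qed (simp_all add: Phi_zero)

text \<open>A transposition is odd, so each summand of the Jucys-Murphy element acts as minus an
  exchange of two bottom positions.\<close>

lemma
  assumes i: "i \<in> {1..n}"
  shows TL_JM_in: "TL_JM n i \<in> TL n"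
    and realise_dmult_JM: "x \<in> Hom a n \<Longrightarrow> realise a n (x \<odot> TL_JM n i) s t =
      - (\<Sum>j\<in>{1..<i}. realise a n x s (t \<circ> swap j i))"
proof -
  have w: "swap j i permutes {1..n}" if "j \<in> {1..<i}" for j
    using i that by (intro permutes_swap_id) auto
  have eq: "TL_JM n i = (\<Sum>j\<in>{1..<i}. \<Phi> n (transp j i))"
    unfolding TL_JM_def JM_def
  proof (rule Phi_sum)
    show "transp j i \<in> QS n" if "j \<in> {1..<i}" for j unfolding transp_def by (rule QS_single[OF w[OF that]])
  qed
  have r: "realises_perm n (swap j i) (\<Phi> n (transp j i))" if "j \<in> {1..<i}" for j
    unfolding transp_def by (rule Phi_realises_perm[OF w[OF that]])
  have h: "\<Phi> n (transp j i) \<in> Hom n n" if "j \<in> {1..<i}" for j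
    using r[OF that] by (simp add: realises_perm_def TL_def)
  show T: "TL_JM n i \<in> TL n" unfolding eq TL_def by (rule Hom_sum[OF h])
  assume x: "x \<in> Hom a n"
  have "realise a n (x \<odot> TL_JM n i) s t = (\<Sum>z\<in>colours n. \<Sum>j\<in>{1..<i}. realise a n x s z * realise n n (\<Phi> n (transp j i)) z t)"
    using T by (simp add: realise_dmult[OF x] TL_def eq realise_sum sum_distrib_left)
  also have "\<dots> = (\<Sum>j\<in>{1..<i}. \<Sum>z\<in>colours n. realise a n x s z * realise n n (\<Phi> n (transp j i)) z t)"
    by (rule sum.swap)
  also have "\<dots> = (\<Sum>j\<in>{1..<i}. realise a n (x \<odot> \<Phi> n (transp j i)) s t)"
    by (intro sum.cong refl) (simp only: realise_dmult[OF x h])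
  also have "\<dots> = (\<Sum>j\<in>{1..<i}. - realise a n x s (t \<circ> swap j i))"
  proof (intro sum.cong refl)
    fix j assume j: "j \<in> {1..<i}"
    then have "j \<noteq> i" by simp
    then show "realise a n (x \<odot> \<Phi> n (transp j i)) s t = - realise a n x s (t \<circ> swap j i)"
      by (simp add: realise_right_perm[OF x w[OF j] r[OF j]] sign_swap_id)
  qed
  finally show "realise a n (x \<odot> TL_JM n i) s t =
      - (\<Sum>j\<in>{1..<i}. realise a n x s (t \<circ> swap j i))"
    by (simp add: sum_negf)
qed

section \<open>The projection onto symmetric tensors\<close>

definition symmetriser :: "nat \<Rightarrow> (nat \<Rightarrow> bool) \<Rightarrow> (nat \<Rightarrow> bool) \<Rightarrow> rat" where
  "symmetriser m s t = (\<Sum>w\<in>{w. w permutes {1..m}}. agree m s (t \<circ> w)) / fact m"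

text \<open>Reindexing the colourings by a permutation moves it from the matrix to \<open>g\<close>,
  which does not notice; each summand of the average thus gives \<open>g s\<close>.\<close>

lemma symmetriser_absorb:
  assumes cong: "\<And>z z'. (\<And>i. i \<in> {1..m} \<Longrightarrow> z i = z' i) \<Longrightarrow> g z = g z'"
    and sym: "\<And>w z. w permutes {1..m} \<Longrightarrow> g (z \<circ> w) = g z"
  shows "(\<Sum>z\<in>colours m. symmetriser m s z * g z) = g s"
proof -
  let ?P = "{w. w permutes {1..m}}"
  have one: "(\<Sum>z\<in>colours m. agree m s (z \<circ> w) * g z) = g s" if w: "w \<in> ?P" for w
  proof -
    have "(\<Sum>z\<in>colours m. agree m s (z \<circ> w) * g z) = (\<Sum>z\<in>colours m. agree m s (z \<circ> w) * g (z \<circ> w))"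
      using sym w by simp
    also have "\<dots> = (\<Sum>z\<in>colours m. agree m s z * g z)"
      using sum_colours_permute[of w m "\<lambda>z. agree m s z * g z"] w by simp
    also have "\<dots> = (\<Sum>z\<in>colours m. g z * agree m z s)" by (simp add: agree_commute mult.commute)
    also have "\<dots> = g s" by (rule sum_agree[OF cong])
    finally show ?thesis .
  qed
  have "(\<Sum>z\<in>colours m. symmetriser m s z * g z) =
      (\<Sum>z\<in>colours m. \<Sum>w\<in>?P. agree m s (z \<circ> w) * g z) / fact m"
    unfolding symmetriser_def by (simp add: sum_divide_distrib sum_distrib_right)
  also have "\<dots> = (\<Sum>w\<in>?P. \<Sum>z\<in>colours m. agree m s (z \<circ> w) * g z) / fact m"
    by (subst sum.swap) simp
  also have "\<dots> = (\<Sum>w\<in>?P. g s) / fact m" using one by simp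
  also have "\<dots> = g s" by (simp add: card_permutations[of _ m])
  finally show ?thesis .
qed

lemma symmetriser_right:
  assumes "p permutes {1..m}"
  shows "symmetriser m s (t \<circ> p) = symmetriser m s t"
  unfolding symmetriser_def
  by (subst (2) setum_permutations_compose_left[OF assms]) (simp add: o_assoc)

lemma symmetriser_left:
  assumes p: "p permutes {1..m}"
  shows "symmetriser m (s \<circ> p) t = symmetriser m s t"
proof -
  have "agree m (s \<circ> p) (t \<circ> w) = agree m s (t \<circ> (w \<circ> inv p))" for w
    using agree_transpose[OF p] by (simp add: o_assoc)
  then show ?thesis unfolding symmetriser_def
    by (subst (2) sum_permutations_compose_right[OF permutes_inv[OF p]]) simp
qed

lemma symmetriser_cong:
  assumes "\<And>i. i \<in> {1..m} \<Longrightarrow> s i = s' i" "\<And>i. i \<in> {1..m} \<Longrightarrow> t i = t' i"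
  shows "symmetriser m s t = symmetriser m s' t'"
proof -
  have "agree m s (t \<circ> w) = agree m s' (t' \<circ> w)" if "w permutes {1..m}" for w
  proof -
    have "t (w i) = t' (w i)" if "i \<in> {1..m}" for i
      using assms(2) permutes_in_image[OF \<open>w permutes {1..m}\<close>] that by blast
    then show ?thesis using assms(1) unfolding agree_def by simp
  qed
  then show ?thesis unfolding symmetriser_def by simp
qed

lemma sum_symmetriser_agree: "(\<Sum>z\<in>colours m. symmetriser m s z * agree m z t) = symmetriser m s t"
  by (rule sum_agree) (rule symmetriser_cong; simp)

lemma symmetriser_idempotent:
  "(\<Sum>z\<in>colours m. symmetriser m s z * symmetriser m z t) = symmetriser m s t"
  by (rule symmetriser_absorb[OF symmetriser_cong symmetriser_left]) simp_all

lemma symmetriser_const: "symmetriser m (\<lambda>_. c) (\<lambda>_. c) = 1"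
  by (simp add: symmetriser_def agree_def card_permutations[of _ m])

text \<open>The realisation carries the sign of a permutation, so the preimage is the
  antisymmetriser of the group algebra.\<close>

lemma ex_realises_symmetriser:
  "\<exists>y\<in>TL m. \<forall>s t. realise m m y s t = symmetriser m s t"
proof -
  let ?P = "{w. w permutes {1..m}}"
  define y where "y = (\<Sum>w\<in>?P. scale (of_int (sign w) / fact m) (\<Phi> m (Poly_Mapping.single w 1)))"
  note r = Phi_realises_perm[unfolded realises_perm_def TL_def]
  have "y \<in> TL m" unfolding y_def TL_def by (intro Hom_sum Hom_scale) (use r in auto)
  moreover have "realise m m y s t = symmetriser m s t" for s t
  proof -
    have "realise m m y s t = (\<Sum>w\<in>?P. of_int (sign w) / fact m * (of_int (sign w) * agree m s (t \<circ> w)))"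
      unfolding y_def realise_sum realise_scale by (intro sum.cong refl) (use r in simp)
    also have "\<dots> = symmetriser m s t"
      unfolding symmetriser_def sum_divide_distrib
      by (intro sum.cong refl) (simp add: mult.assoc[symmetric] of_int_mult[symmetric] del: of_int_mult)
    finally show ?thesis .
  qed
  ultimately show ?thesis by blast
qed

section \<open>Jones-Wenzl idempotents\<close>

text \<open>For equal spins both weights vanish. For different spins the exchange flips both ends of
  the cup together, which preserves compatibility, and \<open>sg\<close> changes because the ends
  have opposite parity.\<close>

lemma weight_cup_swap:
  assumes D: "D \<in> diagrams a b" and cup: "{Top i, Top j} \<in> D"
  shows "weight a b D (s \<circ> swap i j) t = - weight a b D s t"
proof -
  obtain \<pi> where n: "nc before (points a b) \<pi>" and D': "D = arcs (points a b) \<pi>"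
    by (rule diagram_arcsE[OF D])
  let ?\<tau> = "swap i j"
  have p: "Top i \<in> points a b" "\<pi> (Top i) = Top j"
    using cup[unfolded D' mem_arcs_iff[OF n]] by simp_all
  then have q: "Top j \<in> points a b" "\<pi> (Top j) = Top i" using ncD[OF n p(1)] by auto
  have ij: "i \<noteq> j" "even i \<noteq> even j" using pol_mate[OF n p(1)] p ncD(3)[OF n p(1)] by auto
  have odd: "odd (i + j)" using ij by simp
  show ?thesis
  proof (cases "s i = s j")
    case True
    have "\<not> compat D (twist s t)" "\<not> compat D (twist (s \<circ> ?\<tau>) t)"
      using True p q ij unfolding D' compat_arcs[OF n] by (auto intro!: bexI[of _ "Top i"])
    then show ?thesis by (simp add: weight_def)
  next
    case False
    have eq: "twist (s \<circ> ?\<tau>) t r = twist s t r" if "r \<noteq> Top i" "r \<noteq> Top j" for r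
      using that by (cases r) (auto simp: transpose_def)
    have "twist (s \<circ> ?\<tau>) t r = twist (s \<circ> ?\<tau>) t (\<pi> r) \<longleftrightarrow> twist s t r = twist s t (\<pi> r)"
      if r: "r \<in> points a b" for r
    proof (cases "r = Top i \<or> r = Top j")
      case True
      then show ?thesis using p q ij by auto
    next
      case False
      then have "\<pi> r \<noteq> Top i" "\<pi> r \<noteq> Top j" using ncD(2)[OF n r] p q by auto
      then show ?thesis using eq False by simp
    qed
    then have "compat D (twist (s \<circ> ?\<tau>) t) = compat D (twist s t)"
      unfolding D' compat_arcs[OF n] by blast
    then show ?thesis using sg_swap[of i a j s] p q ij False odd by (simp add: weight_def)
  qed
qed

text \<open>Without a cup all top points go to the bottom, and by counting all bottom points go to
  the top. Then the openers are the top points, as for the vertical lines, and the openers determine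
  the diagram.\<close>

lemma ex_top_cup:
  assumes D: "D \<in> diagrams m m" and ne: "D \<noteq> vertical_lines {1..m}"
  shows "\<exists>i j. i \<in> {1..m} \<and> j \<in> {1..m} \<and> {Top i, Top j} \<in> D"
proof (rule ccontr)
  assume no: "\<not> ?thesis"
  obtain \<pi> where n: "nc before (points m m) \<pi>" and D': "D = arcs (points m m) \<pi>"
    by (rule diagram_arcsE[OF D])
  let ?T = "Top ` {1..m}" and ?B = "Bot ` {1..m}"
  have S: "points m m = ?T \<union> ?B" by (simp add: points_def)
  have "\<pi> (Top i) \<in> ?B" if "i \<in> {1..m}" for i
  proof (cases "\<pi> (Top i)")
    case (Top j)
    then have "{Top i, Top j} \<in> D" "j \<in> {1..m}"
      using that mem_arcs_iff[OF n] ncD(1)[OF n, of "Top i"] unfolding D' by auto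
    then show ?thesis using no that by blast
  next
    case (Bot j)
    then show ?thesis using ncD(1)[OF n, of "Top i"] that by auto
  qed
  then have sub: "\<pi> ` ?T \<subseteq> ?B" by blast
  have "inj_on \<pi> (points m m)" by (rule inj_on_inverseI[where g = \<pi>]) (rule ncD(2)[OF n])
  then have "inj_on \<pi> ?T" unfolding S by (rule inj_on_subset) simp
  then have "card (\<pi> ` ?T) = card ?T" by (rule card_image)
  also have "\<dots> = card ?B" by (simp add: card_image inj_on_def)
  finally have "card (\<pi> ` ?T) = card ?B" .
  then have im: "\<pi> ` ?T = ?B" using sub by (intro card_subset_eq) auto
  have bot: "\<exists>i. \<pi> (Bot j) = Top i" if "j \<in> {1..m}" for j
  proof -
    have "Bot j \<in> \<pi> ` ?T" unfolding im using that by simp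
    then obtain i where "i \<in> {1..m}" "Bot j = \<pi> (Top i)" by blast
    then show ?thesis using ncD(2)[OF n, of "Top i"] by auto
  qed
  have O: "openers before (points m m) \<pi> = ?T"
  proof -
    have "before (Top i) (\<pi> (Top i))" if "i \<in> {1..m}" for i
    proof -
      have "\<pi> (Top i) \<in> ?B" using sub that by blast
      then show ?thesis by auto
    qed
    moreover have "\<not> before (Bot j) (\<pi> (Bot j))" if "j \<in> {1..m}" for j using bot[OF that] by auto
    ultimately show ?thesis unfolding openers_def S by auto
  qed
  define \<iota> where "\<iota> = (\<lambda>p. case p of Top i \<Rightarrow> Bot i | Bot i \<Rightarrow> Top i)"
  have \<iota>: "nc before (points m m) \<iota>" "vertical_lines {1..m} = arcs (points m m) \<iota>"
    unfolding \<iota>_def by (rule vertical_lines_arcs)+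
  have "openers before (points m m) \<iota> = ?T"
    unfolding openers_def S by (auto simp: \<iota>_def)
  then have "\<pi> p = \<iota> p" if "p \<in> points m m" for p
    using nc_determined_by_openers[OF strict_linear_before finite_points n \<iota>(1) _ that] O by simp
  then have "D = vertical_lines {1..m}" unfolding D' \<iota>(2) arcs_def by auto
  then show False using ne by simp
qed

text \<open>A symmetric matrix meets an alternating cup: exchanging the ends of the cup shows that
  the sum equals its own negative.\<close>

lemma symmetriser_weight:
  assumes D: "D \<in> diagrams m m" and ne: "D \<noteq> vertical_lines {1..m}"
  shows "(\<Sum>z\<in>colours m. symmetriser m s z * weight m m D z t) = 0"
proof -
  obtain i j where ij: "i \<in> {1..m}" "j \<in> {1..m}" "{Top i, Top j} \<in> D"
    using ex_top_cup[OF assms] by blast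
  have w: "swap i j permutes {1..m}" using ij by (intro permutes_swap_id)
  have "(\<Sum>z\<in>colours m. symmetriser m s z * weight m m D z t) =
    (\<Sum>z\<in>colours m. symmetriser m s (z \<circ> swap i j) * weight m m D (z \<circ> swap i j) t)"
    using sum_colours_permute[OF w, of "\<lambda>z. symmetriser m s z * weight m m D z t"] by simp
  also have "\<dots> = - (\<Sum>z\<in>colours m. symmetriser m s z * weight m m D z t)"
    unfolding symmetriser_right[OF w] weight_cup_swap[OF D ij(3)] by (simp add: sum_negf)
  finally show ?thesis by simp
qed

lemma sum_agree_left:
  assumes "\<And>z z'. (\<And>i. i \<in> {1..n} \<Longrightarrow> z i = z' i) \<Longrightarrow> g z = g z'"
  shows "(\<Sum>z\<in>colours n. agree n s z * g z) = g s"
  using sum_agree[OF assms] by (simp add: agree_commute[of n s] mult.commute)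

lemma realise_TL_u_left:
  assumes i: "i \<in> {1..<m}" and x: "x \<in> Hom m b"
  shows "realise m b (TL_u m i \<odot> x) s t = realise m b x s t - realise m b x (s \<circ> swap i (i + 1)) t"
proof -
  have u: "TL_u m i \<in> Hom m m" using TL_u_in[OF i] by (simp add: TL_def)
  have "(\<Sum>z\<in>colours m. agree m s z * realise m b x z t) = realise m b x s t" for s
    by (rule sum_agree_left) (rule realise_cong; simp)
  then show ?thesis
    unfolding realise_dmult[OF u x] realise_TL_u[OF i] left_diff_distrib sum_subtractf by simp
qed

definition jones_wenzl :: "nat \<Rightarrow> (diagram \<Rightarrow>\<^sub>0 rat) \<Rightarrow> bool" where
  "jones_wenzl m x \<longleftrightarrow> x \<in> TL m \<and> x \<noteq> 0 \<and> x \<odot> x = x \<and>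
     (\<forall>i\<in>{1..<m}. TL_u m i \<odot> x = 0 \<and> x \<odot> TL_u m i = 0)"

lemma symmetriser_jones_wenzl:
  assumes J: "J \<in> TL m" and R: "\<And>s t. realise m m J s t = symmetriser m s t"
  shows "jones_wenzl m J"
proof -
  have J': "J \<in> Hom m m" using J by (simp add: TL_def)
  have "J \<noteq> 0" using R[of "\<lambda>_. True" "\<lambda>_. True"] symmetriser_const[of m True] by auto
  moreover have "J \<odot> J = J"
  proof (rule realise_inject[OF dmult_Hom[OF J' J'] J'])
    fix s t
    show "realise m m (J \<odot> J) s t = realise m m J s t"
      unfolding realise_dmult[OF J' J'] R by (rule symmetriser_idempotent)
  qed
  moreover have "TL_u m i \<odot> J = 0 \<and> J \<odot> TL_u m i = 0" if i: "i \<in> {1..<m}" for i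
  proof
    have u: "TL_u m i \<in> Hom m m" using TL_u_in[OF i] by (simp add: TL_def)
    have w: "swap i (i + 1) permutes {1..m}" using i by (intro permutes_swap_id) auto
    show "TL_u m i \<odot> J = 0"
      by (rule realise_eq_0[OF dmult_Hom[OF u J']])
        (simp only: realise_TL_u_left[OF i J'] R symmetriser_left[OF w] diff_self)
    show "J \<odot> TL_u m i = 0"
    proof (rule realise_eq_0[OF dmult_Hom[OF J' u]])
      fix s t
      show "realise m m (J \<odot> TL_u m i) s t = 0"
        unfolding realise_dmult[OF J' u] R realise_TL_u[OF i] right_diff_distrib sum_subtractf
          agree_transpose[OF w] sum_symmetriser_agree symmetriser_right[OF permutes_inv[OF w]] by simp
    qed
  qed
  ultimately show ?thesis using J unfolding jones_wenzl_def by blast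
qed

text \<open>As \<open>u_i\<close> realises 1 minus an exchange, \<open>u_i x = 0\<close> makes
  \<open>x\<close> symmetric on the left, so the symmetriser fixes it. But the symmetriser kills
  every diagram except the vertical lines, so \<open>x\<close> is a multiple of \<open>J\<close>,
  and a nonzero idempotent multiple is \<open>J\<close>.\<close>

lemma jones_wenzl_unique:
  assumes J: "J \<in> TL m" and R: "\<And>s t. realise m m J s t = symmetriser m s t"
    and x: "jones_wenzl m x"
  shows "x = J"
proof -
  have J': "J \<in> Hom m m" and x': "x \<in> Hom m m" using J x by (simp_all add: TL_def jones_wenzl_def)
  have adj: "realise m m x (s \<circ> swap i (i + 1)) t = realise m m x s t" if i: "i \<in> {1..<m}" for i s t
    using realise_TL_u_left[OF i x', of s t] x i unfolding jones_wenzl_def by simp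
  have sym: "\<forall>s. realise m m x (s \<circ> w) t = realise m m x s t" if "w permutes {1..m}" for w t
    using that
  proof (induction rule: adjacent_permutes_induct)
    case (step i p)
    show ?case
    proof
      fix s
      show "realise m m x (s \<circ> (swap i (i + 1) \<circ> p)) t = realise m m x s t"
        using step(3) adj[OF step(1)] by (simp only: o_assoc)
    qed
  qed simp
  define c where "c = coeff x (vertical_lines {1..m})"
  have Rx: "realise m m x s t = c * symmetriser m s t" for s t
  proof -
    have "realise m m x s t = (\<Sum>z\<in>colours m. symmetriser m s z * realise m m x z t)"
    proof (rule symmetriser_absorb[symmetric])
      show "realise m m x z t = realise m m x z' t" if "\<And>i. i \<in> {1..m} \<Longrightarrow> z i = z' i" for z z'
        using that by (intro realise_cong) auto
    qed (use sym in blast)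
    also have "\<dots> = (\<Sum>z\<in>colours m. \<Sum>D\<in>diagrams m m. coeff x D * (symmetriser m s z * weight m m D z t))"
      unfolding realise_def by (simp add: sum_distrib_left mult_ac)
    also have "\<dots> = (\<Sum>D\<in>diagrams m m. \<Sum>z\<in>colours m. coeff x D * (symmetriser m s z * weight m m D z t))"
      by (rule sum.swap)
    also have "\<dots> = (\<Sum>D\<in>diagrams m m. coeff x D * (\<Sum>z\<in>colours m. symmetriser m s z * weight m m D z t))"
      by (simp add: sum_distrib_left)
    also have "\<dots> = (\<Sum>D\<in>diagrams m m. if D = vertical_lines {1..m} then c * symmetriser m s t else 0)"
    proof (intro sum.cong refl)
      fix D assume D: "D \<in> diagrams m m"
      show "coeff x D * (\<Sum>z\<in>colours m. symmetriser m s z * weight m m D z t) =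
          (if D = vertical_lines {1..m} then c * symmetriser m s t else 0)"
      proof (cases "D = vertical_lines {1..m}")
        case True
        show ?thesis unfolding True c_def weight_vertical_lines sum_symmetriser_agree by simp
      next
        case False
        show ?thesis unfolding symmetriser_weight[OF D False] using False by (simp only: if_False mult_zero_right)
      qed
    qed
    also have "\<dots> = (if vertical_lines {1..m} \<in> diagrams m m then c * symmetriser m s t else 0)"
      by (rule sum.delta) simp
    finally show ?thesis using vertical_lines_diagram[of m] by (simp only: if_True)
  qed
  have eq: "x = scale c J"
    by (rule realise_inject[OF x' Hom_scale[OF J']]) (simp add: Rx R realise_scale)
  have "c * c = c"
  proof -
    \<comment> \<open>At a constant colouring the symmetriser has entry 1, so the scalar equation
      can be read off.\<close>
    let ?t = "\<lambda>_. True"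
    have "c * c * symmetriser m ?t ?t = c * c * (\<Sum>z\<in>colours m. symmetriser m ?t z * symmetriser m z ?t)"
      by (simp only: symmetriser_idempotent)
    also have "\<dots> = realise m m (x \<odot> x) ?t ?t"
      unfolding realise_dmult[OF x' x'] Rx by (simp add: sum_distrib_left mult_ac)
    also have "\<dots> = c * symmetriser m ?t ?t" using x Rx by (simp add: jones_wenzl_def)
    finally show ?thesis by (simp add: symmetriser_const)
  qed
  moreover have "c \<noteq> 0"
  proof
    assume "c = 0"
    then have "x = 0" unfolding eq by (intro poly_mapping_eqI) simp
    then show False using x by (simp add: jones_wenzl_def)
  qed
  ultimately have "c = 1" by simp
  then show ?thesis unfolding eq by (intro poly_mapping_eqI) simp
qed

lemma JW_Hom: "JW m \<in> Hom m m"
  and realise_JW: "realise m m (JW m) s t = symmetriser m s t"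
proof -
  obtain J where J: "J \<in> TL m" "\<And>s t. realise m m J s t = symmetriser m s t"
    using ex_realises_symmetriser by blast
  have "JW m = (THE x. jones_wenzl m x)" unfolding JW_def jones_wenzl_def ..
  also have "\<dots> = J"
    using symmetriser_jones_wenzl[OF J] jones_wenzl_unique[OF J] by (rule the_equality)
  finally show "JW m \<in> Hom m m" "realise m m (JW m) s t = symmetriser m s t"
    using J by (simp_all add: TL_def)
qed

section \<open>Equivariance, juxtaposition and bending\<close>

lemma sg_flip:
  assumes i: "i \<in> {1..m}"
  shows "sg m (s(i := \<not> s i)) = (if odd i then - sg m s else sg m s)"
proof -
  let ?s' = "s(i := \<not> s i)"
  have "sg m s * sg m ?s' = (\<Prod>k\<in>{1..m}. (if s k \<and> odd k then - 1 else 1) * (if ?s' k \<and> odd k then - 1 else 1))"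
    unfolding sg_def prod.distrib ..
  also have "\<dots> = (\<Prod>k\<in>{i}. (if s k \<and> odd k then - 1 else 1) * (if ?s' k \<and> odd k then - 1 else 1))"
    by (rule prod.mono_neutral_right) (use i in auto)
  also have "\<dots> = (if odd i then - 1 else 1)" by auto
  finally have "sg m s * (sg m s * sg m ?s') = sg m s * (if odd i then - 1 else 1)" by simp
  then show ?thesis by (simp add: mult.assoc[symmetric])
qed

lemma compat_cong:
  assumes D: "D \<in> diagrams a b" and eq: "\<And>p. p \<in> points a b \<Longrightarrow> \<kappa> p = \<kappa>' p"
  shows "compat D \<kappa> = compat D \<kappa>'"
proof -
  obtain \<pi> where n: "nc before (points a b) \<pi>" and D': "D = arcs (points a b) \<pi>"
    by (rule diagram_arcsE[OF D])
  show ?thesis unfolding D' compat_arcs[OF n] using eq ncD(1)[OF n] by auto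
qed

lemma sum_points:
  "(\<Sum>p\<in>points a b. f p) = (\<Sum>i\<in>{1..a}. f (Top i)) + (\<Sum>j\<in>{1..b}. f (Bot j))"
proof -
  have "(\<Sum>p\<in>points a b. f p) = (\<Sum>p\<in>Top ` {1..a}. f p) + (\<Sum>p\<in>Bot ` {1..b}. f p)"
    unfolding points_def by (rule sum.union_disjoint) auto
  then show ?thesis by (simp add: sum.reindex inj_on_def)
qed

lemma sum_antisymmetric:
  fixes f :: "'a \<Rightarrow> rat"
  assumes n: "nc lt S \<pi>" and f: "\<And>p. p \<in> S \<Longrightarrow> f (\<pi> p) = - f p"
  shows "sum f S = 0"
proof -
  have "sum f S = (\<Sum>p\<in>S. f (\<pi> p))"
    by (rule sum.reindex_bij_witness[where i = \<pi> and j = \<pi>]) (use ncD[OF n] in auto)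
  also have "\<dots> = - sum f S" using f by (simp add: sum_negf)
  finally show ?thesis by simp
qed

text \<open>
  Infinitesimal \<open>GL\<^sub>2\<close>-equivariance: the matrix unit sending \<open>\<beta>\<close> to \<open>\<alpha>\<close> acts on the bottom
  points as it does on the top points, up to a multiple of the trace.  The two ends of each arc
  contribute opposite terms to the difference of the two sides.
\<close>

lemma weight_equivariant:
  assumes D: "D \<in> diagrams a b"
  shows "(\<Sum>j\<in>{1..b}. of_bool (t j = \<alpha>) * weight a b D s (t(j := \<beta>))) =
    (\<Sum>p\<in>{1..a}. of_bool (s p = \<beta>) * weight a b D (s(p := \<alpha>)) t) +
    (of_nat b - of_nat a) / 2 * of_bool (\<alpha> = \<beta>) * weight a b D s t"
proof -
  obtain \<pi> where n: "nc before (points a b) \<pi>" and D': "D = arcs (points a b) \<pi>"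
    by (rule diagram_arcsE[OF D])
  let ?\<kappa> = "twist s t" and ?W = "weight a b D"
  \<comment> \<open>Half of a possible diagonal contribution. Subtracting it at every point
    distributes the trace term, so that cancellation can be shown arc by arc.\<close>
  let ?h = "of_bool (\<alpha> = \<beta>) / 2 * ?W s t"
  define T where "T p = (case p of Top i \<Rightarrow> - (of_bool (s i = \<beta>) * ?W (s(i := \<alpha>)) t - ?h)
    | Bot j \<Rightarrow> of_bool (t j = \<alpha>) * ?W s (t(j := \<beta>)) - ?h)" for p
  \<comment> \<open>A description of the points with a possible contribution that is uniform in top
    and bottom. On an arc the values of \<open>pol\<close> differ, so \<open>e\<close> differs at
    ends of equal twisted colour and agrees at ends of different twisted colour.\<close>
  define e where "e p \<longleftrightarrow> (?\<kappa> p = pol p) = \<alpha>" for p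
  have e_simps: "e (Top i) \<longleftrightarrow> s i \<noteq> \<alpha>" "e (Bot j) \<longleftrightarrow> t j = \<alpha>" for i j
    unfolding e_def by auto
  have "T (\<pi> p) = - T p" if p: "p \<in> points a b" for p
  proof (cases "\<alpha> = \<beta>")
    case True
    have T: "T p = (of_bool (e p) - 1 / 2) * ?W s t" for p
    proof (cases p)
      case (Top i)
      have "s i = \<alpha> \<Longrightarrow> s(i := \<alpha>) = s" by auto
      then show ?thesis using True Top by (cases "s i = \<alpha>") (simp_all add: T_def e_simps algebra_simps)
    next
      case (Bot j)
      have "t j = \<alpha> \<Longrightarrow> t(j := \<alpha>) = t" by auto
      then show ?thesis using True Bot by (cases "t j = \<alpha>") (simp_all add: T_def e_simps algebra_simps)
    qed
    show ?thesis
    proof (cases "compat D ?\<kappa>")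
      case True
      then have "?\<kappa> p = ?\<kappa> (\<pi> p)" using p unfolding D' compat_arcs[OF n] by blast
      then have "e (\<pi> p) \<longleftrightarrow> \<not> e p" using pol_mate[OF n p] unfolding e_def by auto
      then show ?thesis unfolding T by (cases "e p") simp_all
    next
      case False
      then show ?thesis unfolding T by (simp add: weight_def)
    qed
  next
    case False
    \<comment> \<open>For an off-diagonal unit a term flips one spin. It survives if its arc is the
      only incompatible one, a condition shared by both ends, and the two surviving terms have
      opposite signs by \<open>pol\<close>.\<close>
    define c where "c p \<longleftrightarrow> e p \<and> compat D (?\<kappa>(p := \<not> ?\<kappa> p))" for p
    have T: "T p = of_bool (c p) * (sg a s * sg b t * (if pol p then - 1 else 1))" if "p \<in> points a b" for p
    proof (cases p)
      case (Top i)
      have \<beta>: "\<beta> = (\<not> \<alpha>)" using False by auto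
      show ?thesis
      proof (cases "s i = \<alpha>")
        case True then show ?thesis using Top \<beta> by (simp add: T_def c_def e_simps)
      next
        case F: False
        then have "s(i := \<alpha>) = s(i := \<not> s i)" by auto
        moreover have "twist (s(i := \<not> s i)) t = ?\<kappa>(Top i := \<not> ?\<kappa> (Top i))"
        proof
          fix q show "twist (s(i := \<not> s i)) t q = (?\<kappa>(Top i := \<not> ?\<kappa> (Top i))) q" by (cases q) auto
        qed
        moreover have "sg a (s(i := \<not> s i)) = (if odd i then - sg a s else sg a s)"
          using that Top by (intro sg_flip) simp
        ultimately show ?thesis using Top \<beta> F by (auto simp add: T_def c_def e_simps weight_def)
      qed
    next
      case (Bot j)
      have \<beta>: "\<beta> = (\<not> \<alpha>)" using False by auto
      show ?thesis
      proof (cases "t j = \<alpha>")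
        case F: True
        then have "t(j := \<beta>) = t(j := \<not> t j)" using \<beta> by auto
        moreover have "twist s (t(j := \<not> t j)) = ?\<kappa>(Bot j := \<not> ?\<kappa> (Bot j))"
        proof
          fix q show "twist s (t(j := \<not> t j)) q = (?\<kappa>(Bot j := \<not> ?\<kappa> (Bot j))) q" by (cases q) auto
        qed
        moreover have "sg b (t(j := \<not> t j)) = (if odd j then - sg b t else sg b t)"
          using that Bot by (intro sg_flip) simp
        ultimately show ?thesis using Bot \<beta> F by (auto simp add: T_def c_def e_simps weight_def)
      next
        case False then show ?thesis using Bot \<beta> by (simp add: T_def c_def e_simps)
      qed
    qed
    have cp: "compat D (?\<kappa>(q := \<not> ?\<kappa> q)) \<longleftrightarrow> ?\<kappa> q \<noteq> ?\<kappa> (\<pi> q) \<and>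
      (\<forall>r\<in>points a b - {q, \<pi> q}. ?\<kappa> r = ?\<kappa> (\<pi> r))" if q: "q \<in> points a b" for q
    proof -
      have "(?\<kappa>(q := \<not> ?\<kappa> q)) r = (?\<kappa>(q := \<not> ?\<kappa> q)) (\<pi> r) \<longleftrightarrow> ?\<kappa> r = ?\<kappa> (\<pi> r)"
        if "r \<in> points a b - {q, \<pi> q}" for r
        using that ncD(2)[OF n, of r] by auto
      moreover have "(?\<kappa>(q := \<not> ?\<kappa> q)) q = (?\<kappa>(q := \<not> ?\<kappa> q)) (\<pi> q) \<longleftrightarrow> ?\<kappa> q \<noteq> ?\<kappa> (\<pi> q)"
        "(?\<kappa>(q := \<not> ?\<kappa> q)) (\<pi> q) = (?\<kappa>(q := \<not> ?\<kappa> q)) (\<pi> (\<pi> q)) \<longleftrightarrow> ?\<kappa> q \<noteq> ?\<kappa> (\<pi> q)"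
        using ncD(2,3)[OF n q] by auto
      moreover have "points a b = insert q (insert (\<pi> q) (points a b - {q, \<pi> q}))"
        using q ncD(1)[OF n q] by auto
      ultimately show ?thesis unfolding D' compat_arcs[OF n] by (metis (no_types, lifting) insert_iff)
    qed
    have c: "c (\<pi> p) \<longleftrightarrow> c p"
    proof -
      have "{\<pi> p, \<pi> (\<pi> p)} = {p, \<pi> p}" using ncD(2)[OF n p] by auto
      then show ?thesis
        using cp[OF p] cp[OF ncD(1)[OF n p]] pol_mate[OF n p] ncD(2)[OF n p] unfolding c_def e_def by auto
    qed
    show ?thesis unfolding T[OF p] T[OF ncD(1)[OF n p]] c using pol_mate[OF n p] by simp
  qed
  then have "sum T (points a b) = 0" by (rule sum_antisymmetric[OF n])
  then show ?thesis
    unfolding sum_points T_def point.case sum_negf sum_subtractf sum_constant card_atLeastAtMost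
    by (simp only: diff_Suc_1 One_nat_def) (simp add: field_simps del: sum_of_bool_mult_eq sum_mult_of_bool_eq)
qed

lemma realise_equivariant:
  "(\<Sum>j\<in>{1..b}. of_bool (t j = \<alpha>) * realise a b x s (t(j := \<beta>))) =
    (\<Sum>p\<in>{1..a}. of_bool (s p = \<beta>) * realise a b x (s(p := \<alpha>)) t) +
    (of_nat b - of_nat a) / 2 * of_bool (\<alpha> = \<beta>) * realise a b x s t"
proof -
  have "(\<Sum>j\<in>{1..b}. of_bool (t j = \<alpha>) * realise a b x s (t(j := \<beta>))) =
    (\<Sum>j\<in>{1..b}. \<Sum>D\<in>diagrams a b. coeff x D * (of_bool (t j = \<alpha>) * weight a b D s (t(j := \<beta>))))"
    unfolding realise_def by (simp only: sum_distrib_left mult_ac)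
  also have "\<dots> = (\<Sum>D\<in>diagrams a b. coeff x D * (\<Sum>j\<in>{1..b}. of_bool (t j = \<alpha>) * weight a b D s (t(j := \<beta>))))"
    by (subst sum.swap) (simp only: sum_distrib_left)
  also have "\<dots> = (\<Sum>D\<in>diagrams a b. coeff x D * (\<Sum>p\<in>{1..a}. of_bool (s p = \<beta>) * weight a b D (s(p := \<alpha>)) t)) +
    (\<Sum>D\<in>diagrams a b. coeff x D * ((of_nat b - of_nat a) / 2 * of_bool (\<alpha> = \<beta>) * weight a b D s t))"
    by (simp only: weight_equivariant distrib_left sum.distrib cong: sum.cong)
  also have "(\<Sum>D\<in>diagrams a b. coeff x D * (\<Sum>p\<in>{1..a}. of_bool (s p = \<beta>) * weight a b D (s(p := \<alpha>)) t)) =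
    (\<Sum>D\<in>diagrams a b. \<Sum>p\<in>{1..a}. of_bool (s p = \<beta>) * (coeff x D * weight a b D (s(p := \<alpha>)) t))"
    by (simp only: sum_distrib_left mult_ac)
  also have "\<dots> = (\<Sum>p\<in>{1..a}. of_bool (s p = \<beta>) * realise a b x (s(p := \<alpha>)) t)"
    unfolding realise_def by (subst sum.swap) (simp only: sum_distrib_left)
  also have "(\<Sum>D\<in>diagrams a b. coeff x D * ((of_nat b - of_nat a) / 2 * of_bool (\<alpha> = \<beta>) * weight a b D s t)) =
    (of_nat b - of_nat a) / 2 * of_bool (\<alpha> = \<beta>) * realise a b x s t"
    unfolding realise_def by (simp only: sum_distrib_left mult_ac)
  finally show ?thesis .
qed

section \<open>Adding vertical strands on the right\<close>

lemma sg_add: "sg (a + d) s = sg a s * (\<Prod>e\<in>{1..d}. if s (a + e) \<and> odd (a + e) then - 1 else 1)"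
proof -
  let ?f = "\<lambda>i. if s i \<and> odd i then - 1 else (1 :: rat)"
  have "{1..a + d} = {1..a} \<union> (\<lambda>e. a + e) ` {1..d}"
  proof (intro equalityI subsetI)
    fix x assume x: "x \<in> {1..a + d}"
    show "x \<in> {1..a} \<union> (\<lambda>e. a + e) ` {1..d}"
    proof (cases "x \<le> a")
      case False
      then have "x = a + (x - a)" "x - a \<in> {1..d}" using x by auto
      then show ?thesis by blast
    qed (use x in simp)
  qed auto
  then have "sg (a + d) s = prod ?f {1..a} * prod ?f ((\<lambda>e. a + e) ` {1..d})"
    unfolding sg_def by (simp only:) (rule prod.union_disjoint; auto)
  also have "prod ?f ((\<lambda>e. a + e) ` {1..d}) = (\<Prod>e\<in>{1..d}. ?f (a + e))"
    by (rule prod.reindex[unfolded o_def]) (simp add: inj_on_def)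
  finally show ?thesis unfolding sg_def .
qed

definition extra_strands :: "nat \<Rightarrow> nat \<Rightarrow> nat \<Rightarrow> diagram" where
  "extra_strands a b d = (\<lambda>j. {Top (a + j), Bot (b + j)}) ` {1..d}"

lemma juxtapose_diagram:
  assumes D: "D \<in> diagrams a b"
  shows "D \<union> extra_strands a b d \<in> diagrams (a + d) (b + d)"
proof -
  obtain \<pi> where n: "nc before (points a b) \<pi>" and D': "D = arcs (points a b) \<pi>"
    by (rule diagram_arcsE[OF D])
  define \<rho> where "\<rho> p = (case p of Top i \<Rightarrow> if i \<le> a then \<pi> p else Bot (b + (i - a))
     | Bot j \<Rightarrow> if j \<le> b then \<pi> p else Top (a + (j - b)))" for p
  let ?N = "Top ` (\<lambda>e. a + e) ` {1..d} \<union> Bot ` (\<lambda>e. b + e) ` {1..d}"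
  have S: "points (a + d) (b + d) = points a b \<union> ?N"
  proof (intro equalityI subsetI)
    fix p assume p: "p \<in> points (a + d) (b + d)"
    show "p \<in> points a b \<union> ?N"
    proof (cases p)
      case (Top i)
      show ?thesis
      proof (cases "i \<le> a")
        case False
        then have "i = a + (i - a)" "i - a \<in> {1..d}" using p Top by auto
        then show ?thesis using Top by blast
      qed (use p Top in simp)
    next
      case (Bot i)
      show ?thesis
      proof (cases "i \<le> b")
        case False
        then have "i = b + (i - b)" "i - b \<in> {1..d}" using p Bot by auto
        then show ?thesis using Bot by blast
      qed (use p Bot in simp)
    qed
  qed (auto simp: points_def)
  have old: "\<rho> p = \<pi> p" "\<rho> p \<in> points a b" if "p \<in> points a b" for p
    using that ncD(1)[OF n that] by (cases p; simp add: \<rho>_def)+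
  have new: "\<rho> (Top (a + e)) = Bot (b + e)" "\<rho> (Bot (b + e)) = Top (a + e)" if "e \<in> {1..d}" for e
    using that by (auto simp: \<rho>_def)
  have nr: "nc before (points (a + d) (b + d)) \<rho>"
    unfolding nc_def S
  proof (intro conjI ballI)
    fix p assume p: "p \<in> points a b \<union> ?N"
    have "\<rho> p \<in> points a b \<union> ?N \<and> \<rho> (\<rho> p) = p \<and> \<rho> p \<noteq> p"
    proof (cases "p \<in> points a b")
      case True
      then show ?thesis using old[OF True] old(1)[OF ncD(1)[OF n True]] ncD[OF n True] by simp
    next
      case False
      then obtain e where e: "e \<in> {1..d}" "p = Top (a + e) \<or> p = Bot (b + e)" using p by blast
      then show ?thesis using new[OF e(1)] by auto
    qed
    then show "\<rho> p \<in> points a b \<union> ?N" "\<rho> (\<rho> p) = p" "\<rho> p \<noteq> p" by simp_all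
  next
    fix p r assume pr: "p \<in> points a b \<union> ?N" "r \<in> points a b \<union> ?N"
    show "\<not> (before p r \<and> before r (\<rho> p) \<and> before (\<rho> p) (\<rho> r))"
    proof
      assume A: "before p r \<and> before r (\<rho> p) \<and> before (\<rho> p) (\<rho> r)"
      consider "p \<in> points a b" "r \<in> points a b" | "p \<in> points a b" "r \<in> ?N" | "p \<in> ?N" "r \<in> points a b" | "p \<in> ?N" "r \<in> ?N"
        using pr by blast
      then show False
      proof cases
        case 1 then show ?thesis using A old ncD_cross[OF n] by metis
      next
        case 2
        then obtain e where e: "e \<in> {1..d}" "r = Top (a + e) \<or> r = Bot (b + e)" by blast
        then show ?thesis using A new[OF e(1)] old(2)[OF 2(1)] by (cases "\<rho> p") auto
      next
        case 3
        then obtain e where e: "e \<in> {1..d}" "p = Top (a + e) \<or> p = Bot (b + e)" by blast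
        then show ?thesis using A new[OF e(1)] 3(2) by (cases r) auto
      next
        case 4
        then obtain e e' where e: "e \<in> {1..d}" "p = Top (a + e) \<or> p = Bot (b + e)"
          "e' \<in> {1..d}" "r = Top (a + e') \<or> r = Bot (b + e')" by blast
        then show ?thesis using A new[OF e(1)] new[OF e(3)] by auto
      qed
    qed
  qed
  have "arcs (points (a + d) (b + d)) \<rho> = D \<union> extra_strands a b d"
  proof -
    have "(\<lambda>p. {p, \<rho> p}) ` points a b = D" unfolding D' arcs_def by (rule image_cong) (simp_all add: old)
    moreover have "(\<lambda>p. {p, \<rho> p}) ` ?N = extra_strands a b d"
      unfolding extra_strands_def image_Un image_image using new by (auto simp: insert_commute image_iff)
    ultimately show ?thesis unfolding arcs_def S image_Un by simp
  qed
  then show ?thesis using arcs_in_diagrams[OF nr] by simp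
qed

text \<open>As \<open>a\<close> and \<open>b\<close> have the same parity, a new strand joins
  positions of equal parity and its two sign factors cancel.\<close>

lemma weight_juxtapose:
  assumes D: "D \<in> diagrams a b"
  shows "weight (a + d) (b + d) (D \<union> extra_strands a b d) s t =
    weight a b D s t * of_bool (\<forall>e\<in>{1..d}. s (a + e) = t (b + e))"
proof -
  have e: "even a = even b" using even_hom[OF D] by auto
  have c: "compat (D \<union> extra_strands a b d) (twist s t) \<longleftrightarrow>
    compat D (twist s t) \<and> (\<forall>e\<in>{1..d}. s (a + e) = t (b + e))"
  proof -
    have "compat (extra_strands a b d) (twist s t) \<longleftrightarrow> (\<forall>e\<in>{1..d}. s (a + e) = t (b + e))"
      using e unfolding compat_def extra_strands_def by auto
    then show ?thesis by (simp add: compat_def ball_Un)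
  qed
  have "sg (a + d) s * sg (b + d) t = sg a s * sg b t" if eq: "\<forall>e\<in>{1..d}. s (a + e) = t (b + e)"
  proof -
    have "(\<Prod>e\<in>{1..d}. if s (a + e) \<and> odd (a + e) then - 1 else 1 :: rat) * (\<Prod>e\<in>{1..d}. if t (b + e) \<and> odd (b + e) then - 1 else 1) = 1"
      unfolding prod.distrib[symmetric] by (rule prod.neutral) (use eq e in auto)
    then show ?thesis unfolding sg_add by (simp add: algebra_simps)
  qed
  then show ?thesis unfolding weight_def c by (auto simp: mult.assoc)
qed

lemma juxtapose_eq:
  assumes "g \<in> Hom a b"
  shows "juxtapose a b d g = (\<Sum>D\<in>diagrams a b. Poly_Mapping.single (D \<union> extra_strands a b d) (coeff g D))"
  unfolding juxtapose_def extra_strands_def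
  by (subst lin_ext_superset[OF finite_diagrams]) (use assms in \<open>simp_all add: Hom_def\<close>)

lemma juxtapose_Hom:
  assumes "g \<in> Hom a b" shows "juxtapose a b d g \<in> Hom (a + d) (b + d)"
  unfolding juxtapose_eq[OF assms] by (intro Hom_sum Hom_single juxtapose_diagram)

lemma realise_juxtapose:
  assumes "g \<in> Hom a b"
  shows "realise (a + d) (b + d) (juxtapose a b d g) s t =
    realise a b g s t * of_bool (\<forall>e\<in>{1..d}. s (a + e) = t (b + e))"
proof -
  have "realise (a + d) (b + d) (juxtapose a b d g) s t = (\<Sum>D\<in>diagrams a b. coeff g D *
      (weight a b D s t * of_bool (\<forall>e\<in>{1..d}. s (a + e) = t (b + e))))"
    unfolding juxtapose_eq[OF assms] realise_sum
    by (intro sum.cong refl) (simp only: realise_single[OF juxtapose_diagram] weight_juxtapose)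
  then show ?thesis unfolding realise_def sum_distrib_right by (simp only: mult.assoc)
qed

section \<open>Bending top strands to the bottom\<close>

lemma bend_point_properties:
  assumes m: "m \<le> a"
  shows "bend_point a b m ` points a b = points (a - m) (b + m)"
    and "inj_on (bend_point a b m) (points a b)"
    and "p \<in> points a b \<Longrightarrow> q \<in> points a b \<Longrightarrow>
      before (bend_point a b m p) (bend_point a b m q) \<longleftrightarrow> before p q"
proof -
  show "bend_point a b m ` points a b = points (a - m) (b + m)"
  proof (intro equalityI subsetI)
    fix p assume "p \<in> bend_point a b m ` points a b"
    then obtain q where "q \<in> points a b" "p = bend_point a b m q" by blast
    then show "p \<in> points (a - m) (b + m)" using m by (cases q) auto
  next
    fix p assume p: "p \<in> points (a - m) (b + m)"
    show "p \<in> bend_point a b m ` points a b"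
    proof (cases p)
      case (Top i)
      then show ?thesis using p m by (intro image_eqI[of _ _ "Top i"]) auto
    next
      case (Bot j)
      show ?thesis
      proof (cases "j \<le> b")
        case True
        then show ?thesis using p Bot by (intro image_eqI[of _ _ "Bot j"]) auto
      next
        case False
        then show ?thesis using p m Bot by (intro image_eqI[of _ _ "Top (a + 1 - (j - b))"]) auto
      qed
    qed
  qed
  show ord: "before (bend_point a b m p) (bend_point a b m q) \<longleftrightarrow> before p q"
    if "p \<in> points a b" "q \<in> points a b" for p q
    using that m by (cases p; cases q) auto
  show "inj_on (bend_point a b m) (points a b)"
  proof (rule inj_onI)
    fix p q assume "p \<in> points a b" "q \<in> points a b" "bend_point a b m p = bend_point a b m q"
    then show "p = q" using ord[of p q] ord[of q p] strict_linear_before unfolding strict_linear_def by metis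
  qed
qed

lemma bend_diagram:
  assumes D: "D \<in> diagrams a b" and m: "m \<le> a"
  shows "(`) (bend_point a b m) ` D \<in> diagrams (a - m) (b + m)"
proof -
  obtain \<pi> where n: "nc before (points a b) \<pi>" and D': "D = arcs (points a b) \<pi>"
    by (rule diagram_arcsE[OF D])
  note P = bend_point_properties[OF m, where b = b]
  show ?thesis
    using arcs_in_diagrams nc_image[OF n P(2,3)] unfolding D' P(1) by metis
qed

text \<open>The top colouring before bending. The negation reflects that bending turns a through
  strand, with equal spins, into an arc with opposite spins, and conversely.\<close>

definition unbent :: "nat \<Rightarrow> nat \<Rightarrow> nat \<Rightarrow> (nat \<Rightarrow> bool) \<Rightarrow> (nat \<Rightarrow> bool) \<Rightarrow> nat \<Rightarrow> bool" where
  "unbent a b m s t i = (if i \<le> a - m then s i else \<not> t (b + (a + 1 - i)))"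

text \<open>The change of the sign factors when a point moves from the top to the bottom, where its
  spin and the parity of its position are both reversed.\<close>

definition bend_sign :: "nat \<Rightarrow> nat \<Rightarrow> (nat \<Rightarrow> bool) \<Rightarrow> rat" where
  "bend_sign b m t = (\<Prod>e\<in>{1..m}. if t (b + e) = even (b + e) then 1 else - 1)"

lemma weight_bend:
  assumes D: "D \<in> diagrams a b" and m: "m \<le> a"
  shows "weight (a - m) (b + m) ((`) (bend_point a b m) ` D) s t =
    bend_sign b m t * weight a b D (unbent a b m s t) t"
proof -
  let ?S = "unbent a b m s t"
  have e: "even a = even b" using even_hom[OF D] by auto
  have "compat ((`) (bend_point a b m) ` D) (twist s t) \<longleftrightarrow> compat D (\<lambda>p. twist s t (bend_point a b m p))"
    by (auto simp: compat_def)
  also have "\<dots> \<longleftrightarrow> compat D (twist ?S t)"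
  proof (rule compat_cong[OF D])
    fix p assume p: "p \<in> points a b"
    show "twist s t (bend_point a b m p) = twist ?S t p"
    proof (cases p)
      case (Top i)
      \<comment> \<open>This parity reversal cancels the negation in \<open>unbent\<close>, so
        twisted colours are unchanged by bending.\<close>
      have "even (b + (a + 1 - i)) \<longleftrightarrow> odd i" if "i \<le> a" using e that by auto
      then show ?thesis using p Top by (auto simp: unbent_def)
    qed simp
  qed
  finally have c: "compat ((`) (bend_point a b m) ` D) (twist s t) \<longleftrightarrow> compat D (twist ?S t)" .
  \<comment> \<open>The sign factors of the bent points before bending, written in their bottom
    coordinates.\<close>
  define Q where "Q = (\<Prod>e\<in>{1..m}. if \<not> t (b + e) \<and> even (b + e) then - 1 else 1 :: rat)"
  have QQ: "Q * Q = 1" unfolding Q_def prod.distrib[symmetric] by (rule prod.neutral) auto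
  have "sg a ?S = sg (a - m) ?S * (\<Prod>e\<in>{1..m}. if ?S (a - m + e) \<and> odd (a - m + e) then - 1 else 1)"
    using sg_add[of "a - m" m ?S] m by simp
  also have "(\<Prod>e\<in>{1..m}. if ?S (a - m + e) \<and> odd (a - m + e) then - 1 else 1 :: rat) = Q"
    unfolding Q_def
  \<comment> \<open>The rightmost top point becomes the first new bottom point, so the order is
    reversed.\<close>
  proof (rule prod.reindex_bij_witness[where i = "\<lambda>e. m + 1 - e" and j = "\<lambda>e. m + 1 - e"])
    fix f assume f: "f \<in> {1..m}"
    have "a + 1 - (a - m + f) = m + 1 - f" using f m by auto
    moreover have "even (b + (m + 1 - f)) \<longleftrightarrow> odd (a - m + f)"
      using f m e by auto
    moreover have "?S (a - m + f) = (\<not> t (b + (a + 1 - (a - m + f))))"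
      using f by (simp add: unbent_def)
    ultimately show "(if \<not> t (b + (m + 1 - f)) \<and> even (b + (m + 1 - f)) then - 1 else 1 :: rat) =
        (if ?S (a - m + f) \<and> odd (a - m + f) then - 1 else 1)"
      by (simp only:)
  qed auto
  also have "sg (a - m) ?S = sg (a - m) s" by (rule sg_cong) (simp add: unbent_def)
  finally have sS: "sg (a - m) s = sg a ?S * Q" using QQ by (simp add: mult.assoc)
  have "Q * (\<Prod>e\<in>{1..m}. if t (b + e) \<and> odd (b + e) then - 1 else 1) = bend_sign b m t"
    unfolding Q_def bend_sign_def prod.distrib[symmetric] by (rule prod.cong) auto
  then have "sg (a - m) s * sg (b + m) t = bend_sign b m t * (sg a ?S * sg b t)"
    unfolding sS sg_add by (simp add: algebra_simps)
  then show ?thesis unfolding weight_def c by (simp add: mult_ac)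
qed

lemma bend_eq:
  assumes "g \<in> Hom a b"
  shows "bend a b m g = (\<Sum>D\<in>diagrams a b. Poly_Mapping.single ((`) (bend_point a b m) ` D) (coeff g D))"
  unfolding bend_def
  by (subst lin_ext_superset[OF finite_diagrams]) (use assms in \<open>simp_all add: Hom_def\<close>)

lemma bend_Hom:
  assumes "g \<in> Hom a b" "m \<le> a" shows "bend a b m g \<in> Hom (a - m) (b + m)"
  unfolding bend_eq[OF assms(1)] by (intro Hom_sum Hom_single bend_diagram assms)

lemma realise_bend:
  assumes "g \<in> Hom a b" "m \<le> a"
  shows "realise (a - m) (b + m) (bend a b m g) s t =
    bend_sign b m t * realise a b g (unbent a b m s t) t"
proof -
  have "realise (a - m) (b + m) (bend a b m g) s t = (\<Sum>D\<in>diagrams a b. coeff g D *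
      (bend_sign b m t * weight a b D (unbent a b m s t) t))"
    unfolding bend_eq[OF assms(1)] realise_sum
    by (intro sum.cong refl) (simp only: realise_single[OF bend_diagram[OF _ assms(2)]] weight_bend[OF _ assms(2)])
  then show ?thesis unfolding realise_def sum_distrib_left by (simp only: mult_ac)
qed

section \<open>Jucys-Murphy eigenvectors\<close>

text \<open>The equation for the eigenvalue \<open>c\<close>, read through the realisation; the
  minus sign is that of an odd transposition. Only exchanges of bottom positions occur, so it makes
  sense for every intermediate \<open>b\<close> of the recursion.\<close>

definition jm_eigen :: "nat \<Rightarrow> nat \<Rightarrow> (diagram \<Rightarrow>\<^sub>0 rat) \<Rightarrow> nat \<Rightarrow> rat \<Rightarrow> bool" where
  "jm_eigen a b x i c \<longleftrightarrow> (\<forall>s t.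
     (\<Sum>j\<in>{1..<i}. realise a b x s (t \<circ> swap j i)) = - c * realise a b x s t)"

definition top_symmetric :: "nat \<Rightarrow> nat \<Rightarrow> (diagram \<Rightarrow>\<^sub>0 rat) \<Rightarrow> bool" where
  "top_symmetric a b x \<longleftrightarrow> (\<forall>w s t. w permutes {1..a} \<longrightarrow> realise a b x (s \<circ> w) t = realise a b x s t)"

lemma realise_JW_dmult:
  assumes "y \<in> Hom m b"
  shows "realise m b (JW m \<odot> y) s t = (\<Sum>z\<in>colours m. symmetriser m s z * realise m b y z t)"
  unfolding realise_dmult[OF JW_Hom assms] realise_JW ..

lemma top_symmetric_JW:
  assumes "y \<in> Hom m b"
  shows "top_symmetric m b (JW m \<odot> y)"
  unfolding top_symmetric_def realise_JW_dmult[OF assms]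
proof (intro allI impI)
  fix w s t assume w: "w permutes {1..m}"
  show "(\<Sum>z\<in>colours m. symmetriser m (s \<circ> w) z * realise m b y z t) =
      (\<Sum>z\<in>colours m. symmetriser m s z * realise m b y z t)"
    by (simp only: symmetriser_left[OF w])
qed

text \<open>Any exchange just below a Jones-Wenzl idempotent is absorbed by it.\<close>

lemma symmetriser_sum_permute:
  assumes w: "w permutes {1..m}"
  shows "(\<Sum>z\<in>colours m. symmetriser m s z * g (z \<circ> w)) = (\<Sum>z\<in>colours m. symmetriser m s z * g z)"
proof -
  have "(\<Sum>z\<in>colours m. symmetriser m s z * g (z \<circ> w)) = (\<Sum>z\<in>colours m. symmetriser m s (z \<circ> w) * g (z \<circ> w))"
    by (simp only: symmetriser_right[OF w])
  also have "\<dots> = (\<Sum>z\<in>colours m. symmetriser m s z * g z)"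
    by (rule sum_colours_permute[OF w])
  finally show ?thesis .
qed

lemma sum_split_at:
  fixes b e :: nat and f :: "nat \<Rightarrow> rat"
  assumes "1 \<le> e"
  shows "(\<Sum>j\<in>{1..<b + e}. f j) = (\<Sum>j\<in>{1..b}. f j) + (\<Sum>j\<in>{1..<e}. f (b + j))"
proof -
  have "(\<Sum>j\<in>{1..<b + e}. f j) = (\<Sum>j\<in>{1..<1 + b}. f j) + (\<Sum>j\<in>{1 + b..<e + b}. f j)"
  proof -
    have "(\<Sum>j\<in>{1..<1 + b}. f j) + (\<Sum>j\<in>{1 + b..<e + b}. f j) = (\<Sum>j\<in>{1..<e + b}. f j)"
      by (rule sum.atLeastLessThan_concat) (use assms in simp_all)
    then show ?thesis by (simp only: add.commute[of b e])
  qed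
  also have "{1..<1 + b} = {1..b}" by auto
  also have "(\<Sum>j\<in>{1 + b..<e + b}. f j) = (\<Sum>j\<in>{1..<e}. f (b + j))"
    by (subst sum.shift_bounds_nat_ivl) (simp add: add.commute)
  finally show ?thesis .
qed

text \<open>The exchanges concern old bottom points only; they neither touch the new strands nor
  interfere with the idempotent on top.\<close>

lemma jm_eigen_juxtapose_old:
  assumes g: "g \<in> Hom a b" and E: "jm_eigen a b g i c" and i: "i \<in> {1..b}"
  shows "jm_eigen (a + d) (b + d) (JW (a + d) \<odot> juxtapose a b d g) i c"
proof -
  let ?y = "juxtapose a b d g"
  have y: "?y \<in> Hom (a + d) (b + d)" by (rule juxtapose_Hom[OF g])
  have Ey: "(\<Sum>j\<in>{1..<i}. realise (a + d) (b + d) ?y s (t \<circ> swap j i)) =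
      - c * realise (a + d) (b + d) ?y s t" for s t
  proof -
    have "(\<Sum>j\<in>{1..<i}. realise (a + d) (b + d) ?y s (t \<circ> swap j i)) =
        (\<Sum>j\<in>{1..<i}. realise a b g s (t \<circ> swap j i) * of_bool (\<forall>e\<in>{1..d}. s (a + e) = t (b + e)))"
    proof (rule sum.cong[OF refl])
      fix j assume j: "j \<in> {1..<i}"
      have "(t \<circ> swap j i) (b + e) = t (b + e)" if "e \<in> {1..d}" for e
        using that i j by (simp add: transpose_def)
      then have "(\<forall>e\<in>{1..d}. s (a + e) = (t \<circ> swap j i) (b + e)) \<longleftrightarrow>
          (\<forall>e\<in>{1..d}. s (a + e) = t (b + e))" by (intro ball_cong refl) (simp only:)
      then show "realise (a + d) (b + d) ?y s (t \<circ> swap j i) =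
          realise a b g s (t \<circ> swap j i) * of_bool (\<forall>e\<in>{1..d}. s (a + e) = t (b + e))"
        unfolding realise_juxtapose[OF g] by (simp only:)
    qed
    also have "\<dots> = - c * realise (a + d) (b + d) ?y s t"
      using E unfolding sum_distrib_right[symmetric] realise_juxtapose[OF g] jm_eigen_def by simp
    finally show ?thesis .
  qed
  show ?thesis unfolding jm_eigen_def
  proof (intro allI)
    fix s t
    have "(\<Sum>j\<in>{1..<i}. realise (a + d) (b + d) (JW (a + d) \<odot> ?y) s (t \<circ> swap j i)) =
        (\<Sum>z\<in>colours (a + d). symmetriser (a + d) s z *
          (\<Sum>j\<in>{1..<i}. realise (a + d) (b + d) ?y z (t \<circ> swap j i)))"
      unfolding realise_JW_dmult[OF y] by (subst sum.swap) (simp add: sum_distrib_left)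
    also have "\<dots> = - c * realise (a + d) (b + d) (JW (a + d) \<odot> ?y) s t"
      unfolding Ey realise_JW_dmult[OF y] by (simp add: sum_distrib_left mult_ac sum_negf)
    finally show "(\<Sum>j\<in>{1..<i}. realise (a + d) (b + d) (JW (a + d) \<odot> ?y) s (t \<circ> swap j i)) =
        - c * realise (a + d) (b + d) (JW (a + d) \<odot> ?y) s t" .
  qed
qed

text \<open>Exchanges with old bottom points pass through \<open>g\<close> by equivariance and come
  out as exchanges with old top points plus a scalar from the trace. Exchanges among new strands
  slide along them from bottom to top.\<close>

lemma juxtapose_transpositions:
  assumes g: "g \<in> Hom a b" and e: "e \<in> {1..d}"
  defines "H \<equiv> realise (a + d) (b + d) (juxtapose a b d g)"
  shows "(\<Sum>j\<in>{1..<b + e}. H s (t \<circ> swap j (b + e))) =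
    (\<Sum>p\<in>{1..<a + e}. H (s \<circ> swap p (a + e)) t) + (of_nat b - of_nat a) / 2 * H s t"
proof -
  let ?G = "realise a b g"
  define \<delta> where "\<delta> s t \<longleftrightarrow> (\<forall>f\<in>{1..d}. s (a + f) = t (b + f))" for s t :: "nat \<Rightarrow> bool"
  \<comment> \<open>The matching condition on the new strands other than \<open>e\<close>, which no
    exchange with an old point affects.\<close>
  define \<delta>' where "\<delta>' \<longleftrightarrow> (\<forall>f\<in>{1..d} - {e}. s (a + f) = t (b + f))"
  have H: "H s t = ?G s t * of_bool (\<delta> s t)" for s t
    unfolding H_def \<delta>_def by (rule realise_juxtapose[OF g])
  have I: "{1..d} = insert e ({1..d} - {e})" using e by auto
  let ?\<alpha> = "t (b + e)" and ?\<beta> = "s (a + e)"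
  have 1: "(\<Sum>j\<in>{1..b}. H s (t \<circ> swap j (b + e))) =
    (\<Sum>p\<in>{1..a}. H (s \<circ> swap p (a + e)) t) + (of_nat b - of_nat a) / 2 * H s t"
  proof -
    \<comment> \<open>The strand \<open>e\<close> fixes both indices of the matrix unit: after the
      exchange its bottom spin is \<open>t j\<close>, which must equal \<open>?\<beta>\<close>, and
      position \<open>j\<close> receives \<open>?\<alpha>\<close>.\<close>
    have "(\<Sum>j\<in>{1..b}. H s (t \<circ> swap j (b + e))) =
      (\<Sum>j\<in>{1..b}. of_bool (t j = ?\<beta>) * ?G s (t(j := ?\<alpha>))) * of_bool \<delta>'"
      unfolding sum_distrib_right
    proof (rule sum.cong[OF refl])
      fix j assume j: "j \<in> {1..b}"
      let ?t = "t \<circ> swap j (b + e)"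
      have "?G s ?t = ?G s (t(j := ?\<alpha>))"
        by (rule realise_cong) (use j e in \<open>auto simp: transpose_def\<close>)
      moreover have "?t (b + f) = t (b + f)" if "f \<in> {1..d} - {e}" for f
        using that j e by (auto simp: transpose_def)
      then have "(\<forall>f\<in>{1..d} - {e}. s (a + f) = ?t (b + f)) \<longleftrightarrow> \<delta>'"
        unfolding \<delta>'_def by (intro ball_cong refl) (simp only:)
      moreover have "?t (b + e) = t j" by (simp add: transpose_def)
      moreover have "\<delta> s ?t \<longleftrightarrow> s (a + e) = ?t (b + e) \<and> (\<forall>f\<in>{1..d} - {e}. s (a + f) = ?t (b + f))"
        unfolding \<delta>_def by (subst I) (simp only: ball_simps)
      ultimately have "?G s ?t = ?G s (t(j := ?\<alpha>))" "\<delta> s ?t \<longleftrightarrow> t j = ?\<beta> \<and> \<delta>'"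
        by (simp only:, metis)
      then show "H s ?t = of_bool (t j = ?\<beta>) * ?G s (t(j := ?\<alpha>)) * of_bool \<delta>'"
        unfolding H by (simp add: of_bool_conj)
    qed
    also have "\<dots> = ((\<Sum>p\<in>{1..a}. of_bool (s p = ?\<alpha>) * ?G (s(p := ?\<beta>)) t) +
        (of_nat b - of_nat a) / 2 * of_bool (?\<beta> = ?\<alpha>) * ?G s t) * of_bool \<delta>'"
      unfolding realise_equivariant ..
    also have "\<dots> = (\<Sum>p\<in>{1..a}. of_bool (s p = ?\<alpha>) * ?G (s(p := ?\<beta>)) t * of_bool \<delta>') +
        (of_nat b - of_nat a) / 2 * (?G s t * of_bool (?\<beta> = ?\<alpha> \<and> \<delta>'))"
      by (simp only: distrib_left distrib_right sum_distrib_left sum_distrib_right of_bool_conj mult_ac)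
    also have "(\<Sum>p\<in>{1..a}. of_bool (s p = ?\<alpha>) * ?G (s(p := ?\<beta>)) t * of_bool \<delta>') =
        (\<Sum>p\<in>{1..a}. H (s \<circ> swap p (a + e)) t)"
    proof (rule sum.cong[OF refl])
      fix p assume p: "p \<in> {1..a}"
      let ?s = "s \<circ> swap p (a + e)"
      have "?G ?s t = ?G (s(p := ?\<beta>)) t"
        by (rule realise_cong) (use p e in \<open>auto simp: transpose_def\<close>)
      moreover have "?s (a + f) = s (a + f)" if "f \<in> {1..d} - {e}" for f
        using that p e by (auto simp: transpose_def)
      then have "(\<forall>f\<in>{1..d} - {e}. ?s (a + f) = t (b + f)) \<longleftrightarrow> \<delta>'"
        unfolding \<delta>'_def by (intro ball_cong refl) (simp only:)
      moreover have "?s (a + e) = s p" by (simp add: transpose_def)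
      moreover have "\<delta> ?s t \<longleftrightarrow> ?s (a + e) = t (b + e) \<and> (\<forall>f\<in>{1..d} - {e}. ?s (a + f) = t (b + f))"
        unfolding \<delta>_def by (subst I) (simp only: ball_simps)
      ultimately have "?G ?s t = ?G (s(p := ?\<beta>)) t" "\<delta> ?s t \<longleftrightarrow> s p = ?\<alpha> \<and> \<delta>'"
        by (simp only:, metis)
      then show "of_bool (s p = ?\<alpha>) * ?G (s(p := ?\<beta>)) t * of_bool \<delta>' = H ?s t"
        unfolding H by (simp add: of_bool_conj)
    qed
    also have "?G s t * of_bool (?\<beta> = ?\<alpha> \<and> \<delta>') = H s t"
    proof -
      have "\<delta> s t \<longleftrightarrow> ?\<beta> = ?\<alpha> \<and> \<delta>'" unfolding \<delta>_def \<delta>'_def by (subst I) (simp only: ball_simps)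
      then show ?thesis unfolding H by simp
    qed
    finally show ?thesis .
  qed
  have 2: "H s (t \<circ> swap (b + f) (b + e)) = H (s \<circ> swap (a + f) (a + e)) t"
    if f: "f \<in> {1..<e}" for f
  proof -
    let ?t = "t \<circ> swap (b + f) (b + e)" and ?s = "s \<circ> swap (a + f) (a + e)"
    let ?\<sigma> = "swap f e"
    have \<sigma>: "?t (b + h) = t (b + ?\<sigma> h)" "?s (a + h) = s (a + ?\<sigma> h)" for h
      by (auto simp: transpose_def)
    have \<sigma>in: "?\<sigma> h \<in> {1..d}" if "h \<in> {1..d}" for h using that e f by (auto simp: transpose_def)
    have "\<delta> s ?t \<longleftrightarrow> \<delta> ?s t"
    proof
      assume L: "\<delta> s ?t"
      show "\<delta> ?s t" unfolding \<delta>_def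
      proof
        fix h assume h: "h \<in> {1..d}"
        then have "s (a + ?\<sigma> h) = ?t (b + ?\<sigma> h)" using L \<sigma>in unfolding \<delta>_def by blast
        then show "?s (a + h) = t (b + h)" unfolding \<sigma> by simp
      qed
    next
      assume L: "\<delta> ?s t"
      show "\<delta> s ?t" unfolding \<delta>_def
      proof
        fix h assume h: "h \<in> {1..d}"
        then have "?s (a + ?\<sigma> h) = t (b + ?\<sigma> h)" using L \<sigma>in unfolding \<delta>_def by blast
        then show "s (a + h) = ?t (b + h)" unfolding \<sigma> by simp
      qed
    qed
    moreover have "?G s ?t = ?G s t"
      by (rule realise_cong) (use e f in \<open>auto simp: transpose_def\<close>)
    moreover have "?G ?s t = ?G s t"
      by (rule realise_cong) (use e f in \<open>auto simp: transpose_def\<close>)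
    ultimately show ?thesis unfolding H by (simp only:)
  qed
  have e1: "1 \<le> e" using e by simp
  show ?thesis unfolding sum_split_at[OF e1] 1 using 2 by simp
qed

text \<open>Once at the top, the a + e - 1 exchanges are absorbed by the idempotent and contribute 1
  each; the remaining (b - a) / 2 is the trace term.\<close>

lemma jm_eigen_juxtapose_new:
  assumes g: "g \<in> Hom a b" and e: "e \<in> {1..d}"
  shows "jm_eigen (a + d) (b + d) (JW (a + d) \<odot> juxtapose a b d g) (b + e)
    (1 - of_nat (a + e) - (of_nat b - of_nat a) / 2)"
proof -
  let ?y = "juxtapose a b d g" and ?k = "(of_nat b - of_nat a) / 2 :: rat"
  have y: "?y \<in> Hom (a + d) (b + d)" by (rule juxtapose_Hom[OF g])
  let ?H = "realise (a + d) (b + d) ?y" and ?F = "realise (a + d) (b + d) (JW (a + d) \<odot> ?y)"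
  show ?thesis unfolding jm_eigen_def
  proof (intro allI)
    fix s t
    have w: "swap p (a + e) permutes {1..a + d}" if "p \<in> {1..<a + e}" for p
      using that e by (intro permutes_swap_id) auto
    have "(\<Sum>j\<in>{1..<b + e}. ?F s (t \<circ> swap j (b + e))) =
        (\<Sum>z\<in>colours (a + d). symmetriser (a + d) s z *
          (\<Sum>j\<in>{1..<b + e}. ?H z (t \<circ> swap j (b + e))))"
      unfolding realise_JW_dmult[OF y] by (subst sum.swap) (simp add: sum_distrib_left)
    also have "\<dots> = (\<Sum>p\<in>{1..<a + e}. \<Sum>z\<in>colours (a + d). symmetriser (a + d) s z * ?H (z \<circ> swap p (a + e)) t) +
        ?k * (\<Sum>z\<in>colours (a + d). symmetriser (a + d) s z * ?H z t)"
      unfolding juxtapose_transpositions[OF g e]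
      by (subst sum.swap) (simp add: distrib_left sum.distrib sum_distrib_left mult_ac)
    also have "(\<Sum>p\<in>{1..<a + e}. \<Sum>z\<in>colours (a + d). symmetriser (a + d) s z * ?H (z \<circ> swap p (a + e)) t) =
        (\<Sum>p\<in>{1..<a + e}. ?F s t)"
      by (rule sum.cong[OF refl]) (simp only: symmetriser_sum_permute[OF w, of _ _ "\<lambda>z. ?H z t"] realise_JW_dmult[OF y])
    also have "\<dots> + ?k * (\<Sum>z\<in>colours (a + d). symmetriser (a + d) s z * ?H z t) =
        - (1 - of_nat (a + e) - ?k) * ?F s t"
      unfolding realise_JW_dmult[OF y] using e by (simp add: of_nat_diff algebra_simps)
    finally show "(\<Sum>j\<in>{1..<b + e}. ?F s (t \<circ> swap j (b + e))) =
        - (1 - of_nat (a + e) - ?k) * ?F s t" .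
  qed
qed

section \<open>Eigenvalues after bending\<close>

lemma bend_sign_cong:
  assumes "\<And>e. e \<in> {1..m} \<Longrightarrow> t (b + e) = t' (b + e)"
  shows "bend_sign b m t = bend_sign b m t'"
  unfolding bend_sign_def by (rule prod.cong) (simp_all add: assms)

lemma bend_sign_square [simp]: "bend_sign b m t * bend_sign b m t = 1"
  unfolding bend_sign_def prod.distrib[symmetric] by (rule prod.neutral) auto

lemma bend_sign_mult:
  "bend_sign b m t * bend_sign b m t' = (\<Prod>e\<in>{1..m}. if t (b + e) = t' (b + e) then 1 else - 1)"
  unfolding bend_sign_def prod.distrib[symmetric] by (rule prod.cong) auto

text \<open>The exchanged positions are at most \<open>b\<close>, so both the bending sign and the
  unbent top colouring stay the same.\<close>

lemma jm_eigen_bend_old: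
  assumes h: "h \<in> Hom a b" and m: "m \<le> a" and E: "jm_eigen a b h i c" and i: "i \<in> {1..b}"
  shows "jm_eigen (a - m) (b + m) (bend a b m h) i c"
  unfolding jm_eigen_def realise_bend[OF h m]
proof (intro allI)
  fix s t
  let ?F = "\<lambda>t. bend_sign b m t * realise a b h (unbent a b m s t) t"
  have "?F (t \<circ> swap j i)
    = bend_sign b m t * realise a b h (unbent a b m s t) (t \<circ> swap j i)"
    if j: "j \<in> {1..<i}" for j
  proof -
    let ?t = "t \<circ> swap j i"
    have t: "?t (b + e) = t (b + e)" if "1 \<le> e" for e
      using that i j by (simp add: transpose_def)
    have "bend_sign b m ?t = bend_sign b m t" by (rule bend_sign_cong) (use t in simp)
    moreover have "realise a b h (unbent a b m s ?t) ?t = realise a b h (unbent a b m s t) ?t"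
    proof (rule realise_cong)
      fix i assume "i \<in> {1..a}"
      then have "1 \<le> a + 1 - i" by (simp add: Suc_diff_le)
      then have "?t (b + (a + 1 - i)) = t (b + (a + 1 - i))" by (rule t)
      then show "unbent a b m s ?t i = unbent a b m s t i" by (simp only: unbent_def)
    qed simp
    ultimately show ?thesis by simp
  qed
  then have "(\<Sum>j\<in>{1..<i}. ?F (t \<circ> swap j i))
    = bend_sign b m t * (\<Sum>j\<in>{1..<i}. realise a b h (unbent a b m s t) (t \<circ> swap j i))"
    by (simp add: sum_distrib_left)
  also have "\<dots> = - c * ?F t"
    using E unfolding jm_eigen_def by simp
  finally show "(\<Sum>j\<in>{1..<i}. ?F (t \<circ> swap j i))
    = - c * ?F t" .
qed

text \<open>An exchange with an old point either does nothing or flips the bent spin, at the cost of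
  a sign. With k = (b - a) / 2 these two kinds sum to N + k and -(N + 1). The e - 1 exchanges with
  earlier bent points contribute 1 each by \<open>top_symmetric\<close>, which makes k + e - 2 in
  total.\<close>

lemma jm_eigen_bend_new:
  assumes h: "h \<in> Hom a b" and m: "m \<le> a" and S: "top_symmetric a b h" and e: "e \<in> {1..m}"
  shows "jm_eigen (a - m) (b + m) (bend a b m h) (b + e)
    (2 - of_nat e - (of_nat b - of_nat a) / 2)"
  unfolding jm_eigen_def
proof (intro allI)
  fix s t :: "nat \<Rightarrow> bool"
  let ?k = "(of_nat b - of_nat a) / 2 :: rat"
  let ?G = "realise a b h" and ?F = "realise (a - m) (b + m) (bend a b m h) s"
  \<comment> \<open>\<open>?q\<close> is the top position that is bent to \<open>b + e\<close>;
    before bending its spin is opposite to \<open>?\<alpha>\<close>.\<close>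
  let ?S = "unbent a b m s" and ?\<alpha> = "t (b + e)" and ?q = "a + 1 - e"
  note F = realise_bend[OF h m]
  have sym: "?G (z \<circ> swap p p') t = ?G z t" if "p \<in> {1..a}" "p' \<in> {1..a}" for z p p' t
    using S permutes_swap_id[OF that] unfolding top_symmetric_def by blast
  have q: "?q \<in> {1..a}" "\<not> ?q \<le> a - m" "a + 1 - ?q = e" using e m by auto
  have Sq: "?S t ?q = (\<not> ?\<alpha>)" using q by (simp add: unbent_def)
  define N :: rat where "N = of_nat (card {p \<in> {1..a}. ?S t p = ?\<alpha>})"
  have eq1: "(\<Sum>j\<in>{1..b}. of_bool (t j = ?\<alpha>) * ?G (?S t) (t(j := ?\<alpha>))) = (N + ?k) * ?G (?S t) t"
  proof -
    have "(\<Sum>p\<in>{1..a}. of_bool (?S t p = ?\<alpha>) * ?G ((?S t)(p := ?\<alpha>)) t) =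
      (\<Sum>p\<in>{1..a}. of_bool (?S t p = ?\<alpha>) * ?G (?S t) t)"
    proof (rule sum.cong[OF refl])
      fix p
      have "?S t p = ?\<alpha> \<Longrightarrow> (?S t)(p := ?\<alpha>) = ?S t" by (rule fun_upd_idem)
      then show "of_bool (?S t p = ?\<alpha>) * ?G ((?S t)(p := ?\<alpha>)) t = of_bool (?S t p = ?\<alpha>) * ?G (?S t) t"
        by (cases "?S t p = ?\<alpha>") simp_all
    qed
    also have "\<dots> = N * ?G (?S t) t"
      unfolding sum_distrib_right[symmetric] N_def by (simp add: of_bool_def sum.If_cases Int_def)
    finally show ?thesis unfolding realise_equivariant by (simp add: distrib_right)
  qed
  have eq2: "(\<Sum>j\<in>{1..b}. of_bool (t j = (\<not> ?\<alpha>)) * ?G ((?S t)(?q := ?\<alpha>)) (t(j := ?\<alpha>))) = (N + 1) * ?G (?S t) t"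
  proof -
    \<comment> \<open>Equivariance lowers one \<open>?\<alpha>\<close> of \<open>?U\<close> on the
      top. At \<open>?q\<close> this restores \<open>?S t\<close>; elsewhere the result is an
      exchange of \<open>?S t\<close>, which has the same value by symmetry. The point
      \<open>?q\<close> itself is the extra 1 in N + 1.\<close>
    let ?U = "(?S t)(?q := ?\<alpha>)"
    have "(\<Sum>p\<in>{1..a}. of_bool (?U p = ?\<alpha>) * ?G (?U(p := \<not> ?\<alpha>)) t) =
      (\<Sum>p\<in>{1..a}. of_bool (?U p = ?\<alpha>) * ?G (?S t) t)"
    proof (rule sum.cong[OF refl])
      fix p assume p: "p \<in> {1..a}"
      have "?G (?U(p := \<not> ?\<alpha>)) t = ?G (?S t) t" if U: "?U p = ?\<alpha>"
      proof (cases "p = ?q")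
        case True
        have "?U(p := \<not> ?\<alpha>) = ?S t" unfolding True fun_upd_upd by (rule fun_upd_idem[where f = "?S t", OF Sq])
        then show ?thesis by simp
      next
        case False
        then have "?S t p = ?\<alpha>" using U by simp
        then have "?U(p := \<not> ?\<alpha>) = ?S t \<circ> swap p ?q"
          using False Sq by (intro ext) (simp add: transpose_def)
        then show ?thesis using sym[OF p q(1)] by simp
      qed
      then show "of_bool (?U p = ?\<alpha>) * ?G (?U(p := \<not> ?\<alpha>)) t = of_bool (?U p = ?\<alpha>) * ?G (?S t) t"
        by (cases "?U p = ?\<alpha>") simp_all
    qed
    also have "\<dots> = of_nat (card {p \<in> {1..a}. ?U p = ?\<alpha>}) * ?G (?S t) t"
      unfolding sum_distrib_right[symmetric] by (simp add: of_bool_def sum.If_cases Int_def)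
    also have "{p \<in> {1..a}. ?U p = ?\<alpha>} = insert ?q {p \<in> {1..a}. ?S t p = ?\<alpha>}"
      using q(1) by auto
    also have "card \<dots> = Suc (card {p \<in> {1..a}. ?S t p = ?\<alpha>})"
      using Sq by (intro card_insert_disjoint) auto
    finally have "(\<Sum>p\<in>{1..a}. of_bool (?U p = ?\<alpha>) * ?G (?U(p := \<not> ?\<alpha>)) t) =
      of_nat (Suc (card {p \<in> {1..a}. ?S t p = ?\<alpha>})) * ?G (?S t) t" .
    note top = this
    show ?thesis unfolding realise_equivariant top by (simp add: N_def)
  qed
  have 1: "(\<Sum>j\<in>{1..b}. ?F (t \<circ> swap j (b + e))) = (?k - 1) * ?F t"
  proof -
    have "?F (t \<circ> swap j (b + e)) =
      bend_sign b m t * (of_bool (t j = ?\<alpha>) * ?G (?S t) (t(j := ?\<alpha>)) -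
        of_bool (t j = (\<not> ?\<alpha>)) * ?G ((?S t)(?q := ?\<alpha>)) (t(j := ?\<alpha>)))"
      if j: "j \<in> {1..b}" for j
    proof (cases "t j = ?\<alpha>")
      case True
      then have "t \<circ> swap j (b + e) = t" "t(j := ?\<alpha>) = t"
        by (auto simp: transpose_def fun_eq_iff)
      then show ?thesis unfolding F using True by simp
    next
      case False
      let ?t = "t \<circ> swap j (b + e)"
      have te: "?t (b + f) = (if f = e then \<not> ?\<alpha> else t (b + f))" if "1 \<le> f" for f
        using j that False by (auto simp: transpose_def)
      \<comment> \<open>Among the bent points only the spin at \<open>b + e\<close> changes, so
        exactly one factor of the bending sign is reversed.\<close>
      have "bend_sign b m t * bend_sign b m ?t = (\<Prod>f\<in>{1..m}. if f = e then - 1 else 1)"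
        unfolding bend_sign_mult by (rule prod.cong[OF refl]) (use te in \<open>simp del: o_apply\<close>)
      also have "\<dots> = - 1" using e by (simp add: prod.delta)
      finally have "bend_sign b m t * (bend_sign b m t * bend_sign b m ?t) = - bend_sign b m t" by simp
      then have bs: "bend_sign b m ?t = - bend_sign b m t" by (simp add: mult.assoc[symmetric])
      have "?G (?S ?t) ?t = ?G ((?S t)(?q := ?\<alpha>)) (t(j := ?\<alpha>))"
      proof (rule realise_cong)
        fix i assume i: "i \<in> {1..a}"
        then have "a + 1 - i = e \<longleftrightarrow> i = ?q" "1 \<le> a + 1 - i" using e m by auto
        then show "?S ?t i = ((?S t)(?q := ?\<alpha>)) i"
          using te[of "a + 1 - i"] q by (auto simp: unbent_def simp del: o_apply)
      next
        fix i assume "i \<in> {1..b}"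
        then show "?t i = (t(j := ?\<alpha>)) i" using e by (auto simp: transpose_def)
      qed
      then show ?thesis unfolding F bs using False by simp
    qed
    then have "(\<Sum>j\<in>{1..b}. ?F (t \<circ> swap j (b + e))) =
      bend_sign b m t * ((\<Sum>j\<in>{1..b}. of_bool (t j = ?\<alpha>) * ?G (?S t) (t(j := ?\<alpha>))) -
        (\<Sum>j\<in>{1..b}. of_bool (t j = (\<not> ?\<alpha>)) * ?G ((?S t)(?q := ?\<alpha>)) (t(j := ?\<alpha>))))"
      by (simp only: sum_distrib_left[symmetric] sum_subtractf cong: sum.cong)
    also have "\<dots> = (?k - 1) * ?F t" unfolding eq1 eq2 F by (simp add: algebra_simps)
    finally show ?thesis .
  qed
  \<comment> \<open>If the two bent spins differ, both of their sign factors are reversed; on the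
    top this is an exchange of \<open>?p\<close> and \<open>?q\<close>.\<close>
  have 2: "?F (t \<circ> swap (b + f) (b + e)) = ?F t" if f: "f \<in> {1..<e}" for f
  proof -
    let ?t = "t \<circ> swap (b + f) (b + e)" and ?p = "a + 1 - f"
    have te: "?t (b + h) = (if h = f then t (b + e) else if h = e then t (b + f) else t (b + h))" for h
      by (auto simp: transpose_def)
    have "bend_sign b m t * bend_sign b m ?t = (\<Prod>h\<in>{1..m}. if t (b + h) = ?t (b + h) then 1 else - 1)"
      by (rule bend_sign_mult)
    also have "\<dots> = (\<Prod>h\<in>{f, e}. if t (b + h) = ?t (b + h) then 1 else - 1)"
      by (rule prod.mono_neutral_right) (use f e te in \<open>auto simp del: o_apply\<close>)
    also have "\<dots> = 1" using f te[of e] te[of f] by (auto simp del: o_apply)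
    finally have "bend_sign b m t * (bend_sign b m t * bend_sign b m ?t) = bend_sign b m t" by simp
    then have bs: "bend_sign b m ?t = bend_sign b m t" by (simp add: mult.assoc[symmetric])
    have p: "?p \<in> {1..a}" "\<not> ?p \<le> a - m" "a + 1 - ?p = f" "?p \<noteq> ?q" using e f m by auto
    have "?G (?S ?t) ?t = ?G (?S t \<circ> swap ?p ?q) t"
    proof (rule realise_cong)
      fix i assume i: "i \<in> {1..a}"
      then have "a + 1 - i = e \<longleftrightarrow> i = ?q" "a + 1 - i = f \<longleftrightarrow> i = ?p" using e f m by auto
      then show "?S ?t i = (?S t \<circ> swap ?p ?q) i"
        using te[of "a + 1 - i"] p q by (auto simp: unbent_def transpose_def[of ?p ?q] simp del: o_apply simp: o_apply[of "?S t"])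
    next
      fix i assume "i \<in> {1..b}"
      then show "?t i = t i" using e f by (auto simp: transpose_def)
    qed
    then show ?thesis unfolding F bs using sym[OF p(1) q(1)] by simp
  qed
  have e1: "1 \<le> e" using e by simp
  show "(\<Sum>j\<in>{1..<b + e}. ?F (t \<circ> swap j (b + e))) =
    - (2 - of_nat e - ?k) * ?F t"
    unfolding sum_split_at[OF e1] 1 using 2 e1 by (simp add: of_nat_diff algebra_simps)
qed

section \<open>Two-column tableaux\<close>

lemma dmult_add_left: "(x + y) \<odot> z = x \<odot> z + y \<odot> z"
proof -
  let ?S = "Poly_Mapping.keys x \<union> Poly_Mapping.keys y"
  have S: "finite ?S" by simp
  note e = bilin_ext_superset[OF S _ finite_keys order_refl]
  have "Poly_Mapping.keys (x + y) \<subseteq> ?S" by (rule keys_add)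
  then show ?thesis unfolding dmult_def
    by (subst (1 2 3) e) (auto simp: sum.distrib[symmetric] lookup_add distrib_right single_add intro!: sum.cong)
qed

lemma top_cups_iff: "v \<in> top_cups lam \<longleftrightarrow> v \<in> Hom (top_strands lam) (sum_list lam) \<and>
    (\<forall>D. coeff v D \<noteq> 0 \<longrightarrow> (\<exists>i j. {Top i, Top j} \<in> D))"
  unfolding top_cups_def by (auto simp: in_keys_iff)

lemma top_cups_add:
  assumes "v \<in> top_cups lam" "w \<in> top_cups lam"
  shows "v + w \<in> top_cups lam"
  using assms Hom_add[of v _ _ w] unfolding top_cups_iff lookup_add by (metis add_0)

lemma top_cups_scale: "v \<in> top_cups lam \<Longrightarrow> scale c v \<in> top_cups lam"
  unfolding top_cups_iff by (simp add: Hom_scale)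

lemma zero_top_cups: "0 \<in> top_cups lam"
  unfolding top_cups_iff by simp

text \<open>Every diagram in the product comes from a first factor with a top cup, and that cup
  survives composition.\<close>

lemma top_cups_dmult:
  assumes v: "v \<in> top_cups lam" and y: "y \<in> TL (sum_list lam)"
  shows "v \<odot> y \<in> top_cups lam"
proof -
  let ?a = "top_strands lam" and ?n = "sum_list lam"
  have v': "v \<in> Hom ?a ?n" and y': "y \<in> Hom ?n ?n" using v y by (simp_all add: top_cups_iff TL_def)
  have "\<exists>i j. {Top i, Top j} \<in> K" if K: "coeff (v \<odot> y) K \<noteq> 0" for K
  proof -
    have "\<exists>D\<in>diagrams ?a ?n. \<exists>E\<in>diagrams ?n ?n. coeff (Poly_Mapping.single (concat_diagram D E)
        (coeff v D * coeff y E * 2 ^ closed_loops D E)) K \<noteq> 0"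
      using K unfolding dmult_eq_sum[OF v' y'] lookup_sum by (meson sum.not_neutral_contains_not_neutral)
    then obtain D E where D: "D \<in> diagrams ?a ?n" and E: "E \<in> diagrams ?n ?n"
      and "coeff v D \<noteq> 0" "K = concat_diagram D E"
      by (auto simp: lookup_single when_def split: if_splits)
    moreover from this obtain i j where "{Top i, Top j} \<in> D" using v unfolding top_cups_iff by blast
    ultimately show ?thesis using top_cup_concat[OF D E] by blast
  qed
  then show ?thesis unfolding top_cups_iff using dmult_Hom[OF v' y'] by blast
qed

lemma cell_class_add_top_cups:
  assumes w: "w \<in> top_cups lam"
  shows "cell_class lam (x + w) = cell_class lam x"
proof -
  have sub: "cell_class lam (x + w) \<subseteq> cell_class lam x" if "w \<in> top_cups lam" for x w
    using top_cups_add[OF that] unfolding cell_class_def by (auto simp: add.assoc)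
  have "scale (- 1) w = - w" by (rule poly_mapping_eqI) simp
  then have "- w \<in> top_cups lam" using top_cups_scale[OF w, of "- 1"] by simp
  from sub[OF this, of "x + w"] sub[OF w, of x] show ?thesis by simp
qed

text \<open>All representatives of the coset yield the same class, so the unions in
  \<open>cell_act\<close> and \<open>cell_scale\<close> collapse to a single coset.\<close>

lemma cell_act_eigenvector:
  assumes y: "y \<in> TL (sum_list lam)" and e: "f \<odot> y = scale c f"
  shows "cell_act lam (cell_class lam f) y = cell_scale lam c (cell_class lam f)"
proof -
  \<comment> \<open>A union over an empty coset would be empty instead of a coset.\<close>
  have ne: "top_cups lam \<noteq> {}" using zero_top_cups by blast
  have "cell_class lam ((f + v) \<odot> y) = cell_class lam (scale c f)" if "v \<in> top_cups lam" for v
    unfolding dmult_add_left e by (rule cell_class_add_top_cups[OF top_cups_dmult[OF that y]])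
  then have "cell_act lam (cell_class lam f) y = cell_class lam (scale c f)"
    unfolding cell_act_def cell_class_def[of lam f] using ne by simp
  moreover have "cell_class lam (scale c (f + v)) = cell_class lam (scale c f)" if "v \<in> top_cups lam" for v
  proof -
    have "scale c (f + v) = scale c f + scale c v"
      by (rule poly_mapping_eqI) (simp add: lookup_add distrib_left)
    then show ?thesis using cell_class_add_top_cups[OF top_cups_scale[OF that]] by simp
  qed
  then have "cell_scale lam c (cell_class lam f) = cell_class lam (scale c f)"
    unfolding cell_scale_def cell_class_def[of lam f] using ne by simp
  ultimately show ?thesis by simp
qed

section \<open>Existence and uniqueness of the block decomposition\<close>

definition alternating :: "('a \<Rightarrow> bool) \<Rightarrow> 'a list \<Rightarrow> ('a list \<times> 'a list) list \<Rightarrow> bool" where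
  "alternating P xs bs \<longleftrightarrow> concat (map (\<lambda>(D, M). D @ M) bs) = xs \<and>
     (\<forall>(D, M)\<in>set bs. D \<noteq> []) \<and> (\<forall>(D, M)\<in>set (butlast bs). M \<noteq> []) \<and>
     (\<forall>(D, M)\<in>set bs. (\<forall>i\<in>set D. P i) \<and> (\<forall>i\<in>set M. \<not> P i))"

lemma alternating_Nil: "alternating P xs [] \<longleftrightarrow> xs = []"
  unfolding alternating_def by auto

lemma alternating_Cons:
  "alternating P xs ((D, M) # bs) \<longleftrightarrow> (\<exists>ys. xs = D @ M @ ys \<and> alternating P ys bs \<and> D \<noteq> [] \<and>
     (bs \<noteq> [] \<longrightarrow> M \<noteq> []) \<and> (\<forall>i\<in>set D. P i) \<and> (\<forall>i\<in>set M. \<not> P i))"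
  unfolding alternating_def by auto

lemma alternating_hd:
  assumes "alternating P xs bs" "xs \<noteq> []"
  shows "P (hd xs)"
proof (cases bs)
  case Nil
  then show ?thesis using assms alternating_Nil by blast
next
  case (Cons b bs')
  obtain D M where b: "b = (D, M)" by (cases b)
  obtain ys where "xs = D @ M @ ys" "D \<noteq> []" "\<forall>i\<in>set D. P i"
    using assms(1) unfolding Cons b alternating_Cons by blast
  then show ?thesis by simp
qed

text \<open>The next \<open>D\<close> and every \<open>M\<close> except the last are non-empty, so
  runs cannot be split: each block is the maximal run at its place.\<close>

lemma alternating_blocks:
  assumes "alternating P xs ((D, M) # bs)"
  shows "D = takeWhile P xs" "M = takeWhile (\<lambda>x. \<not> P x) (dropWhile P xs)"
    "alternating P (dropWhile (\<lambda>x. \<not> P x) (dropWhile P xs)) bs"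
proof -
  obtain ys where ys: "xs = D @ M @ ys" "alternating P ys bs" "D \<noteq> []"
     "bs \<noteq> [] \<longrightarrow> M \<noteq> []" "\<forall>i\<in>set D. P i" "\<forall>i\<in>set M. \<not> P i"
    using assms unfolding alternating_Cons by blast
  have hy: "ys \<noteq> [] \<Longrightarrow> P (hd ys)" by (rule alternating_hd[OF ys(2)])
  have hM: "M @ ys \<noteq> [] \<Longrightarrow> \<not> P (hd (M @ ys))"
  proof (cases M)
    case Nil
    then have "ys = []" using ys(2,4) alternating_Nil by blast
    then show "M @ ys \<noteq> [] \<Longrightarrow> \<not> P (hd (M @ ys))" using Nil by simp
  next
    case (Cons x M')
    then show "M @ ys \<noteq> [] \<Longrightarrow> \<not> P (hd (M @ ys))" using ys(6) by simp
  qed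
  have t: "takeWhile Q (zs @ zs') = zs" "dropWhile Q (zs @ zs') = zs'"
    if "\<forall>i\<in>set zs. Q i" "zs' \<noteq> [] \<Longrightarrow> \<not> Q (hd zs')" for Q :: "'a \<Rightarrow> bool" and zs zs'
    using that by (cases zs'; simp)+
  have d: "dropWhile P xs = M @ ys" unfolding ys(1) by (rule t) (use ys hM in auto)
  show "D = takeWhile P xs" unfolding ys(1) by (rule t(1)[symmetric]) (use ys hM in auto)
  show "M = takeWhile (\<lambda>x. \<not> P x) (dropWhile P xs)" unfolding d
    by (rule t(1)[symmetric]) (use ys hy in auto)
  have "dropWhile (\<lambda>x. \<not> P x) (dropWhile P xs) = ys" unfolding d
    by (rule t(2)) (use ys hy in auto)
  then show "alternating P (dropWhile (\<lambda>x. \<not> P x) (dropWhile P xs)) bs" using ys(2) by simp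
qed

lemma alternating_unique:
  "alternating P xs bs \<Longrightarrow> alternating P xs bs' \<Longrightarrow> bs = bs'"
proof (induction bs arbitrary: xs bs')
  case Nil
  then have "xs = []" by (simp add: alternating_Nil)
  show ?case
  proof (cases bs')
    case (Cons b bs'')
    then show ?thesis using Nil.prems(2) \<open>xs = []\<close> by (cases b) (simp add: alternating_Cons)
  qed simp
next
  case (Cons b bs)
  obtain D M where b: "b = (D, M)" by (cases b)
  have "xs \<noteq> []" using Cons.prems(1) unfolding b alternating_Cons by auto
  then obtain D' M' bs'' where bs': "bs' = (D', M') # bs''"
    using Cons.prems(2) by (cases bs') (auto simp: alternating_Nil)
  note 1 = alternating_blocks[OF Cons.prems(1)[unfolded b]] and 2 = alternating_blocks[OF Cons.prems(2)[unfolded bs']]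
  have "bs = bs''" by (rule Cons.IH[OF 1(3) 2(3)])
  then show ?case unfolding b bs' using 1(1,2) 2(1,2) by simp
qed

text \<open>Cutting off maximal runs greedily works; an initial element satisfying \<open>P\<close>
  is what makes the first \<open>D\<close> non-empty.\<close>

lemma ex_alternating:
  "(xs \<noteq> [] \<Longrightarrow> P (hd xs)) \<Longrightarrow> \<exists>bs. alternating P xs bs"
proof (induction xs rule: length_induct)
  case (1 xs)
  show ?case
  proof (cases "xs = []")
    case True
    then show ?thesis using alternating_Nil by blast
  next
    case False
    let ?r = "dropWhile P xs" and ?Q = "\<lambda>x. \<not> P x"
    let ?D = "takeWhile P xs" and ?M = "takeWhile ?Q ?r" and ?r' = "dropWhile ?Q ?r"
    have D: "?D \<noteq> []" using False 1(2) by (cases xs) auto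
    have xs: "xs = ?D @ ?M @ ?r'" by simp
    have "length xs = length ?D + length ?M + length ?r'" by (subst xs) (simp only: length_append)
    then have "length ?r' < length xs" using D by (cases ?D) simp_all
    moreover have "?r' \<noteq> [] \<longrightarrow> P (hd ?r')" using hd_dropWhile[of ?Q ?r] by blast
    ultimately obtain bs where bs: "alternating P ?r' bs" using 1(1) by blast
    have "bs \<noteq> [] \<longrightarrow> ?M \<noteq> []"
    proof
      assume "bs \<noteq> []"
      have "?r' \<noteq> []"
      proof
        assume "?r' = []"
        then have "bs = []" using alternating_unique[OF bs, of "[]"] by (simp add: alternating_Nil)
        then show False using \<open>bs \<noteq> []\<close> by simp
      qed
      then have "?r \<noteq> []" by (metis dropWhile.simps(1))
      then have "\<not> P (hd ?r)" using hd_dropWhile[of P xs] by blast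
      then show "?M \<noteq> []" using \<open>?r \<noteq> []\<close> by (cases ?r) auto
    qed
    moreover have "\<forall>i\<in>set ?D. P i" "\<forall>i\<in>set ?M. \<not> P i" by (blast dest: set_takeWhileD)+
    ultimately have "alternating P xs ((?D, ?M) # bs)"
      unfolding alternating_Cons using D bs xs by blast
    then show ?thesis by blast
  qed
qed

section \<open>Column counts along the recursion\<close>

definition col_count :: "(nat \<Rightarrow> nat) \<Rightarrow> nat \<Rightarrow> nat \<Rightarrow> nat" where
  "col_count col c i = card {j \<in> {1..i}. col j = c}"

lemma col_count_0: "col_count col c 0 = 0"
  by (simp add: col_count_def)

lemma col_count_Suc: "col_count col c (Suc i) = col_count col c i + (if col (Suc i) = c then 1 else 0)"
proof -
  have "{j \<in> {1..Suc i}. col j = c} =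
      (if col (Suc i) = c then insert (Suc i) {j \<in> {1..i}. col j = c} else {j \<in> {1..i}. col j = c})"
    by (auto simp: le_Suc_eq)
  then show ?thesis unfolding col_count_def by simp
qed

lemma col_count_block:
  assumes "\<forall>e\<in>{1..m}. col (b + e) = c" "e \<le> m"
  shows "col_count col c' (b + e) = col_count col c' b + (if c' = c then e else 0)"
  using assms(2)
proof (induction e)
  case (Suc e)
  have "col (Suc (b + e)) = c" using assms(1) Suc.prems by (metis Suc_le_eq add_Suc_right atLeastAtMost_iff le_add1 plus_1_eq_Suc)
  then show ?case using Suc by (simp add: col_count_Suc)
qed simp

lemma col_count_total:
  assumes "\<forall>j\<in>{1..i}. col j \<in> {1, 2}"
  shows "col_count col 1 i + col_count col 2 i = i"
  using assms by (induction i) (auto simp: col_count_0 col_count_Suc)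

text \<open>The content without rows: in a standard tableau the row of \<open>i\<close> is the
  number of entries up to \<open>i\<close> in its column. This quantity can be followed through the
  recursion block by block.\<close>

definition column_content :: "(nat \<Rightarrow> nat) \<Rightarrow> nat \<Rightarrow> rat" where
  "column_content col i = of_nat (col i) - of_nat (col_count col (col i) i)"

text \<open>The alternative \<open>D @ M = []\<close> covers \<open>n < b\<close>, where the
  interval is empty and the subtraction in its length is truncated.\<close>

lemma upt_append_blocks:
  assumes "D @ M @ ys = [Suc b..<Suc n]"
  shows "b + length D + length M \<le> n \<or> D @ M = []" "ys = [Suc (b + length D + length M)..<Suc n]"
    "e \<in> {1..length D} \<Longrightarrow> b + e \<in> set D"
    "e \<in> {1..length M} \<Longrightarrow> b + length D + e \<in> set M"
proof -
  have "length (D @ M @ ys) = n - b" unfolding assms by (simp del: upt_Suc)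
  then have len: "length D + length M + length ys = n - b" by simp
  then show "b + length D + length M \<le> n \<or> D @ M = []"
  proof (cases "length D + length M = 0")
    case False
    then have "b + length D + length M \<le> n" using len by arith
    then show ?thesis by simp
  qed simp
  have "ys = drop (length D + length M) [Suc b..<Suc n]" unfolding assms[symmetric] by simp
  then show "ys = [Suc (b + length D + length M)..<Suc n]" by (simp del: upt_Suc add: add.assoc)
  show "b + e \<in> set D" if e: "e \<in> {1..length D}"
  proof -
    have lt: "e - 1 < length D" using e by auto
    have "D ! (e - 1) = (D @ M @ ys) ! (e - 1)" using lt by (simp only: nth_append if_True)
    also have "\<dots> = Suc b + (e - 1)" unfolding assms by (rule nth_upt) (use lt len in arith)
    also have "\<dots> = b + e" using e by simp
    finally show ?thesis using nth_mem[OF lt] by simp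
  qed
  show "b + length D + e \<in> set M" if e: "e \<in> {1..length M}"
  proof -
    have lt: "e - 1 < length M" using e by auto
    have "M ! (e - 1) = (D @ M @ ys) ! (length D + (e - 1))" using lt by (simp add: nth_append)
    also have "\<dots> = Suc b + (length D + (e - 1))" unfolding assms by (rule nth_upt) (use lt len in arith)
    also have "\<dots> = b + length D + e" using e by simp
    finally show ?thesis using nth_mem[OF lt] by simp
  qed
qed

text \<open>The induction carries the equations for all entries placed so far, and the fact that the
  number of top strands is the difference of the column lengths, stated additively to avoid
  truncated subtraction.\<close>

lemma g_from_eigen:
  assumes "concat (map (\<lambda>(D, M). D @ M) bs) = [Suc b..<Suc n]"
    and "\<forall>(D, M)\<in>set bs. (\<forall>i\<in>set D. col i = 1) \<and> (\<forall>i\<in>set M. col i = 2)"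
    and "g \<in> Hom a b" and "b \<le> n" and "a + col_count col 2 b = col_count col 1 b"
    and "\<And>i. i \<in> {1..b} \<Longrightarrow> jm_eigen a b g i (column_content col i)"
    and cols: "\<forall>i\<in>{1..n}. col i \<in> {1, 2}"
    and ballot: "\<And>i. i \<le> n \<Longrightarrow> col_count col 2 i \<le> col_count col 1 i"
  defines "F \<equiv> g_from a b g (map (\<lambda>(D, M). (length D, length M)) bs)"
  shows "\<exists>a'. F \<in> Hom a' n \<and> (\<forall>i\<in>{1..n}. jm_eigen a' n F i (column_content col i))"
  using assms(1-6) unfolding F_def
proof (induction bs arbitrary: a b g)
  case Nil
  have "[Suc b..<Suc n] = []" using Nil.prems(1) by (simp del: upt_Suc)
  then have "b = n" using Nil.prems(4) by (simp del: upt_Suc)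
  then show ?case using Nil.prems by auto
next
  case (Cons B bs)
  obtain D M where B: "B = (D, M)" by (cases B)
  define d m where "d = length D" and "m = length M"
  let ?c1 = "col_count col 1" and ?c2 = "col_count col 2"
  have eq: "D @ M @ concat (map (\<lambda>(D, M). D @ M) bs) = [Suc b..<Suc n]" using Cons.prems(1) B by simp
  note u = upt_append_blocks[OF eq, folded d_def m_def]
  have cD: "\<forall>e\<in>{1..d}. col (b + e) = 1" and cM: "\<forall>e\<in>{1..m}. col (b + d + e) = 2"
    using Cons.prems(2) u(3,4) unfolding B by auto
  have le: "b + d + m \<le> n" using u(1) Cons.prems(4) unfolding d_def m_def by auto
  have tot: "?c1 b + ?c2 b = b" by (rule col_count_total) (use cols Cons.prems(4) in auto)
  have cntD: "col_count col c (b + e) = col_count col c b + (if c = 1 then e else 0)" if "e \<le> d" for c e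
    by (rule col_count_block[OF cD that])
  have cntM: "col_count col c (b + d + e) = col_count col c (b + d) + (if c = 2 then e else 0)" if "e \<le> m" for c e
    by (rule col_count_block[OF cM that])
  \<comment> \<open>Since the two column counts add up to \<open>b\<close> and differ by
    \<open>a\<close>, the trace constant is the current length of column 2.\<close>
  have half: "(of_nat b - of_nat a) / 2 = (of_nat (?c2 b) :: rat)"
  proof -
    have "b = a + 2 * ?c2 b" using tot Cons.prems(5) by simp
    then have "(of_nat b :: rat) = of_nat a + 2 * of_nat (?c2 b)" by (metis of_nat_add of_nat_mult of_nat_numeral)
    then show ?thesis by simp
  qed
  let ?h = "JW (a + d) \<odot> juxtapose a b d g"
  have h: "?h \<in> Hom (a + d) (b + d)" by (rule dmult_Hom[OF JW_Hom juxtapose_Hom[OF Cons.prems(3)]])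
  have hs: "top_symmetric (a + d) (b + d) ?h" by (rule top_symmetric_JW[OF juxtapose_Hom[OF Cons.prems(3)]])
  have he: "jm_eigen (a + d) (b + d) ?h i (column_content col i)" if i: "i \<in> {1..b + d}" for i
  proof (cases "i \<le> b")
    case True
    then show ?thesis using jm_eigen_juxtapose_old[OF Cons.prems(3) Cons.prems(6)] i by simp
  next
    case False
    then obtain e where e: "i = b + e" "e \<in> {1..d}" using i by (intro that[of "i - b"]) auto
    have "column_content col i = 1 - of_nat (a + e) - (of_nat b - of_nat a) / 2"
      unfolding half column_content_def e(1) using cD e(2) cntD[of e 1] Cons.prems(5)[symmetric] by simp
    then show ?thesis using jm_eigen_juxtapose_new[OF Cons.prems(3) e(2)] e(1) by simp
  qed
  have ad: "a + d + ?c2 b = ?c1 b + d" using Cons.prems(5) by simp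
  \<comment> \<open>The ballot condition at the end of the block guarantees enough top strands to
    bend.\<close>
  have "?c2 b + m \<le> ?c1 b + d" using ballot[OF le] cntM[of m 1] cntM[of m 2] cntD[of d 1] cntD[of d 2] by simp
  then have md: "m \<le> a + d" using ad by simp
  let ?g = "bend (a + d) (b + d) m ?h"
  have ge: "jm_eigen (a + d - m) (b + d + m) ?g i (column_content col i)" if i: "i \<in> {1..b + d + m}" for i
  proof (cases "i \<le> b + d")
    case True
    then show ?thesis using jm_eigen_bend_old[OF h md he] i by simp
  next
    case False
    then obtain e where e: "i = b + d + e" "e \<in> {1..m}" using i by (intro that[of "i - (b + d)"]) auto
    have "column_content col i = 2 - of_nat e - (of_nat (b + d) - of_nat (a + d)) / 2"
      unfolding column_content_def e(1) using cM e(2) cntM[of e 2] cntD[of d 2] half by simp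
    then show ?thesis using jm_eigen_bend_new[OF h md hs e(2)] e(1) by simp
  qed
  have "\<exists>a'. g_from (a + d - m) (b + d + m) ?g (map (\<lambda>(D, M). (length D, length M)) bs) \<in> Hom a' n \<and>
     (\<forall>i\<in>{1..n}. jm_eigen a' n (g_from (a + d - m) (b + d + m) ?g (map (\<lambda>(D, M). (length D, length M)) bs)) i (column_content col i))"
  proof (rule Cons.IH)
    show "concat (map (\<lambda>(D, M). D @ M) bs) = [Suc (b + d + m)..<Suc n]" by (rule u(2))
    show "\<forall>(D, M)\<in>set bs. (\<forall>i\<in>set D. col i = 1) \<and> (\<forall>i\<in>set M. col i = 2)" using Cons.prems(2) by simp
    show "?g \<in> Hom (a + d - m) (b + d + m)" by (rule bend_Hom[OF h md])
    show "a + d - m + ?c2 (b + d + m) = ?c1 (b + d + m)"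
      using ad md cntM[of m 1] cntM[of m 2] cntD[of d 1] cntD[of d 2] by simp
  qed (rule le ge, assumption?)+
  then show ?case unfolding B by (simp add: d_def m_def)
qed

section \<open>Standard tableaux with at most two columns\<close>

context
  fixes lam :: "nat list" and t :: "nat \<times> nat \<Rightarrow> nat" and n :: nat
  assumes lam: "lam \<in> Par2 n" and t: "t \<in> Std lam"
begin

lemma sum_lam: "sum_list lam = n"
  using lam by (simp add: Par2_def Par_def)

lemma young_col: "(r, c) \<in> young lam \<Longrightarrow> c = 1 \<or> c = 2"
  using lam unfolding Par2_def young_def by fastforce

lemma young_up: "(r, c) \<in> young lam \<Longrightarrow> 1 \<le> r' \<Longrightarrow> r' \<le> r \<Longrightarrow> (r', c) \<in> young lam"
proof -
  assume a: "(r, c) \<in> young lam" "1 \<le> r'" "r' \<le> r"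
  have "sorted_wrt (\<ge>) lam" using lam by (simp add: Par2_def Par_def)
  moreover have "r - 1 < length lam" using a by (auto simp: young_def)
  ultimately have "lam ! (r - 1) \<le> lam ! (r' - 1)"
    using a by (cases "r' = r") (auto intro: sorted_wrt_nth_less)
  then show "(r', c) \<in> young lam" using a by (auto simp: young_def)
qed

lemma young_left: "(r, c) \<in> young lam \<Longrightarrow> 1 \<le> c' \<Longrightarrow> c' \<le> c \<Longrightarrow> (r, c') \<in> young lam"
  by (auto simp: young_def)

lemma t_bij: "bij_betw t (young lam) {1..n}"
  using t sum_lam by (simp add: Std_def)

lemma box:
  assumes "i \<in> {1..n}"
  shows "(row_of lam t i, col_of lam t i) \<in> young lam" "t (row_of lam t i, col_of lam t i) = i"
proof -
  have i: "i \<in> t ` young lam" using assms t_bij by (simp add: bij_betw_def)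
  show "(row_of lam t i, col_of lam t i) \<in> young lam" "t (row_of lam t i, col_of lam t i) = i"
    unfolding row_of_def col_of_def using inv_into_into[OF i] f_inv_into_f[OF i] by simp_all
qed

lemma box_of_entry:
  assumes "(r, c) \<in> young lam"
  shows "row_of lam t (t (r, c)) = r" "col_of lam t (t (r, c)) = c" "t (r, c) \<in> {1..n}"
proof -
  have "inj_on t (young lam)" "t ` young lam = {1..n}" using t_bij by (simp_all add: bij_betw_def)
  then show "row_of lam t (t (r, c)) = r" "col_of lam t (t (r, c)) = c" "t (r, c) \<in> {1..n}"
    using assms unfolding row_of_def col_of_def by auto
qed

lemma col_of_cases: "i \<in> {1..n} \<Longrightarrow> col_of lam t i \<in> {1, 2}"
  using young_col[OF box(1)] by blast

lemma t_col_mono: "(r, c) \<in> young lam \<Longrightarrow> (r', c) \<in> young lam \<Longrightarrow> r < r' \<Longrightarrow> t (r, c) < t (r', c)"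
  using t unfolding Std_def by blast

lemma t_row_mono: "(r, c) \<in> young lam \<Longrightarrow> (r, c') \<in> young lam \<Longrightarrow> c < c' \<Longrightarrow> t (r, c) < t (r, c')"
  using t unfolding Std_def by blast

text \<open>Entries increase down a column, so the entries up to \<open>i\<close> in the column of
  \<open>i\<close> are precisely those in its first rows.\<close>

lemma row_eq_col_count:
  assumes i: "i \<in> {1..n}"
  shows "row_of lam t i = col_count (col_of lam t) (col_of lam t i) i"
proof -
  let ?r = "row_of lam t i" and ?c = "col_of lam t i"
  have up: "(r', ?c) \<in> young lam" if "r' \<in> {1..?r}" for r'
    using young_up[OF box(1)[OF i]] that by simp
  have "{j \<in> {1..i}. col_of lam t j = ?c} = (\<lambda>r'. t (r', ?c)) ` {1..?r}"
  proof (intro equalityI subsetI)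
    fix j assume j: "j \<in> {j \<in> {1..i}. col_of lam t j = ?c}"
    then have jn: "j \<in> {1..n}" using i by auto
    have b: "(row_of lam t j, ?c) \<in> young lam" "t (row_of lam t j, ?c) = j" using box[OF jn] j by auto
    have "\<not> ?r < row_of lam t j" using t_col_mono[OF box(1)[OF i] b(1)] box(2)[OF i] b(2) j by auto
    then have "row_of lam t j \<in> {1..?r}" using b(1) by (auto simp: young_def)
    then show "j \<in> (\<lambda>r'. t (r', ?c)) ` {1..?r}" using b(2) by (intro image_eqI[of _ _ "row_of lam t j"]) auto
  next
    fix j assume "j \<in> (\<lambda>r'. t (r', ?c)) ` {1..?r}"
    then obtain r' where r': "r' \<in> {1..?r}" "j = t (r', ?c)" by blast
    have "j \<le> i" using t_col_mono[OF up[OF r'(1)] box(1)[OF i]] box(2)[OF i] r'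
      by (cases "r' = ?r") auto
    then show "j \<in> {j \<in> {1..i}. col_of lam t j = ?c}" using box_of_entry[OF up[OF r'(1)]] r'(2) by auto
  qed
  moreover have "inj_on (\<lambda>r'. t (r', ?c)) {1..?r}"
  proof (rule inj_onI)
    fix x y assume "x \<in> {1..?r}" "y \<in> {1..?r}" "t (x, ?c) = t (y, ?c)"
    then show "x = y" using box_of_entry(1)[OF up] by metis
  qed
  ultimately show ?thesis unfolding col_count_def by (simp add: card_image)
qed

text \<open>The left neighbour of an entry in column 2 is smaller and lies in column 1; distinct
  entries of column 2 have distinct left neighbours.\<close>

lemma ballot:
  assumes i: "i \<le> n"
  shows "col_count (col_of lam t) 2 i \<le> col_count (col_of lam t) 1 i"
  unfolding col_count_def
proof (rule card_inj_on_le[where f = "\<lambda>j. t (row_of lam t j, 1)"])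
  have b: "(row_of lam t j, 1) \<in> young lam" "t (row_of lam t j, 1) < j" "t (row_of lam t j, 2) = j"
    if "j \<in> {j \<in> {1..i}. col_of lam t j = 2}" for j
  proof -
    have jn: "j \<in> {1..n}" and c: "col_of lam t j = 2" using that i by auto
    note bx = box[OF jn, unfolded c]
    show y: "(row_of lam t j, 1) \<in> young lam" by (rule young_left[OF bx(1)]) simp_all
    have "t (row_of lam t j, 1) < t (row_of lam t j, 2)" by (rule t_row_mono[OF y bx(1)]) simp
    then show "t (row_of lam t j, 1) < j" "t (row_of lam t j, 2) = j" by (simp_all only: bx(2))
  qed
  show "inj_on (\<lambda>j. t (row_of lam t j, 1)) {j \<in> {1..i}. col_of lam t j = 2}"
  proof (rule inj_onI)
    fix x y assume x: "x \<in> {j \<in> {1..i}. col_of lam t j = 2}" and y: "y \<in> {j \<in> {1..i}. col_of lam t j = 2}"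
      and eq: "t (row_of lam t x, 1) = t (row_of lam t y, 1)"
    have "row_of lam t x = row_of lam t y"
      using arg_cong[OF eq, of "row_of lam t"] unfolding box_of_entry(1)[OF b(1)[OF x]] box_of_entry(1)[OF b(1)[OF y]] .
    from arg_cong[OF this, of "\<lambda>r. t (r, 2)"] show "x = y" unfolding b(3)[OF x] b(3)[OF y] .
  qed
  show "(\<lambda>j. t (row_of lam t j, 1)) ` {j \<in> {1..i}. col_of lam t j = 2} \<subseteq> {j \<in> {1..i}. col_of lam t j = 1}"
  proof
    fix k assume "k \<in> (\<lambda>j. t (row_of lam t j, 1)) ` {j \<in> {1..i}. col_of lam t j = 2}"
    then obtain j where j: "j \<in> {j \<in> {1..i}. col_of lam t j = 2}" "k = t (row_of lam t j, 1)" by blast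
    show "k \<in> {j \<in> {1..i}. col_of lam t j = 1}"
      using b(2)[OF j(1)] box_of_entry(2,3)[OF b(1)[OF j(1)]] j by simp
  qed
qed simp

text \<open>A \<open>THE\<close> term can be used only after existence and uniqueness are known;
  both come from \<open>alternating\<close>.\<close>

lemma blocks: "is_block_decomposition lam t (blocks lam t)"
proof -
  let ?P = "\<lambda>i. col_of lam t i = 1"
  \<comment> \<open>Lying in column 2 agrees with not lying in column 1 only for entries in
    \<open>{1..n}\<close>; the equation for the concatenation ensures this.\<close>
  have iff: "is_block_decomposition lam t bs \<longleftrightarrow> alternating ?P [1..<Suc n] bs" for bs
  proof -
    have "(\<forall>(D, M)\<in>set bs. (\<forall>i\<in>set D. col_of lam t i = 1) \<and> (\<forall>i\<in>set M. col_of lam t i = 2)) \<longleftrightarrow>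
      (\<forall>(D, M)\<in>set bs. (\<forall>i\<in>set D. col_of lam t i = 1) \<and> (\<forall>i\<in>set M. \<not> col_of lam t i = 1))"
      if c: "concat (map (\<lambda>(D, M). D @ M) bs) = [1..<Suc n]"
    proof -
      have "col_of lam t i = 2 \<longleftrightarrow> \<not> col_of lam t i = 1" if "(D, M) \<in> set bs" "i \<in> set M" for D M i
      proof -
        have "i \<in> set (concat (map (\<lambda>(D, M). D @ M) bs))" using that by force
        then have "i \<in> {1..n}" unfolding c by auto
        from col_of_cases[OF this] show ?thesis by auto
      qed
      then show ?thesis by (intro ball_cong refl) (auto split: prod.splits)
    qed
    then show ?thesis unfolding is_block_decomposition_def alternating_def sum_lam by blast
  qed
  \<comment> \<open>The ballot condition for \<open>i = 1\<close> forces the entry 1 into the first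
    column.\<close>
  have "?P (hd [1..<Suc n])" if ne: "[1..<Suc n] \<noteq> []"
  proof -
    have "n \<noteq> 0"
    proof
      assume "n = 0"
      then show False using ne by simp
    qed
    then have 1: "1 \<in> {1..n}" "1 \<le> n" by auto
    have "col_of lam t 1 \<noteq> 2"
      using ballot[OF 1(2)] by (auto simp: col_count_Suc[of _ _ 0, simplified] col_count_0)
    then have "col_of lam t 1 = 1" using col_of_cases[OF 1(1)] by auto
    then show ?thesis using \<open>n \<noteq> 0\<close> by (simp add: upt_rec)
  qed
  then obtain bs where bs: "alternating ?P [1..<Suc n] bs" using ex_alternating[of "[1..<Suc n]" ?P] by blast
  show ?thesis unfolding blocks_def iff
    by (rule theI[of _ bs]) (rule bs, rule alternating_unique[OF _ bs])
qed

lemma content_eq_column_content: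
  "i \<in> {1..n} \<Longrightarrow> of_int (content lam t i) = column_content (col_of lam t) i"
  unfolding content_def column_content_def by (simp add: row_eq_col_count)

lemma f_diag_eigen:
  "\<exists>a. f_diag lam t \<in> Hom a n \<and>
    (\<forall>i\<in>{1..n}. jm_eigen a n (f_diag lam t) i (of_int (content lam t i)))"
proof -
  have "{} \<in> diagrams 0 0"
    by (simp add: diagrams_def points_def partition_on_def noncrossing_def)
  then have g: "Poly_Mapping.single {} 1 \<in> Hom 0 0" by (rule Hom_single)
  have "\<exists>a. f_diag lam t \<in> Hom a n \<and>
      (\<forall>i\<in>{1..n}. jm_eigen a n (f_diag lam t) i (column_content (col_of lam t) i))"
    unfolding f_diag_def
    by (rule g_from_eigen[OF _ _ g]) (use blocks col_of_cases ballot in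
      \<open>auto simp: is_block_decomposition_def sum_lam col_count_0\<close>)
  then show ?thesis by (metis content_eq_column_content)
qed

end

theorem theorem3p8:
  fixes n :: nat and lam :: "nat list" and t :: "nat \<times> nat \<Rightarrow> nat"
  assumes "lam \<in> Par2 n" and "t \<in> Std lam"
  shows "\<forall>i\<in>{1..n}.
    cell_act lam (f_tab lam t) (TL_JM n i) = cell_scale lam (of_int (content lam t i)) (f_tab lam t)"
proof
  fix i assume i: "i \<in> {1..n}"
  obtain a where f: "f_diag lam t \<in> Hom a n" and e: "jm_eigen a n (f_diag lam t) i (of_int (content lam t i))"
    using f_diag_eigen[OF assms] i by blast
  have L: "TL_JM n i \<in> TL n" by (rule TL_JM_in[OF i])
  then have L': "TL_JM n i \<in> TL (sum_list lam)" by (simp only: sum_lam[OF assms])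
  have "f_diag lam t \<odot> TL_JM n i = scale (of_int (content lam t i)) (f_diag lam t)"
  proof (rule realise_inject[OF dmult_Hom[OF f L[unfolded TL_def]] Hom_scale[OF f]])
    fix s u
    show "realise a n (f_diag lam t \<odot> TL_JM n i) s u = realise a n (scale (of_int (content lam t i)) (f_diag lam t)) s u"
      using e unfolding realise_dmult_JM[OF i f] realise_scale jm_eigen_def by simp
  qed
  then show "cell_act lam (f_tab lam t) (TL_JM n i) = cell_scale lam (of_int (content lam t i)) (f_tab lam t)"
    unfolding f_tab_def by (rule cell_act_eigenvector[OF L'])
qed

end
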